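(* Let $k$ be an algebraically closed field and let $C$ be a finite dimensional basic associative $k$-algebra of global dimension at most $2$. Let $1,\dots,n$ be the vertices of the quiver of $C$, and let $P=\bigoplus_{j=1}^n a_jP_C(j)$ be a finitely generated projective right $C$-module, where $P_C(j)$ is the indecomposable projective $C$-module at $j$ and $a_j\ge 0$ is its multiplicity. Let $R(C)=C\ltimes \mathrm{Ext}^2_C(DC,C)$ be the relation extension of $C$ and let $\overline{P}=\bigoplus_{j=1}^n a_jP_{R(C)}(j)$ be the projective right $R(C)$-module with the same multiplicities. Then there is an isomorphism of $k$-algebras $$R(C[P])\cong R(C)[\overline{P}],$$ where $C[P]$ and $R(C)[\overline P]$ denote one-point extensions.
   Context: All modules are finitely generated right modules, and $aM$ denotes the direct sum of $a$ copies of $M$. For a vertex $i$ of the ordinary quiver of a basic algebra $\Lambda$ with corresponding primitive idempotent $e_i$, $P_\Lambda(i)=e_i\Lambda$ is the indecomposable projective module at $i$. Relation extension: for an algebra $\Lambda$ of global dimension at most $2$, $R(\Lambda)=\Lambda\ltimes \mathrm{Ext}^2_\Lambda(D\Lambda,\Lambda)$ is the trivial extension of $\Lambda$ by the $\Lambda$-bimodule $\mathrm{Ext}^2_\Lambda(D\Lambda,\Lambda)$, where $D=\mathrm{Hom}_k(-,k)$; that is, the vector space $\Lambda\oplus\mathrm{Ext}^2_\Lambda(D\Lambda,\Lambda)$ with multiplication $(c,g)(c',g')=(cc',cg'+gc')$. The left action on $\mathrm{Ext}^2_\Lambda(D\Lambda,\Lambda)$ is induced by the left $\Lambda$-module structure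 of the second argument $\Lambda$, and the right action by the left $\Lambda$-module structure of $D\Lambda$. The quiver of $R(\Lambda)$ has the same vertices as the quiver of $\Lambda$. One-point extension: for a $k$-algebra $\Lambda$ and a right $\Lambda$-module $M$, $\Lambda[M]=\left[\begin{smallmatrix} \Lambda & 0 \\ M & k \end{smallmatrix}\right]$ is the algebra of matrices $\left[\begin{smallmatrix} a & 0 \\ m & \mu \end{smallmatrix}\right]$ with $a\in\Lambda$, $m\in M$, $\mu\in k$ and multiplication $$\left[\begin{smallmatrix} a & 0 \\ m & \mu \end{smallmatrix}\right]\left[\begin{smallmatrix} a' & 0 \\ m' & \mu' \end{smallmatrix}\right]=\left[\begin{smallmatrix} aa' & 0 \\ ma'+\mu m' & \mu\mu' \end{smallmatrix}\right].$$ When $C$ has global dimension at most $2$ and $P$ is projective, $C[P]$ also has global dimension at most $2$, so $R(C[P])$ is defined. *)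

theory Defs
  imports "HOL-Algebra.Algebra" "HOL-Library.Extended_Nat"
begin

section \<open>Algebras over a field\<close>

text \<open>The library locale \<open>algebra\<close> is restricted to commutative algebras.\<close>

locale k_algebra = K?: field K + module K A + A?: ring A
  for K (structure) and A (structure) +
  assumes smult_mult_left:
      "\<lbrakk> c \<in> carrier K; x \<in> carrier A; y \<in> carrier A \<rbrakk> \<Longrightarrow>
        (c \<odot>\<^bsub>A\<^esub> x) \<otimes>\<^bsub>A\<^esub> y = c \<odot>\<^bsub>A\<^esub> (x \<otimes>\<^bsub>A\<^esub> y)"
    and smult_mult_right:
      "\<lbrakk> c \<in> carrier K; x \<in> carrier A; y \<in> carrier A \<rbrakk> \<Longrightarrow>
        x \<otimes>\<^bsub>A\<^esub> (c \<odot>\<^bsub>A\<^esub> y) = c \<odot>\<^bsub>A\<^esub> (x \<otimes>\<^bsub>A\<^esub> y)"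

definition finite_dim :: "('k, 'r) ring_scheme \<Rightarrow> ('k, 'a, 's) module_scheme \<Rightarrow> bool" where
  "finite_dim K V \<longleftrightarrow>
    (\<exists>S. finite S \<and> S \<subseteq> carrier V \<and>
      (\<forall>x \<in> carrier V. \<exists>c \<in> S \<rightarrow> carrier K. x = (\<Oplus>\<^bsub>V\<^esub>s\<in>S. c s \<odot>\<^bsub>V\<^esub> s)))"

definition alg_iso ::
    "('k, 'r) ring_scheme \<Rightarrow> ('k, 'a, 's) module_scheme \<Rightarrow> ('k, 'b, 't) module_scheme \<Rightarrow> bool" where
  "alg_iso K A B \<longleftrightarrow>
    (\<exists>\<phi> \<in> ring_iso A B. \<forall>c \<in> carrier K. \<forall>x \<in> carrier A. \<phi> (c \<odot>\<^bsub>A\<^esub> x) = c \<odot>\<^bsub>B\<^esub> \<phi> x)"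


section \<open>Right modules and bimodules\<close>

text \<open>As in the library record \<open>module\<close>, the fields \<open>mult\<close> and \<open>one\<close> inherited from \<open>ring\<close>
  carry no meaning.\<close>

record ('a, 'm) rmodule = "'m ring" +
  ract :: "'m \<Rightarrow> 'a \<Rightarrow> 'm"

record ('a, 'm) bimodule = "('a, 'm) rmodule" +
  lact :: "'a \<Rightarrow> 'm \<Rightarrow> 'm"

locale right_module = R?: ring R + M?: abelian_group M
  for R :: "('a, 'r) ring_scheme" (structure) and M :: "('a, 'm, 'z) rmodule_scheme" (structure) +
  assumes ract_closed: "\<lbrakk> x \<in> carrier M; a \<in> carrier R \<rbrakk> \<Longrightarrow> ract M x a \<in> carrier M"
    and ract_add_left:
      "\<lbrakk> x \<in> carrier M; y \<in> carrier M; a \<in> carrier R \<rbrakk> \<Longrightarrow>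
        ract M (x \<oplus>\<^bsub>M\<^esub> y) a = ract M x a \<oplus>\<^bsub>M\<^esub> ract M y a"
    and ract_add_right:
      "\<lbrakk> x \<in> carrier M; a \<in> carrier R; b \<in> carrier R \<rbrakk> \<Longrightarrow>
        ract M x (a \<oplus>\<^bsub>R\<^esub> b) = ract M x a \<oplus>\<^bsub>M\<^esub> ract M x b"
    and ract_assoc:
      "\<lbrakk> x \<in> carrier M; a \<in> carrier R; b \<in> carrier R \<rbrakk> \<Longrightarrow>
        ract M x (a \<otimes>\<^bsub>R\<^esub> b) = ract M (ract M x a) b"
    and ract_one: "x \<in> carrier M \<Longrightarrow> ract M x \<one>\<^bsub>R\<^esub> = x"

definition fin_gen :: "('a, 'r) ring_scheme \<Rightarrow> ('a, 'm, 'z) rmodule_scheme \<Rightarrow> bool" where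
  "fin_gen R M \<longleftrightarrow>
    (\<exists>S. finite S \<and> S \<subseteq> carrier M \<and>
      (\<forall>x \<in> carrier M. \<exists>c \<in> S \<rightarrow> carrier R. x = (\<Oplus>\<^bsub>M\<^esub>s\<in>S. ract M s (c s))))"

text \<open>Homomorphisms are normalised to be \<open>undefined\<close> outside the carrier, so that equality of
  functions is equality of homomorphisms.\<close>

definition rhom ::
    "('a, 'r) ring_scheme \<Rightarrow> ('a, 'm, 'y) rmodule_scheme \<Rightarrow> ('a, 'n, 'z) rmodule_scheme \<Rightarrow> ('m \<Rightarrow> 'n) set" where
  "rhom R M N =
    {h \<in> carrier M \<rightarrow>\<^sub>E carrier N.
      (\<forall>x \<in> carrier M. \<forall>y \<in> carrier M. h (x \<oplus>\<^bsub>M\<^esub> y) = h x \<oplus>\<^bsub>N\<^esub> h y) \<and>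
      (\<forall>x \<in> carrier M. \<forall>a \<in> carrier R. h (ract M x a) = ract N (h x) a)}"

definition rhom_group ::
    "('a, 'r) ring_scheme \<Rightarrow> ('a, 'm, 'y) rmodule_scheme \<Rightarrow> ('a, 'n, 'z) rmodule_scheme \<Rightarrow> ('m \<Rightarrow> 'n) ring" where
  "rhom_group R M N =
    \<lparr>carrier = rhom R M N, monoid.mult = undefined, one = undefined,
     ring.zero = (\<lambda>x \<in> carrier M. \<zero>\<^bsub>N\<^esub>),
     ring.add = (\<lambda>f g. \<lambda>x \<in> carrier M. f x \<oplus>\<^bsub>N\<^esub> g x)\<rparr>"

definition rmod_iso ::
    "('a, 'r) ring_scheme \<Rightarrow> ('a, 'm, 'y) rmodule_scheme \<Rightarrow> ('a, 'n, 'z) rmodule_scheme \<Rightarrow> bool" where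
  "rmod_iso R M N \<longleftrightarrow> (\<exists>h \<in> rhom R M N. bij_betw h (carrier M) (carrier N))"

definition direct_sum :: "'i set \<Rightarrow> ('i \<Rightarrow> ('a, 'm) rmodule) \<Rightarrow> ('a, 'i \<Rightarrow> 'm) rmodule" where
  \<comment> \<open>direct sum of a finite family\<close>
  "direct_sum I M =
    \<lparr>carrier = (\<Pi>\<^sub>E i\<in>I. carrier (M i)), monoid.mult = undefined, one = undefined,
     ring.zero = (\<lambda>i\<in>I. \<zero>\<^bsub>M i\<^esub>),
     ring.add = (\<lambda>x y. \<lambda>i\<in>I. x i \<oplus>\<^bsub>M i\<^esub> y i),
     ract = (\<lambda>x a. \<lambda>i\<in>I. ract (M i) (x i) a)\<rparr>"

definition regular_bimod :: "('a, 'r) ring_scheme \<Rightarrow> ('a, 'a) bimodule" where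
  "regular_bimod R =
    \<lparr>carrier = carrier R, monoid.mult = undefined, one = undefined, ring.zero = \<zero>\<^bsub>R\<^esub>, ring.add = ring.add R,
     ract = monoid.mult R, lact = monoid.mult R\<rparr>"

definition dual_bimod ::
    "('k, 'r) ring_scheme \<Rightarrow> ('k, 'a, 's) module_scheme \<Rightarrow> ('a, 'a \<Rightarrow> 'k) bimodule" where
  \<comment> \<open>\<open>D A = Hom_k(A, k)\<close> with \<open>(\<phi> a)(x) = \<phi>(a x)\<close> and \<open>(a \<phi>)(x) = \<phi>(x a)\<close>\<close>
  "dual_bimod K A =
    \<lparr>carrier =
       {\<phi> \<in> carrier A \<rightarrow>\<^sub>E carrier K.
         (\<forall>x \<in> carrier A. \<forall>y \<in> carrier A. \<phi> (x \<oplus>\<^bsub>A\<^esub> y) = \<phi> x \<oplus>\<^bsub>K\<^esub> \<phi> y) \<and>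
         (\<forall>c \<in> carrier K. \<forall>x \<in> carrier A. \<phi> (c \<odot>\<^bsub>A\<^esub> x) = c \<otimes>\<^bsub>K\<^esub> \<phi> x)},
     monoid.mult = undefined, one = undefined,
     ring.zero = (\<lambda>x \<in> carrier A. \<zero>\<^bsub>K\<^esub>),
     ring.add = (\<lambda>\<phi> \<psi>. \<lambda>x \<in> carrier A. \<phi> x \<oplus>\<^bsub>K\<^esub> \<psi> x),
     ract = (\<lambda>\<phi> a. \<lambda>x \<in> carrier A. \<phi> (a \<otimes>\<^bsub>A\<^esub> x)),
     lact = (\<lambda>a \<phi>. \<lambda>x \<in> carrier A. \<phi> (x \<otimes>\<^bsub>A\<^esub> a))\<rparr>"


section \<open>Projective resolutions and global dimension\<close>

text \<open>
  A definition cannot quantify over types. Test modules and the terms of resolutions are therefore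
  carried by the type \<open>nat \<Rightarrow> 'a\<close>, where \<open>'a\<close> is the element type of the ring. Nothing is lost: a
  finitely generated right \<open>R\<close>-module is isomorphic to a quotient of some \<open>R\<^sup>m\<close>, and choosing a
  representative in each coset transports its structure to a subset of \<open>R\<^sup>m\<close>, hence of \<open>nat \<Rightarrow> 'a\<close>.
\<close>

definition fg_projective :: "('a, 'r) ring_scheme \<Rightarrow> ('a, 'm, 'z) rmodule_scheme \<Rightarrow> bool" where
  \<comment> \<open>projective object of the category of finitely generated right \<open>R\<close>-modules\<close>
  "fg_projective R P \<longleftrightarrow>
    right_module R P \<and> fin_gen R P \<and>
    (\<forall>(M :: ('a, nat \<Rightarrow> 'a) rmodule) (N :: ('a, nat \<Rightarrow> 'a) rmodule).
      \<forall>g \<in> rhom R M N. \<forall>h \<in> rhom R P N.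
        right_module R M \<and> fin_gen R M \<and> right_module R N \<and> fin_gen R N \<and>
        g ` carrier M = carrier N \<longrightarrow>
        (\<exists>l \<in> rhom R P M. \<forall>x \<in> carrier P. g (l x) = h x))"

text \<open>\<open>\<dots> \<rightarrow> Q\<^sub>2 \<rightarrow> Q\<^sub>1 \<rightarrow> Q\<^sub>0 \<rightarrow> V \<rightarrow> 0\<close>, where \<open>rdiff Q i\<close> maps \<open>Q\<^sub>i\<^sub>+\<^sub>1\<close> to \<open>Q\<^sub>i\<close>.\<close>

record ('a, 'm, 'x) resolution =
  rterm :: "nat \<Rightarrow> ('a, 'm) rmodule"
  rdiff :: "nat \<Rightarrow> 'm \<Rightarrow> 'm"
  raug :: "'m \<Rightarrow> 'x"

definition proj_resolution ::
    "('a, 'r) ring_scheme \<Rightarrow> ('a, 'x, 'z) rmodule_scheme \<Rightarrow> ('a, 'm, 'x) resolution \<Rightarrow> bool" where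
  "proj_resolution R V Q \<longleftrightarrow>
    (\<forall>i. fg_projective R (rterm Q i)) \<and>
    (\<forall>i. rdiff Q i \<in> rhom R (rterm Q (Suc i)) (rterm Q i)) \<and>
    raug Q \<in> rhom R (rterm Q 0) V \<and>
    raug Q ` carrier (rterm Q 0) = carrier V \<and>
    rdiff Q 0 ` carrier (rterm Q 1) = {x \<in> carrier (rterm Q 0). raug Q x = \<zero>\<^bsub>V\<^esub>} \<and>
    (\<forall>i. rdiff Q (Suc i) ` carrier (rterm Q (Suc (Suc i))) =
      {x \<in> carrier (rterm Q (Suc i)). rdiff Q i x = \<zero>\<^bsub>rterm Q i\<^esub>})"

definition proj_dim :: "('a, 'r) ring_scheme \<Rightarrow> ('a, 'x, 'z) rmodule_scheme \<Rightarrow> enat" where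
  "proj_dim R V =
    Inf {enat n | n. \<exists>Q :: ('a, nat \<Rightarrow> 'a, 'x) resolution.
      proj_resolution R V Q \<and> (\<forall>i > n. carrier (rterm Q i) = {\<zero>\<^bsub>rterm Q i\<^esub>})}"

definition gl_dim :: "('a, 'r) ring_scheme \<Rightarrow> enat" where
  "gl_dim R =
    Sup {proj_dim R M | M :: ('a, nat \<Rightarrow> 'a) rmodule. right_module R M \<and> fin_gen R M}"


section \<open>Ext\<close>

text \<open>\<open>Ext\<^sup>n(V, W)\<close> is the \<open>n\<close>-th cohomology group of \<open>Hom(Q, W)\<close> for a chosen projective
  resolution \<open>Q\<close> of \<open>V\<close>. Its elements are cosets of the group of coboundaries.\<close>

definition chosen_res ::
    "('a, 'r) ring_scheme \<Rightarrow> ('a, 'x, 'z) rmodule_scheme \<Rightarrow> ('a, nat \<Rightarrow> 'a, 'x) resolution" where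
  "chosen_res R V = (SOME Q. proj_resolution R V Q)"

definition ext_cochains ::
    "('a, 'r) ring_scheme \<Rightarrow> nat \<Rightarrow> ('a, 'x, 'z) rmodule_scheme \<Rightarrow> ('a, 'y, 'w) rmodule_scheme \<Rightarrow>
      ((nat \<Rightarrow> 'a) \<Rightarrow> 'y) ring" where
  "ext_cochains R n V W = rhom_group R (rterm (chosen_res R V) n) W"

definition ext_cocycles ::
    "('a, 'r) ring_scheme \<Rightarrow> nat \<Rightarrow> ('a, 'x, 'z) rmodule_scheme \<Rightarrow> ('a, 'y, 'w) rmodule_scheme \<Rightarrow>
      ((nat \<Rightarrow> 'a) \<Rightarrow> 'y) set" where
  "ext_cocycles R n V W =
    {f \<in> carrier (ext_cochains R n V W).
      \<forall>q \<in> carrier (rterm (chosen_res R V) (Suc n)). f (rdiff (chosen_res R V) n q) = \<zero>\<^bsub>W\<^esub>}"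

definition ext_coboundaries ::
    "('a, 'r) ring_scheme \<Rightarrow> nat \<Rightarrow> ('a, 'x, 'z) rmodule_scheme \<Rightarrow> ('a, 'y, 'w) rmodule_scheme \<Rightarrow>
      ((nat \<Rightarrow> 'a) \<Rightarrow> 'y) set" where
  "ext_coboundaries R n V W =
    (case n of
      0 \<Rightarrow> {\<zero>\<^bsub>ext_cochains R 0 V W\<^esub>}
    | Suc m \<Rightarrow>
        (\<lambda>g. compose (carrier (rterm (chosen_res R V) n)) g (rdiff (chosen_res R V) m)) `
          carrier (ext_cochains R m V W))"

definition ext_class ::
    "('a, 'r) ring_scheme \<Rightarrow> nat \<Rightarrow> ('a, 'x, 'z) rmodule_scheme \<Rightarrow> ('a, 'y, 'w) rmodule_scheme \<Rightarrow>
      ((nat \<Rightarrow> 'a) \<Rightarrow> 'y) \<Rightarrow> ((nat \<Rightarrow> 'a) \<Rightarrow> 'y) set" where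
  "ext_class R n V W f = ext_coboundaries R n V W +>\<^bsub>ext_cochains R n V W\<^esub> f"

text \<open>Functoriality. The class of the composite does not depend on the representative \<open>f\<close> of
  \<open>\<xi>\<close> or on the lift \<open>\<phi>\<close>, so each of the two unions is a single coset.\<close>

definition ext_push ::
    "('a, 'r) ring_scheme \<Rightarrow> nat \<Rightarrow> ('a, 'x, 'z) rmodule_scheme \<Rightarrow> ('a, 'y, 'w) rmodule_scheme \<Rightarrow>
      ('y \<Rightarrow> 'y) \<Rightarrow> ((nat \<Rightarrow> 'a) \<Rightarrow> 'y) set \<Rightarrow> ((nat \<Rightarrow> 'a) \<Rightarrow> 'y) set" where
  \<comment> \<open>\<open>Ext\<^sup>n(V, h)\<close> for an endomorphism \<open>h\<close> of \<open>W\<close>\<close>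
  "ext_push R n V W h \<xi> =
    (\<Union>f \<in> \<xi>. ext_class R n V W (compose (carrier (rterm (chosen_res R V) n)) h f))"

definition chain_lift ::
    "('a, 'r) ring_scheme \<Rightarrow> ('a, 'm, 'x) resolution \<Rightarrow> ('x \<Rightarrow> 'x) \<Rightarrow> (nat \<Rightarrow> 'm \<Rightarrow> 'm) \<Rightarrow> bool" where
  "chain_lift R Q h \<phi> \<longleftrightarrow>
    (\<forall>i. \<phi> i \<in> rhom R (rterm Q i) (rterm Q i)) \<and>
    (\<forall>q \<in> carrier (rterm Q 0). raug Q (\<phi> 0 q) = h (raug Q q)) \<and>
    (\<forall>i. \<forall>q \<in> carrier (rterm Q (Suc i)). rdiff Q i (\<phi> (Suc i) q) = \<phi> i (rdiff Q i q))"

definition ext_pull ::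
    "('a, 'r) ring_scheme \<Rightarrow> nat \<Rightarrow> ('a, 'x, 'z) rmodule_scheme \<Rightarrow> ('a, 'y, 'w) rmodule_scheme \<Rightarrow>
      ('x \<Rightarrow> 'x) \<Rightarrow> ((nat \<Rightarrow> 'a) \<Rightarrow> 'y) set \<Rightarrow> ((nat \<Rightarrow> 'a) \<Rightarrow> 'y) set" where
  \<comment> \<open>\<open>Ext\<^sup>n(h, W)\<close> for an endomorphism \<open>h\<close> of \<open>V\<close>\<close>
  "ext_pull R n V W h \<xi> =
    (\<Union>f \<in> \<xi>. \<Union>\<phi> \<in> {\<phi>. chain_lift R (chosen_res R V) h \<phi>}.
      ext_class R n V W (compose (carrier (rterm (chosen_res R V) n)) f (\<phi> n)))"

text \<open>For bimodules \<open>V\<close> and \<open>W\<close>, the left action on \<open>Ext\<^sup>n(V, W)\<close> comes from the left action on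
  \<open>W\<close>, and the right action from the left action on \<open>V\<close>.\<close>

definition ext_bimod ::
    "('a, 'r) ring_scheme \<Rightarrow> nat \<Rightarrow> ('a, 'x, 'z) bimodule_scheme \<Rightarrow> ('a, 'y, 'w) bimodule_scheme \<Rightarrow>
      ('a, ((nat \<Rightarrow> 'a) \<Rightarrow> 'y) set) bimodule" where
  "ext_bimod R n V W =
    \<lparr>carrier = ext_class R n V W ` ext_cocycles R n V W,
     monoid.mult = undefined, one = undefined,
     ring.zero = ext_coboundaries R n V W,
     ring.add = set_add (ext_cochains R n V W),
     ract = (\<lambda>\<xi> a. ext_pull R n V W (lact V a) \<xi>),
     lact = (\<lambda>a \<xi>. ext_push R n V W (lact W a) \<xi>)\<rparr>"


section \<open>Trivial, relation and one-point extensions\<close>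

text \<open>A scalar \<open>c\<close> acts on a module over the algebra \<open>A\<close> as the element \<open>c \<odot> \<one>\<close> of \<open>A\<close>.\<close>

definition trivial_ext ::
    "('k, 'a, 's) module_scheme \<Rightarrow> ('a, 'e, 'z) bimodule_scheme \<Rightarrow> ('k, 'a \<times> 'e) module" where
  "trivial_ext A E =
    \<lparr>carrier = carrier A \<times> carrier E,
     monoid.mult = (\<lambda>(c, g) (c', g'). (c \<otimes>\<^bsub>A\<^esub> c', lact E c g' \<oplus>\<^bsub>E\<^esub> ract E g c')),
     one = (\<one>\<^bsub>A\<^esub>, \<zero>\<^bsub>E\<^esub>),
     ring.zero = (\<zero>\<^bsub>A\<^esub>, \<zero>\<^bsub>E\<^esub>),
     ring.add = (\<lambda>(c, g) (c', g'). (c \<oplus>\<^bsub>A\<^esub> c', g \<oplus>\<^bsub>E\<^esub> g')),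
     smult = (\<lambda>t (c, g). (t \<odot>\<^bsub>A\<^esub> c, lact E (t \<odot>\<^bsub>A\<^esub> \<one>\<^bsub>A\<^esub>) g))\<rparr>"

definition ext2_bimod ::
    "('k, 'r) ring_scheme \<Rightarrow> ('k, 'a, 's) module_scheme \<Rightarrow> ('a, ((nat \<Rightarrow> 'a) \<Rightarrow> 'a) set) bimodule" where
  "ext2_bimod K A = ext_bimod A 2 (dual_bimod K A) (regular_bimod A)"

definition relation_ext ::
    "('k, 'r) ring_scheme \<Rightarrow> ('k, 'a, 's) module_scheme \<Rightarrow>
      ('k, 'a \<times> ((nat \<Rightarrow> 'a) \<Rightarrow> 'a) set) module" where
  "relation_ext K A = trivial_ext A (ext2_bimod K A)"

definition one_point_ext ::
    "('k, 'r) ring_scheme \<Rightarrow> ('k, 'a, 's) module_scheme \<Rightarrow> ('a, 'm, 'z) rmodule_scheme \<Rightarrow>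
      ('k, 'a \<times> 'm \<times> 'k) module" where
  \<comment> \<open>\<open>(a, m, \<mu>)\<close> is the matrix with first row \<open>(a, 0)\<close> and second row \<open>(m, \<mu>)\<close>\<close>
  "one_point_ext K A M =
    \<lparr>carrier = carrier A \<times> carrier M \<times> carrier K,
     monoid.mult = (\<lambda>(a, m, \<mu>) (a', m', \<mu>').
       (a \<otimes>\<^bsub>A\<^esub> a', ract M m a' \<oplus>\<^bsub>M\<^esub> ract M m' (\<mu> \<odot>\<^bsub>A\<^esub> \<one>\<^bsub>A\<^esub>), \<mu> \<otimes>\<^bsub>K\<^esub> \<mu>')),
     one = (\<one>\<^bsub>A\<^esub>, \<zero>\<^bsub>M\<^esub>, \<one>\<^bsub>K\<^esub>),
     ring.zero = (\<zero>\<^bsub>A\<^esub>, \<zero>\<^bsub>M\<^esub>, \<zero>\<^bsub>K\<^esub>),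
     ring.add = (\<lambda>(a, m, \<mu>) (a', m', \<mu>'). (a \<oplus>\<^bsub>A\<^esub> a', m \<oplus>\<^bsub>M\<^esub> m', \<mu> \<oplus>\<^bsub>K\<^esub> \<mu>')),
     smult = (\<lambda>t (a, m, \<mu>). (t \<odot>\<^bsub>A\<^esub> a, ract M m (t \<odot>\<^bsub>A\<^esub> \<one>\<^bsub>A\<^esub>), t \<otimes>\<^bsub>K\<^esub> \<mu>))\<rparr>"


section \<open>Primitive idempotents and basic algebras\<close>

definition primitive_idem :: "('a, 'r) ring_scheme \<Rightarrow> 'a \<Rightarrow> bool" where
  "primitive_idem R e \<longleftrightarrow>
    e \<in> carrier R \<and> e \<otimes>\<^bsub>R\<^esub> e = e \<and> e \<noteq> \<zero>\<^bsub>R\<^esub> \<and>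
    \<not> (\<exists>f \<in> carrier R. \<exists>g \<in> carrier R.
        f \<otimes>\<^bsub>R\<^esub> f = f \<and> g \<otimes>\<^bsub>R\<^esub> g = g \<and> f \<otimes>\<^bsub>R\<^esub> g = \<zero>\<^bsub>R\<^esub> \<and> g \<otimes>\<^bsub>R\<^esub> f = \<zero>\<^bsub>R\<^esub> \<and>
        f \<noteq> \<zero>\<^bsub>R\<^esub> \<and> g \<noteq> \<zero>\<^bsub>R\<^esub> \<and> e = f \<oplus>\<^bsub>R\<^esub> g)"

definition complete_idems :: "('a, 'r) ring_scheme \<Rightarrow> nat \<Rightarrow> (nat \<Rightarrow> 'a) \<Rightarrow> bool" where
  \<comment> \<open>\<open>e\<^sub>1, \<dots>, e\<^sub>n\<close> is a complete set of primitive orthogonal idempotents\<close>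
  "complete_idems R n e \<longleftrightarrow>
    (\<forall>i \<in> {1..n}. primitive_idem R (e i)) \<and>
    (\<forall>i \<in> {1..n}. \<forall>j \<in> {1..n}. i \<noteq> j \<longrightarrow> e i \<otimes>\<^bsub>R\<^esub> e j = \<zero>\<^bsub>R\<^esub>) \<and>
    (\<Oplus>\<^bsub>R\<^esub>i\<in>{1..n}. e i) = \<one>\<^bsub>R\<^esub>"

definition idem_module :: "('a, 'r) ring_scheme \<Rightarrow> 'a \<Rightarrow> ('a, 'a) rmodule" where
  \<comment> \<open>the right ideal \<open>e R\<close>\<close>
  "idem_module R e =
    \<lparr>carrier = {e \<otimes>\<^bsub>R\<^esub> x | x. x \<in> carrier R}, monoid.mult = undefined, one = undefined,
     ring.zero = \<zero>\<^bsub>R\<^esub>, ring.add = ring.add R, ract = monoid.mult R\<rparr>"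

definition basic_algebra :: "('a, 'r) ring_scheme \<Rightarrow> bool" where
  "basic_algebra R \<longleftrightarrow>
    (\<exists>n e. complete_idems R n e \<and>
      (\<forall>i \<in> {1..n}. \<forall>j \<in> {1..n}. i \<noteq> j \<longrightarrow>
        \<not> rmod_iso R (idem_module R (e i)) (idem_module R (e j))))"

text \<open>The vertices of the ordinary quiver of a basic algebra are \<open>1, \<dots>, n\<close>, where
  \<open>e\<^sub>1, \<dots>, e\<^sub>n\<close> is a complete set of primitive orthogonal idempotents, and the indecomposable
  projective at the vertex \<open>j\<close> is \<open>e\<^sub>j R\<close>. The following is the direct sum of \<open>a\<^sub>j\<close> copies of
  \<open>e\<^sub>j R\<close> for \<open>j = 1, \<dots>, n\<close>; the index \<open>(j, l)\<close> is the \<open>l\<close>-th copy of \<open>e\<^sub>j R\<close>.\<close>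

definition proj_sum ::
    "('a, 'r) ring_scheme \<Rightarrow> nat \<Rightarrow> (nat \<Rightarrow> 'a) \<Rightarrow> (nat \<Rightarrow> nat) \<Rightarrow> ('a, nat \<times> nat \<Rightarrow> 'a) rmodule" where
  "proj_sum R n e a =
    direct_sum (SIGMA j:{1..n}. {..<a j}) (\<lambda>(j, l). idem_module R (e j))"

definition relation_ext_idem ::
    "('k, 'r) ring_scheme \<Rightarrow> ('k, 'a, 's) module_scheme \<Rightarrow> 'a \<Rightarrow> 'a \<times> ((nat \<Rightarrow> 'a) \<Rightarrow> 'a) set" where
  \<comment> \<open>an idempotent \<open>x\<close> of \<open>A\<close> viewed in the relation extension of \<open>A\<close>, which has the same
      vertices as \<open>A\<close>\<close>
  "relation_ext_idem K A x = (x, \<zero>\<^bsub>ext2_bimod K A\<^esub>)"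

end

theory Submission
  imports Defs
begin

text \<open>
  Write \<open>B = C[P]\<close> and let \<open>e\<^sub>0\<close> be the idempotent of the new vertex. The quotient of \<open>DB\<close> by its
  submodule \<open>DC\<close> is a sum of copies of the simple module at the new vertex, whose projective
  resolution is \<open>0 \<rightarrow> P \<rightarrow> e\<^sub>0 B\<close>. Hence in a projective resolution \<open>T\<close> of \<open>DB\<close> the preimage of \<open>DC\<close> in
  \<open>T\<^sub>0\<close> is again projective, and replacing \<open>T\<^sub>0\<close> by it gives a projective resolution of \<open>DC\<close> over \<open>B\<close>.
  A projective resolution of \<open>DC\<close> over \<open>C\<close> is another one, because \<open>C\<close> is projective over \<open>B\<close>.
  Comparing the two yields \<open>Ext\<^sup>2\<^sub>B(DB, B) \<cong> Ext\<^sup>2\<^sub>C(DC, C \<oplus> P)\<close>, which is the direct sum of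
  \<open>E = Ext\<^sup>2\<^sub>C(DC, C)\<close> and of \<open>a\<^sub>j\<close> copies of \<open>e\<^sub>j E\<close> for each \<open>j\<close>. Since \<open>e\<^sub>j R(C) = e\<^sub>j C \<oplus> e\<^sub>j E\<close>, these
  are the components by which \<open>R(C)[P']\<close>, for the \<open>R(C)\<close>-module \<open>P'\<close> with the multiplicities of \<open>P\<close>,
  exceeds \<open>C[P]\<close>.
\<close>

section \<open>Homomorphisms of right modules\<close>

text \<open>\<open>Ext\<close> is computed from a resolution picked by \<open>SOME\<close>, of which
  only exactness and projectivity are known. A resolution of \<open>DB\<close> can therefore not be
  built to suit; it is altered in degree 0 alone, so that degrees 1 to 3, and with them the second
  cohomology, stay literally the same. The definition of projectivity tests lifting against modules
  whose elements lie in a type tied to the ring. That type differs for \<open>B\<close> and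
  \<open>C\<close>, yet a resolution over \<open>C\<close> must serve as one over \<open>B\<close>.
  Projectivity is therefore handled as existence of a finite dual basis, which moves freely between
  element types and along the surjection of \<open>B\<close> onto \<open>C\<close>: a functional
  with values \<open>c\<close> becomes one with values \<open>(c, 0, 0)\<close>. The same criterion
  yields the projectivity of the altered term by an explicit formula for its identity map. A
  \<open>B\<close>-linear map from a \<open>C\<close>-module to \<open>B\<close> has corner entry
  zero, because \<open>(1, 0, 0)\<close> acts as the identity on its source. This is how
  \<open>C \<oplus> P\<close> takes the place of \<open>B\<close>, and why the left action of
  \<open>B\<close> on \<open>Ext\<close> becomes a product of matrices with a zero corner.\<close>

lemma right_module_ring: "right_module R M \<Longrightarrow> ring R"
  by (simp add: right_module_def)

lemma right_module_abelian_group: "right_module R M \<Longrightarrow> abelian_group M"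
  by (simp add: right_module_def)

lemma right_moduleI:
  assumes "ring R" "abelian_group M"
    and "\<And>x a. x \<in> carrier M \<Longrightarrow> a \<in> carrier R \<Longrightarrow> ract M x a \<in> carrier M"
    and "\<And>x y a. x \<in> carrier M \<Longrightarrow> y \<in> carrier M \<Longrightarrow> a \<in> carrier R \<Longrightarrow>
        ract M (x \<oplus>\<^bsub>M\<^esub> y) a = ract M x a \<oplus>\<^bsub>M\<^esub> ract M y a"
    and "\<And>x a b. x \<in> carrier M \<Longrightarrow> a \<in> carrier R \<Longrightarrow> b \<in> carrier R \<Longrightarrow>
        ract M x (a \<oplus>\<^bsub>R\<^esub> b) = ract M x a \<oplus>\<^bsub>M\<^esub> ract M x b"
    and "\<And>x a b. x \<in> carrier M \<Longrightarrow> a \<in> carrier R \<Longrightarrow> b \<in> carrier R \<Longrightarrow>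
        ract M x (a \<otimes>\<^bsub>R\<^esub> b) = ract M (ract M x a) b"
    and "\<And>x. x \<in> carrier M \<Longrightarrow> ract M x \<one>\<^bsub>R\<^esub> = x"
  shows "right_module R M"
  using assms unfolding right_module_def right_module_axioms_def by blast

context right_module
begin

lemma ract_zero_left:
  assumes "a \<in> carrier R"
  shows "ract M \<zero>\<^bsub>M\<^esub> a = \<zero>\<^bsub>M\<^esub>"
proof -
  have "ract M \<zero>\<^bsub>M\<^esub> a \<oplus>\<^bsub>M\<^esub> ract M \<zero>\<^bsub>M\<^esub> a = ract M \<zero>\<^bsub>M\<^esub> a"
    using ract_add_left[of "\<zero>\<^bsub>M\<^esub>" "\<zero>\<^bsub>M\<^esub>" a] assms by simp
  then show ?thesis
    by (metis M.add.l_cancel_one' M.zero_closed assms ract_closed)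
qed

lemma ract_zero_right:
  assumes "x \<in> carrier M"
  shows "ract M x \<zero>\<^bsub>R\<^esub> = \<zero>\<^bsub>M\<^esub>"
proof -
  have "ract M x \<zero>\<^bsub>R\<^esub> \<oplus>\<^bsub>M\<^esub> ract M x \<zero>\<^bsub>R\<^esub> = ract M x \<zero>\<^bsub>R\<^esub>"
    using ract_add_right[of x "\<zero>\<^bsub>R\<^esub>" "\<zero>\<^bsub>R\<^esub>"] assms by simp
  then show ?thesis
    by (metis M.add.l_cancel_one' R.zero_closed assms ract_closed)
qed

lemma ract_minus_left:
  assumes "x \<in> carrier M" "a \<in> carrier R"
  shows "ract M (\<ominus>\<^bsub>M\<^esub> x) a = \<ominus>\<^bsub>M\<^esub> ract M x a"
proof -
  have "ract M (\<ominus>\<^bsub>M\<^esub> x) a \<oplus>\<^bsub>M\<^esub> ract M x a = \<zero>\<^bsub>M\<^esub>"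
    using ract_add_left[of "\<ominus>\<^bsub>M\<^esub> x" x a] assms by (simp add: M.l_neg ract_zero_left)
  then show ?thesis
    using assms by (simp add: M.minus_equality ract_closed)
qed

end

lemma rhomI:
  assumes "\<And>x. x \<in> carrier M \<Longrightarrow> F x \<in> carrier N"
    and "\<And>x y. x \<in> carrier M \<Longrightarrow> y \<in> carrier M \<Longrightarrow> F (x \<oplus>\<^bsub>M\<^esub> y) = F x \<oplus>\<^bsub>N\<^esub> F y"
    and "\<And>x a. x \<in> carrier M \<Longrightarrow> a \<in> carrier R \<Longrightarrow> F (ract M x a) = ract N (F x) a"
    and "right_module R M"
  shows "(\<lambda>x\<in>carrier M. F x) \<in> rhom R M N"
proof -
  interpret right_module R M by fact
  show ?thesis
    using assms(1-3) ract_closed by (auto simp: rhom_def)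
qed

lemma rhom_closed: "h \<in> rhom R M N \<Longrightarrow> x \<in> carrier M \<Longrightarrow> h x \<in> carrier N"
  by (auto simp: rhom_def)

lemma rhom_add:
  "h \<in> rhom R M N \<Longrightarrow> x \<in> carrier M \<Longrightarrow> y \<in> carrier M \<Longrightarrow> h (x \<oplus>\<^bsub>M\<^esub> y) = h x \<oplus>\<^bsub>N\<^esub> h y"
  by (auto simp: rhom_def)

lemma rhom_ract:
  "h \<in> rhom R M N \<Longrightarrow> x \<in> carrier M \<Longrightarrow> a \<in> carrier R \<Longrightarrow> h (ract M x a) = ract N (h x) a"
  by (auto simp: rhom_def)

lemma rhom_eqI:
  assumes "f \<in> rhom R M N" "g \<in> rhom R' M N'" "\<And>x. x \<in> carrier M \<Longrightarrow> f x = g x"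
  shows "f = g"
  using assms by (auto simp: rhom_def PiE_def intro: extensionalityI)

lemma rhom_restrict: "h \<in> rhom R M N \<Longrightarrow> (\<lambda>x\<in>carrier M. h x) = h"
  by (auto simp: rhom_def PiE_def extensional_restrict)

lemma rhom_zero:
  assumes "h \<in> rhom R M N" "abelian_group M" "abelian_group N"
  shows "h \<zero>\<^bsub>M\<^esub> = \<zero>\<^bsub>N\<^esub>"
proof -
  interpret M: abelian_group M by fact
  interpret N: abelian_group N by fact
  have "h \<zero>\<^bsub>M\<^esub> \<oplus>\<^bsub>N\<^esub> h \<zero>\<^bsub>M\<^esub> = h \<zero>\<^bsub>M\<^esub>"
    using rhom_add[OF assms(1), of "\<zero>\<^bsub>M\<^esub>" "\<zero>\<^bsub>M\<^esub>"] by simp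
  then show ?thesis
    by (metis N.add.l_cancel_one' M.zero_closed assms(1) rhom_closed)
qed

lemma rhom_minus:
  assumes "h \<in> rhom R M N" "abelian_group M" "abelian_group N" "x \<in> carrier M"
  shows "h (\<ominus>\<^bsub>M\<^esub> x) = \<ominus>\<^bsub>N\<^esub> h x"
proof -
  interpret M: abelian_group M by fact
  interpret N: abelian_group N by fact
  have "h (\<ominus>\<^bsub>M\<^esub> x) \<oplus>\<^bsub>N\<^esub> h x = \<zero>\<^bsub>N\<^esub>"
    using rhom_add[OF assms(1), of "\<ominus>\<^bsub>M\<^esub> x" x] assms by (simp add: M.l_neg rhom_zero)
  then show ?thesis
    using assms by (simp add: N.minus_equality rhom_closed)
qed

lemma rhom_diff:
  assumes "h \<in> rhom R M N" "abelian_group M" "abelian_group N" "x \<in> carrier M" "y \<in> carrier M"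
  shows "h (x \<ominus>\<^bsub>M\<^esub> y) = h x \<ominus>\<^bsub>N\<^esub> h y"
proof -
  interpret M: abelian_group M by fact
  show ?thesis
    using assms by (simp add: a_minus_def rhom_add rhom_minus)
qed

lemma zero_rhom:
  assumes "right_module R M" "right_module R N"
  shows "(\<lambda>x\<in>carrier M. \<zero>\<^bsub>N\<^esub>) \<in> rhom R M N"
proof -
  interpret N: right_module R N by fact
  show ?thesis
    using assms(1) by (intro rhomI) (simp_all add: N.ract_zero_left)
qed

lemma id_rhom:
  assumes "right_module R M"
  shows "(\<lambda>x\<in>carrier M. x) \<in> rhom R M M"
  using assms by (intro rhomI) simp_all

lemma compose_rhom:
  assumes "f \<in> rhom R L M" "g \<in> rhom R M N" "right_module R L"
  shows "compose (carrier L) g f \<in> rhom R L N"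
  unfolding compose_def
  using assms by (intro rhomI) (simp_all add: rhom_closed[OF assms(1)] rhom_closed[OF assms(2)]
      rhom_add[OF assms(1)] rhom_add[OF assms(2)] rhom_ract[OF assms(1)] rhom_ract[OF assms(2)])

lemma plus_rhom:
  assumes f: "f \<in> rhom R M N" and g: "g \<in> rhom R M N" and M: "right_module R M" and N: "right_module R N"
  shows "(\<lambda>x\<in>carrier M. f x \<oplus>\<^bsub>N\<^esub> g x) \<in> rhom R M N"
proof -
  interpret N: right_module R N by fact
  show ?thesis
  proof (rule rhomI[OF _ _ _ M])
    fix x y assume "x \<in> carrier M" "y \<in> carrier M"
    then show "f (x \<oplus>\<^bsub>M\<^esub> y) \<oplus>\<^bsub>N\<^esub> g (x \<oplus>\<^bsub>M\<^esub> y) = f x \<oplus>\<^bsub>N\<^esub> g x \<oplus>\<^bsub>N\<^esub> (f y \<oplus>\<^bsub>N\<^esub> g y)"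
      using rhom_closed[OF f] rhom_closed[OF g]
      by (simp add: rhom_add[OF f] rhom_add[OF g] N.M.a_ac)
  qed (simp_all add: rhom_closed[OF f] rhom_closed[OF g] rhom_ract[OF f] rhom_ract[OF g] N.ract_add_left)
qed

lemma minus_rhom:
  assumes f: "f \<in> rhom R M N" and M: "right_module R M" and N: "right_module R N"
  shows "(\<lambda>x\<in>carrier M. \<ominus>\<^bsub>N\<^esub> f x) \<in> rhom R M N"
proof -
  interpret N: right_module R N by fact
  show ?thesis
    by (rule rhomI[OF _ _ _ M]) (simp_all add: rhom_closed[OF f] rhom_add[OF f]
        rhom_ract[OF f] N.ract_minus_left N.M.minus_add)
qed

lemma diff_rhom:
  assumes f: "f \<in> rhom R M N" and g: "g \<in> rhom R M N" and M: "right_module R M" and N: "right_module R N"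
  shows "(\<lambda>x\<in>carrier M. f x \<ominus>\<^bsub>N\<^esub> g x) \<in> rhom R M N"
proof -
  have "(\<lambda>x\<in>carrier M. f x \<ominus>\<^bsub>N\<^esub> g x) = (\<lambda>x\<in>carrier M. f x \<oplus>\<^bsub>N\<^esub> (\<lambda>x\<in>carrier M. \<ominus>\<^bsub>N\<^esub> g x) x)"
    by (auto simp: a_minus_def)
  then show ?thesis
    using plus_rhom[OF f minus_rhom[OF g M N] M N] by simp
qed

section \<open>The regular module, submodules and restriction of scalars\<close>

lemma regular_simps [simp]:
  "carrier (regular_bimod R) = carrier R" "\<zero>\<^bsub>regular_bimod R\<^esub> = \<zero>\<^bsub>R\<^esub>"
  "x \<oplus>\<^bsub>regular_bimod R\<^esub> y = x \<oplus>\<^bsub>R\<^esub> y" "ract (regular_bimod R) x y = x \<otimes>\<^bsub>R\<^esub> y"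
  "lact (regular_bimod R) x y = x \<otimes>\<^bsub>R\<^esub> y"
  by (simp_all add: regular_bimod_def)

lemma abelian_group_transfer:
  assumes "abelian_group G" "carrier H = carrier G" "\<zero>\<^bsub>H\<^esub> = \<zero>\<^bsub>G\<^esub>"
    "\<And>x y. x \<in> carrier G \<Longrightarrow> y \<in> carrier G \<Longrightarrow> x \<oplus>\<^bsub>H\<^esub> y = x \<oplus>\<^bsub>G\<^esub> y"
  shows "abelian_group H"
proof -
  interpret G: abelian_group G by fact
  show ?thesis
  proof (rule abelian_groupI)
    fix x assume "x \<in> carrier H"
    then show "\<exists>y\<in>carrier H. y \<oplus>\<^bsub>H\<^esub> x = \<zero>\<^bsub>H\<^esub>"
      using assms by (intro bexI[of _ "\<ominus>\<^bsub>G\<^esub> x"]) (simp_all add: G.l_neg)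
  qed (simp_all add: assms G.a_ac)
qed

lemma right_module_regular:
  assumes "ring R"
  shows "right_module R (regular_bimod R)"
proof -
  interpret ring R by fact
  show ?thesis
    by (rule right_moduleI) (auto intro: abelian_group_transfer[OF abelian_group_axioms] ring_axioms
        simp: l_distr r_distr m_assoc)
qed

text \<open>The result is a plain \<open>rmodule\<close> record whatever the record type of
  \<open>M\<close>. With \<open>N = carrier M\<close> it thus also strips the left action from a
  bimodule, which lets the regular module be a summand of \<open>direct_sum\<close>.\<close>

definition submod :: "('a, 'm, 'z) rmodule_scheme \<Rightarrow> 'm set \<Rightarrow> ('a, 'm) rmodule" where
  "submod M N = \<lparr>carrier = N, monoid.mult = undefined, one = undefined,
     ring.zero = \<zero>\<^bsub>M\<^esub>, ring.add = ring.add M, ract = ract M\<rparr>"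

lemma submod_simps [simp]:
  "carrier (submod M N) = N" "\<zero>\<^bsub>submod M N\<^esub> = \<zero>\<^bsub>M\<^esub>" "x \<oplus>\<^bsub>submod M N\<^esub> y = x \<oplus>\<^bsub>M\<^esub> y"
  "ract (submod M N) = ract M"
  by (simp_all add: submod_def)

definition is_submod :: "('a, 'r) ring_scheme \<Rightarrow> ('a, 'm, 'z) rmodule_scheme \<Rightarrow> 'm set \<Rightarrow> bool" where
  "is_submod R M N \<longleftrightarrow> N \<subseteq> carrier M \<and> \<zero>\<^bsub>M\<^esub> \<in> N \<and> (\<forall>x\<in>N. \<forall>y\<in>N. x \<oplus>\<^bsub>M\<^esub> y \<in> N) \<and>
     (\<forall>x\<in>N. \<forall>a\<in>carrier R. ract M x a \<in> N)"

text \<open>Negation is the action of the ring element -1, so the closure conditions of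
  \<open>is_submod\<close> already cover it.\<close>

lemma submod_minus_closed:
  assumes "right_module R M" "is_submod R M N" "x \<in> N"
  shows "\<ominus>\<^bsub>M\<^esub> x \<in> N"
proof -
  interpret right_module R M by fact
  have x: "x \<in> carrier M" using assms by (auto simp: is_submod_def)
  have "ract M x (\<ominus>\<^bsub>R\<^esub> \<one>\<^bsub>R\<^esub>) \<oplus>\<^bsub>M\<^esub> x = ract M x (\<ominus>\<^bsub>R\<^esub> \<one>\<^bsub>R\<^esub> \<oplus>\<^bsub>R\<^esub> \<one>\<^bsub>R\<^esub>)"
    using x by (simp add: ract_add_right ract_one del: R.l_neg)
  also have "\<dots> = \<zero>\<^bsub>M\<^esub>"
    using x by (simp add: R.l_neg ract_zero_right)
  finally have "\<ominus>\<^bsub>M\<^esub> x = ract M x (\<ominus>\<^bsub>R\<^esub> \<one>\<^bsub>R\<^esub>)"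
    using x by (simp add: M.minus_equality ract_closed)
  then show ?thesis
    using assms by (simp add: is_submod_def)
qed

lemma right_module_submod:
  assumes M: "right_module R M" and N: "is_submod R M N"
  shows "right_module R (submod M N)"
proof -
  interpret right_module R M by fact
  have sub: "x \<in> N \<Longrightarrow> x \<in> carrier M" for x using N by (auto simp: is_submod_def)
  have "abelian_group (submod M N)"
  proof (rule abelian_groupI)
    fix x assume "x \<in> carrier (submod M N)"
    then show "\<exists>y\<in>carrier (submod M N). y \<oplus>\<^bsub>submod M N\<^esub> x = \<zero>\<^bsub>submod M N\<^esub>"
      using submod_minus_closed[OF M N] sub by (intro bexI[of _ "\<ominus>\<^bsub>M\<^esub> x"]) (simp_all add: M.l_neg)
  qed (use N in \<open>auto simp: M.a_ac sub is_submod_def\<close>)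
  then show ?thesis
    by (rule right_moduleI[OF R.ring_axioms])
      (use N in \<open>auto simp: sub is_submod_def ract_add_left ract_add_right ract_assoc ract_one\<close>)
qed

lemma incl_rhom:
  assumes "right_module R M" "is_submod R M N"
  shows "(\<lambda>x\<in>N. x) \<in> rhom R (submod M N) M"
  using rhomI[of "submod M N" "\<lambda>x. x" M R] right_module_submod[OF assms] assms(2)
  by (auto simp: is_submod_def)

lemma corestrict_rhom:
  assumes "h \<in> rhom R L M" "h ` carrier L \<subseteq> N"
  shows "h \<in> rhom R L (submod M N)"
  using assms by (auto simp: rhom_def PiE_def)

lemma rhom_from_submod_extend:
  assumes "h \<in> rhom R L (submod M N)" "N \<subseteq> carrier M"
  shows "h \<in> rhom R L M"
  using assms by (auto simp: rhom_def PiE_def)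

lemma kernel_submod:
  assumes h: "h \<in> rhom R M N" and M: "right_module R M" and N: "right_module R N"
  shows "is_submod R M {x \<in> carrier M. h x = \<zero>\<^bsub>N\<^esub>}"
proof -
  interpret M: right_module R M by fact
  interpret N: right_module R N by fact
  show ?thesis
    using rhom_zero[OF h] M.ract_closed N.ract_zero_left
    by (auto simp: is_submod_def rhom_add[OF h] rhom_ract[OF h] M.M.abelian_group_axioms N.M.abelian_group_axioms)
qed

lemma image_submod:
  assumes h: "h \<in> rhom R M N" and M: "right_module R M" and N: "right_module R N"
  shows "is_submod R N (h ` carrier M)"
proof -
  interpret M: right_module R M by fact
  interpret N: right_module R N by fact
  have "\<zero>\<^bsub>N\<^esub> = h \<zero>\<^bsub>M\<^esub>"
    using rhom_zero[OF h M.M.abelian_group_axioms N.M.abelian_group_axioms] by simp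
  then show ?thesis
    using M.ract_closed rhom_closed[OF h]
    by (auto simp: is_submod_def rhom_add[OF h, symmetric] rhom_ract[OF h, symmetric])
qed

text \<open>Serves three kinds of ring homomorphism: from the field into an algebra
  (\<open>scalars\<close>), and from the one-point extension onto each of its two diagonal
  entries.\<close>

definition restrict_scalars :: "('b \<Rightarrow> 'a) \<Rightarrow> ('a, 'm, 'z) rmodule_scheme \<Rightarrow> ('b, 'm) rmodule" where
  "restrict_scalars h M = \<lparr>carrier = carrier M, monoid.mult = undefined, one = undefined,
     ring.zero = \<zero>\<^bsub>M\<^esub>, ring.add = ring.add M, ract = (\<lambda>x b. ract M x (h b))\<rparr>"

lemma restrict_scalars_simps [simp]:
  "carrier (restrict_scalars h M) = carrier M" "\<zero>\<^bsub>restrict_scalars h M\<^esub> = \<zero>\<^bsub>M\<^esub>"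
  "x \<oplus>\<^bsub>restrict_scalars h M\<^esub> y = x \<oplus>\<^bsub>M\<^esub> y" "ract (restrict_scalars h M) x b = ract M x (h b)"
  by (simp_all add: restrict_scalars_def)

lemma right_module_restrict_scalars:
  assumes h: "h \<in> ring_hom R S" and R: "ring R" and M: "right_module S M"
  shows "right_module R (restrict_scalars h M)"
proof -
  interpret right_module S M by fact
  have "abelian_group (restrict_scalars h M)"
    by (rule abelian_group_transfer[OF M.abelian_group_axioms]) simp_all
  then show ?thesis
    by (rule right_moduleI[OF R])
      (simp_all add: ring_hom_closed[OF h] ring_hom_add[OF h] ring_hom_mult[OF h] ring_hom_one[OF h]
        ract_closed ract_add_left ract_add_right ract_assoc ract_one)
qed

lemma rhom_restrict_scalars:
  assumes "h \<in> ring_hom R S" "f \<in> rhom S M N"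
  shows "f \<in> rhom R (restrict_scalars h M) (restrict_scalars h N)"
  using assms by (auto simp: rhom_def ring_hom_closed)

section \<open>Finite rank homomorphisms and projective modules\<close>

text \<open>The homomorphisms \<open>x \<mapsto> \<Sum> n\<^sub>i \<xi>\<^sub>i(x)\<close> with \<open>n\<^sub>i \<in> N\<close> and \<open>\<xi>\<^sub>i \<in> Hom(M, R)\<close>. A module is finitely
  generated projective iff its identity has this form (dual basis lemma), a criterion that does not
  mention test modules and hence is independent of the choice of their element type.\<close>

inductive_set frank ::
    "('a, 'r) ring_scheme \<Rightarrow> ('a, 'm, 'y) rmodule_scheme \<Rightarrow> ('a, 'n, 'z) rmodule_scheme \<Rightarrow> ('m \<Rightarrow> 'n) set"
  for R M N where
    zero: "(\<lambda>x\<in>carrier M. \<zero>\<^bsub>N\<^esub>) \<in> frank R M N"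
  | add: "n \<in> carrier N \<Longrightarrow> \<xi> \<in> rhom R M (regular_bimod R) \<Longrightarrow> f \<in> frank R M N \<Longrightarrow>
      (\<lambda>x\<in>carrier M. ract N n (\<xi> x) \<oplus>\<^bsub>N\<^esub> f x) \<in> frank R M N"

lemma scaled_functional_rhom:
  assumes \<xi>: "\<xi> \<in> rhom R M (regular_bimod R)" and M: "right_module R M" and N: "right_module R N"
    and n: "n \<in> carrier N"
  shows "(\<lambda>x\<in>carrier M. ract N n (\<xi> x)) \<in> rhom R M N"
proof -
  interpret N: right_module R N by fact
  have c: "\<xi> x \<in> carrier R" if "x \<in> carrier M" for x using rhom_closed[OF \<xi> that] by simp
  show ?thesis
    by (rule rhomI[OF _ _ _ M])
      (simp_all add: c n N.ract_closed rhom_add[OF \<xi>] rhom_ract[OF \<xi>] N.ract_add_right N.ract_assoc)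
qed

lemma frank_rhom:
  assumes "f \<in> frank R M N" and M: "right_module R M" and N: "right_module R N"
  shows "f \<in> rhom R M N"
  using assms(1)
proof induction
  case zero
  show ?case by (rule zero_rhom[OF M N])
next
  case (add n \<xi> f)
  have "(\<lambda>x\<in>carrier M. ract N n (\<xi> x) \<oplus>\<^bsub>N\<^esub> f x) =
      (\<lambda>x\<in>carrier M. (\<lambda>x\<in>carrier M. ract N n (\<xi> x)) x \<oplus>\<^bsub>N\<^esub> f x)"
    by auto
  then show ?case
    using plus_rhom[OF scaled_functional_rhom[OF add(2) M N add(1)] add(4) M N] by (simp only:)
qed

lemma frank_plus:
  assumes f: "f \<in> frank R M N" and g: "g \<in> frank R M N" and M: "right_module R M" and N: "right_module R N"
  shows "(\<lambda>x\<in>carrier M. f x \<oplus>\<^bsub>N\<^esub> g x) \<in> frank R M N"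
  using f
proof induction
  case zero
  interpret N: right_module R N by fact
  have "(\<lambda>x\<in>carrier M. (\<lambda>x\<in>carrier M. \<zero>\<^bsub>N\<^esub>) x \<oplus>\<^bsub>N\<^esub> g x) = g"
    by (rule rhom_eqI[OF plus_rhom[OF zero_rhom[OF M N] frank_rhom[OF g M N] M N] frank_rhom[OF g M N]])
      (simp add: rhom_closed[OF frank_rhom[OF g M N]])
  then show ?case using g by (simp only:)
next
  case (add n \<xi> f)
  interpret N: right_module R N by fact
  have c: "\<xi> x \<in> carrier R" if "x \<in> carrier M" for x using rhom_closed[OF add(2) that] by simp
  have "(\<lambda>x\<in>carrier M. (\<lambda>x\<in>carrier M. ract N n (\<xi> x) \<oplus>\<^bsub>N\<^esub> f x) x \<oplus>\<^bsub>N\<^esub> g x) =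
      (\<lambda>x\<in>carrier M. ract N n (\<xi> x) \<oplus>\<^bsub>N\<^esub> (\<lambda>x\<in>carrier M. f x \<oplus>\<^bsub>N\<^esub> g x) x)"
    by (intro restrict_ext) (simp add: N.M.a_assoc N.ract_closed add(1) c
        rhom_closed[OF frank_rhom[OF g M N]] rhom_closed[OF frank_rhom[OF add(3) M N]])
  then show ?case using frank.add[OF add(1,2,4)] by (simp only:)
qed

text \<open>Finite rank homomorphisms form an ideal: composition on the left turns each
  \<open>n\<close> into \<open>g n\<close>, composition on the right
  (\<open>frank_compose_right\<close>) each \<open>\<xi>\<close> into \<open>\<xi> k\<close>. Hence
  an identity map that is a sum of maps factoring through modules with a dual basis is itself of
  finite rank. Most later proofs of projectivity have this form.\<close>

lemma frank_compose_left:
  assumes "f \<in> frank R L M" and g: "g \<in> rhom R M N" and L: "right_module R L"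
    and M: "right_module R M" and N: "right_module R N"
  shows "compose (carrier L) g f \<in> frank R L N"
  using assms(1)
proof induction
  case zero
  have "compose (carrier L) g (\<lambda>x\<in>carrier L. \<zero>\<^bsub>M\<^esub>) = (\<lambda>x\<in>carrier L. \<zero>\<^bsub>N\<^esub>)"
    using rhom_zero[OF g right_module_abelian_group[OF M] right_module_abelian_group[OF N]]
    by (auto simp: compose_def)
  then show ?case using frank.zero[where M=L and N=N and R=R] by (simp only:)
next
  case (add n \<xi> f)
  interpret M: right_module R M by fact
  have c: "\<xi> x \<in> carrier R" if "x \<in> carrier L" for x using rhom_closed[OF add(2) that] by simp
  have "compose (carrier L) g (\<lambda>x\<in>carrier L. ract M n (\<xi> x) \<oplus>\<^bsub>M\<^esub> f x) =
      (\<lambda>x\<in>carrier L. ract N (g n) (\<xi> x) \<oplus>\<^bsub>N\<^esub> compose (carrier L) g f x)"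
    unfolding compose_def
    by (intro restrict_ext) (simp add: rhom_add[OF g] rhom_ract[OF g] add(1) c M.ract_closed
        rhom_closed[OF frank_rhom[OF add(3) L M]])
  then show ?case using frank.add[OF rhom_closed[OF g add(1)] add(2,4)] by (simp only:)
qed

lemma frank_compose_right:
  assumes "f \<in> frank R M N" and k: "k \<in> rhom R L M" and L: "right_module R L"
  shows "compose (carrier L) f k \<in> frank R L N"
  using assms(1)
proof induction
  case zero
  have "compose (carrier L) (\<lambda>x\<in>carrier M. \<zero>\<^bsub>N\<^esub>) k = (\<lambda>x\<in>carrier L. \<zero>\<^bsub>N\<^esub>)"
    using rhom_closed[OF k] by (auto simp: compose_def)
  then show ?case using frank.zero[where M=L and N=N and R=R] by (simp only:)
next
  case (add n \<xi> f)
  have "compose (carrier L) (\<lambda>x\<in>carrier M. ract N n (\<xi> x) \<oplus>\<^bsub>N\<^esub> f x) k =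
      (\<lambda>x\<in>carrier L. ract N n (compose (carrier L) \<xi> k x) \<oplus>\<^bsub>N\<^esub> compose (carrier L) f k x)"
    unfolding compose_def by (intro restrict_ext) (simp add: rhom_closed[OF k])
  then show ?case using frank.add[OF add(1) compose_rhom[OF k add(2) L] add(4)] by (simp only:)
qed

lemma frank_scaled:
  assumes "n \<in> carrier N" "\<xi> \<in> rhom R M (regular_bimod R)" and N: "right_module R N"
  shows "(\<lambda>x\<in>carrier M. ract N n (\<xi> x)) \<in> frank R M N"
proof -
  interpret N: right_module R N by fact
  have c: "\<xi> x \<in> carrier R" if "x \<in> carrier M" for x using rhom_closed[OF assms(2) that] by simp
  have "(\<lambda>x\<in>carrier M. ract N n (\<xi> x) \<oplus>\<^bsub>N\<^esub> (\<lambda>x\<in>carrier M. \<zero>\<^bsub>N\<^esub>) x) = (\<lambda>x\<in>carrier M. ract N n (\<xi> x))"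
    by (intro restrict_ext) (simp add: N.ract_closed assms c)
  then show ?thesis using frank.add[OF assms(1,2) frank.zero] by (simp only:)
qed

definition dbproj :: "('a, 'r) ring_scheme \<Rightarrow> ('a, 'm, 'z) rmodule_scheme \<Rightarrow> bool" where
  "dbproj R P \<longleftrightarrow> right_module R P \<and> (\<lambda>x\<in>carrier P. x) \<in> frank R P P"

lemma dbproj_right_module: "dbproj R P \<Longrightarrow> right_module R P"
  by (simp add: dbproj_def)

text \<open>The identity of \<open>P\<close> is lifted term by term: a term \<open>n \<xi>\<close>
  becomes \<open>m \<xi>\<close>, where \<open>m\<close> is a preimage of \<open>h n\<close> under
  \<open>g\<close>. The hypothesis compares images instead of asking for a surjective
  \<open>g\<close>, so that maps into the cycles of a complex lift without forming the submodule of
  cycles.\<close>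

lemma dbproj_lift:
  assumes P: "dbproj R P" and g: "g \<in> rhom R M N" and h: "h \<in> rhom R P N"
    and im: "h ` carrier P \<subseteq> g ` carrier M" and M: "right_module R M" and N: "right_module R N"
  shows "\<exists>l \<in> rhom R P M. \<forall>x\<in>carrier P. g (l x) = h x"
proof -
  have P': "right_module R P" using P by (simp add: dbproj_def)
  interpret P: right_module R P by fact
  interpret M: right_module R M by fact
  have "\<exists>l \<in> rhom R P M. \<forall>x\<in>carrier P. g (l x) = h (f x)" if "f \<in> frank R P P" for f
    using that
  proof induction
    case zero
    have "\<forall>x\<in>carrier P. g ((\<lambda>x\<in>carrier P. \<zero>\<^bsub>M\<^esub>) x) = h ((\<lambda>x\<in>carrier P. \<zero>\<^bsub>P\<^esub>) x)"
      using rhom_zero[OF g right_module_abelian_group[OF M] right_module_abelian_group[OF N]]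
        rhom_zero[OF h right_module_abelian_group[OF P'] right_module_abelian_group[OF N]] by simp
    then show ?case using zero_rhom[OF P' M] by blast
  next
    case (add n \<xi> f)
    then obtain l where l: "l \<in> rhom R P M" "\<forall>x\<in>carrier P. g (l x) = h (f x)" by blast
    have "h n \<in> g ` carrier M" using im add(1) by blast
    then obtain m where m: "m \<in> carrier M" "g m = h n" by auto
    have c: "\<xi> x \<in> carrier R" if "x \<in> carrier P" for x using rhom_closed[OF add(2) that] by simp
    let ?l = "\<lambda>x\<in>carrier P. (\<lambda>x\<in>carrier P. ract M m (\<xi> x)) x \<oplus>\<^bsub>M\<^esub> l x"
    have "?l \<in> rhom R P M"
      by (rule plus_rhom[OF scaled_functional_rhom[OF add(2) P' M m(1)] l(1) P' M])
    moreover have "\<forall>x\<in>carrier P. g (?l x) = h ((\<lambda>x\<in>carrier P. ract P n (\<xi> x) \<oplus>\<^bsub>P\<^esub> f x) x)"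
      by (simp add: rhom_add[OF g] rhom_ract[OF g] rhom_add[OF h] rhom_ract[OF h] m l(2) c add(1)
          M.ract_closed P.ract_closed rhom_closed[OF l(1)] rhom_closed[OF frank_rhom[OF add(3) P' P']])
    ultimately show ?case by blast
  qed
  then show ?thesis
    using P by (fastforce simp: dbproj_def)
qed

section \<open>Spans and finite generation\<close>

text \<open>Linear combinations are built one term at a time, so that arguments about spans are
  inductions; the passage to and from indexed sums is confined to \<open>finsum_in_rhull\<close> and
  \<open>rhull_finsum\<close>.\<close>

inductive_set rhull :: "('a, 'r) ring_scheme \<Rightarrow> ('a, 'm, 'z) rmodule_scheme \<Rightarrow> 'm set \<Rightarrow> 'm set"
  for R M S where
    zero: "\<zero>\<^bsub>M\<^esub> \<in> rhull R M S"
  | add: "s \<in> S \<Longrightarrow> a \<in> carrier R \<Longrightarrow> x \<in> rhull R M S \<Longrightarrow> ract M s a \<oplus>\<^bsub>M\<^esub> x \<in> rhull R M S"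

lemma rhull_closed:
  assumes "x \<in> rhull R M S" and M: "right_module R M" and S: "S \<subseteq> carrier M"
  shows "x \<in> carrier M"
proof -
  interpret right_module R M by fact
  show ?thesis using assms(1) by induction (use S ract_closed in auto)
qed

lemma rhull_plus:
  assumes "x \<in> rhull R M S" and y: "y \<in> rhull R M S" and M: "right_module R M" and S: "S \<subseteq> carrier M"
  shows "x \<oplus>\<^bsub>M\<^esub> y \<in> rhull R M S"
proof -
  interpret right_module R M by fact
  show ?thesis using assms(1)
  proof induction
    case zero
    then show ?case using y rhull_closed[OF y M S] by simp
  next
    case (add s a x)
    then show ?case
      using S rhull_closed[OF y M S] rhull_closed[OF add(3) M S] ract_closed[of s a]
        rhull.add[OF add(1,2,4)] by (simp add: M.a_assoc subset_iff)
  qed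
qed

lemma rhull_ract:
  assumes "x \<in> rhull R M S" and b: "b \<in> carrier R" and M: "right_module R M" and S: "S \<subseteq> carrier M"
  shows "ract M x b \<in> rhull R M S"
proof -
  interpret right_module R M by fact
  show ?thesis using assms(1)
  proof induction
    case zero
    then show ?case using b by (simp add: ract_zero_left rhull.zero)
  next
    case (add s a x)
    then have "ract M (ract M s a \<oplus>\<^bsub>M\<^esub> x) b = ract M s (a \<otimes>\<^bsub>R\<^esub> b) \<oplus>\<^bsub>M\<^esub> ract M x b"
      using S b rhull_closed[OF add(3) M S] by (auto simp: ract_add_left ract_closed ract_assoc subset_iff)
    then show ?case using rhull.add[OF add(1) _ add(4)] add(2) b by simp
  qed
qed

lemma rhull_inc:
  assumes "s \<in> S" and M: "right_module R M" and S: "S \<subseteq> carrier M"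
  shows "s \<in> rhull R M S"
proof -
  interpret right_module R M by fact
  have "ract M s \<one>\<^bsub>R\<^esub> \<oplus>\<^bsub>M\<^esub> \<zero>\<^bsub>M\<^esub> \<in> rhull R M S"
    by (intro rhull.intros assms) simp
  moreover have "ract M s \<one>\<^bsub>R\<^esub> \<oplus>\<^bsub>M\<^esub> \<zero>\<^bsub>M\<^esub> = s"
    using S assms(1) by (simp add: ract_one subset_iff)
  ultimately show ?thesis by simp
qed

lemma is_submod_rhull:
  assumes M: "right_module R M" and S: "S \<subseteq> carrier M"
  shows "is_submod R M (rhull R M S)"
  using rhull_closed[OF _ M S] rhull_plus[OF _ _ M S] rhull_ract[OF _ _ M S]
  by (auto simp: is_submod_def rhull.zero)

lemma rhull_minimal:
  assumes "is_submod R M N" "S \<subseteq> N"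
  shows "rhull R M S \<subseteq> N"
proof
  fix x assume "x \<in> rhull R M S"
  then show "x \<in> N" by induction (use assms in \<open>auto simp: is_submod_def\<close>)
qed

lemma rhull_submod_subset: "rhull R M S \<subseteq> rhull R (submod M N) S"
proof
  fix x assume "x \<in> rhull R M S"
  then show "x \<in> rhull R (submod M N) S"
  proof induction
    case zero
    show ?case using rhull.zero[of "submod M N" R S] by simp
  next
    case (add s a x)
    then show ?case using rhull.add[of s S a R x "submod M N"] by simp
  qed
qed

lemma finsum_in_rhull:
  assumes M: "right_module R M" and "finite S" "S \<subseteq> T" "T \<subseteq> carrier M" "c \<in> S \<rightarrow> carrier R"
  shows "(\<Oplus>\<^bsub>M\<^esub>s\<in>S. ract M s (c s)) \<in> rhull R M T"
proof -
  interpret right_module R M by fact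
  show ?thesis using assms(2-)
  proof (induction S)
    case empty
    then show ?case by (simp add: rhull.zero)
  next
    case (insert s S)
    have "(\<Oplus>\<^bsub>M\<^esub>s\<in>insert s S. ract M s (c s)) = ract M s (c s) \<oplus>\<^bsub>M\<^esub> (\<Oplus>\<^bsub>M\<^esub>s\<in>S. ract M s (c s))"
      using insert by (intro M.finsum_insert) (auto intro!: ract_closed)
    then show ?case using insert by (auto intro!: rhull.add)
  qed
qed

text \<open>A derivation in \<open>rhull\<close> may use the same generator several times, a
  coefficient function has one value for it. Adding a term \<open>ract M s a\<close> is therefore
  adding \<open>a\<close> to the coefficient at \<open>s\<close>.\<close>

lemma rhull_finsum:
  assumes M: "right_module R M" and fin: "finite S" and S: "S \<subseteq> carrier M" and "x \<in> rhull R M S"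
  shows "\<exists>c \<in> S \<rightarrow> carrier R. x = (\<Oplus>\<^bsub>M\<^esub>s\<in>S. ract M s (c s))"
proof -
  interpret right_module R M by fact
  show ?thesis using assms(4)
  proof induction
    case zero
    have "(\<Oplus>\<^bsub>M\<^esub>s\<in>S. ract M s \<zero>\<^bsub>R\<^esub>) = (\<Oplus>\<^bsub>M\<^esub>s\<in>S. \<zero>\<^bsub>M\<^esub>)"
      using S by (intro M.finsum_cong') (auto simp: ract_zero_right)
    then show ?case by (intro bexI[of _ "\<lambda>_. \<zero>\<^bsub>R\<^esub>"]) simp_all
  next
    case (add s a x)
    then obtain c where c: "c \<in> S \<rightarrow> carrier R" "x = (\<Oplus>\<^bsub>M\<^esub>s\<in>S. ract M s (c s))" by blast
    \<comment> \<open>The coefficient function that is \<open>a\<close> at \<open>s\<close> and zero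
      elsewhere; \<open>?d + c\<close> is the new witness.\<close>
    let ?d = "\<lambda>t. if s = t then a else \<zero>\<^bsub>R\<^esub>"
    have "(\<Oplus>\<^bsub>M\<^esub>t\<in>S. ract M t (?d t)) = (\<Oplus>\<^bsub>M\<^esub>t\<in>S. if s = t then ract M t a else \<zero>\<^bsub>M\<^esub>)"
      using S add by (intro M.finsum_cong') (auto simp: ract_zero_right intro!: ract_closed)
    also have "\<dots> = ract M s a"
      using M.finsum_singleton[OF add(1) fin, of "\<lambda>t. ract M t a"] S add by (auto intro!: ract_closed)
    finally have s: "(\<Oplus>\<^bsub>M\<^esub>t\<in>S. ract M t (?d t)) = ract M s a" .
    have "(\<Oplus>\<^bsub>M\<^esub>t\<in>S. ract M t (?d t \<oplus>\<^bsub>R\<^esub> c t)) = (\<Oplus>\<^bsub>M\<^esub>t\<in>S. ract M t (?d t) \<oplus>\<^bsub>M\<^esub> ract M t (c t))"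
      using S add(2) c(1) by (intro M.finsum_cong') (auto simp: ract_add_right Pi_iff subset_iff intro!: ract_closed)
    also have "\<dots> = (\<Oplus>\<^bsub>M\<^esub>t\<in>S. ract M t (?d t)) \<oplus>\<^bsub>M\<^esub> (\<Oplus>\<^bsub>M\<^esub>t\<in>S. ract M t (c t))"
      using S add(2) c(1) by (intro M.finsum_addf) (auto simp: Pi_iff subset_iff intro!: ract_closed)
    finally show ?case
      using c add(2) s by (intro bexI[of _ "\<lambda>t. ?d t \<oplus>\<^bsub>R\<^esub> c t"]) (auto simp: Pi_iff)
  qed
qed

lemma fin_gen_iff:
  assumes M: "right_module R M"
  shows "fin_gen R M \<longleftrightarrow> (\<exists>S. finite S \<and> S \<subseteq> carrier M \<and> carrier M \<subseteq> rhull R M S)"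
proof -
  have "(\<forall>x\<in>carrier M. \<exists>c\<in>S \<rightarrow> carrier R. x = (\<Oplus>\<^bsub>M\<^esub>s\<in>S. ract M s (c s))) \<longleftrightarrow> carrier M \<subseteq> rhull R M S"
      (is "?L \<longleftrightarrow> ?R") if S: "finite S" "S \<subseteq> carrier M" for S
  proof
    assume ?L
    show ?R
    proof
      fix x assume "x \<in> carrier M"
      then obtain c where "c \<in> S \<rightarrow> carrier R" "x = (\<Oplus>\<^bsub>M\<^esub>s\<in>S. ract M s (c s))" using \<open>?L\<close> by auto
      then show "x \<in> rhull R M S" using finsum_in_rhull[OF M S(1) order_refl S(2)] by simp
    qed
  next
    assume ?R
    then show ?L using rhull_finsum[OF M S] by (metis subsetD)
  qed
  then show ?thesis unfolding fin_gen_def by (intro ex_cong1) (simp cong: conj_cong)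
qed

text \<open>The elements \<open>n\<close> that occur in a finite rank map span its image. For the
  identity map this is finite generation.\<close>

lemma frank_rhull:
  assumes "f \<in> frank R M N"
  shows "\<exists>S. finite S \<and> S \<subseteq> carrier N \<and> (\<forall>x\<in>carrier M. f x \<in> rhull R N S)"
  using assms
proof induction
  case zero
  show ?case by (rule exI[of _ "{}"]) (simp add: rhull.zero)
next
  case (add n \<xi> f)
  then obtain S where S: "finite S" "S \<subseteq> carrier N" "\<forall>x\<in>carrier M. f x \<in> rhull R N S" by blast
  have mono: "y \<in> rhull R N (insert n S)" if "y \<in> rhull R N S" for y
    using that
  proof induction
    case (add s a x)
    then show ?case using rhull.add[of s "insert n S"] by simp
  qed (rule rhull.zero)
  have "\<forall>x\<in>carrier M. \<xi> x \<in> carrier R" using rhom_closed[OF add(2)] by simp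
  then show ?case
    using S add(1) mono rhull.add[where s=n and S="insert n S" and M=N and R=R]
    by (intro exI[of _ "insert n S"]) auto
qed

lemma dbproj_fin_gen:
  assumes "dbproj R P"
  shows "fin_gen R P"
proof -
  obtain S where "finite S" "S \<subseteq> carrier P" "\<forall>x\<in>carrier P. (\<lambda>x\<in>carrier P. x) x \<in> rhull R P S"
    using frank_rhull[of "\<lambda>x\<in>carrier P. x" R P P] assms by (auto simp: dbproj_def)
  then have "carrier P \<subseteq> rhull R P S" by (simp add: subset_iff)
  then show ?thesis
    using \<open>finite S\<close> \<open>S \<subseteq> carrier P\<close> fin_gen_iff[OF dbproj_right_module[OF assms]] by blast
qed

section \<open>Direct sums and free modules\<close>

lemma direct_sum_simps [simp]:
  "carrier (direct_sum I M) = (\<Pi>\<^sub>E i\<in>I. carrier (M i))"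
  "\<zero>\<^bsub>direct_sum I M\<^esub> = (\<lambda>i\<in>I. \<zero>\<^bsub>M i\<^esub>)"
  "x \<oplus>\<^bsub>direct_sum I M\<^esub> y = (\<lambda>i\<in>I. x i \<oplus>\<^bsub>M i\<^esub> y i)"
  "ract (direct_sum I M) x a = (\<lambda>i\<in>I. ract (M i) (x i) a)"
  by (simp_all add: direct_sum_def)

lemma right_module_direct_sum:
  assumes R: "ring R" and M: "\<And>i. i \<in> I \<Longrightarrow> right_module R (M i)"
  shows "right_module R (direct_sum I M)"
proof -
  note ag = right_module_abelian_group[OF M]
  have mem: "x i \<in> carrier (M i)" if "x \<in> (\<Pi>\<^sub>E i\<in>I. carrier (M i))" "i \<in> I" for x i
    using that by (rule PiE_mem)
  have "abelian_group (direct_sum I M)"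
  proof (rule abelian_groupI)
    fix x y assume "x \<in> carrier (direct_sum I M)" "y \<in> carrier (direct_sum I M)"
    then show "x \<oplus>\<^bsub>direct_sum I M\<^esub> y \<in> carrier (direct_sum I M)"
      using ag by (auto simp: mem intro!: abelian_monoid.a_closed abelian_group.axioms(1))
  next
    show "\<zero>\<^bsub>direct_sum I M\<^esub> \<in> carrier (direct_sum I M)"
      using ag by (auto intro!: abelian_monoid.zero_closed abelian_group.axioms(1))
  next
    fix x y z
    assume "x \<in> carrier (direct_sum I M)" "y \<in> carrier (direct_sum I M)" "z \<in> carrier (direct_sum I M)"
    then show "x \<oplus>\<^bsub>direct_sum I M\<^esub> y \<oplus>\<^bsub>direct_sum I M\<^esub> z = x \<oplus>\<^bsub>direct_sum I M\<^esub> (y \<oplus>\<^bsub>direct_sum I M\<^esub> z)"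
      using ag by (auto simp: mem intro!: restrict_ext abelian_monoid.a_assoc abelian_group.axioms(1))
  next
    fix x y assume "x \<in> carrier (direct_sum I M)" "y \<in> carrier (direct_sum I M)"
    then show "x \<oplus>\<^bsub>direct_sum I M\<^esub> y = y \<oplus>\<^bsub>direct_sum I M\<^esub> x"
      using ag by (auto simp: mem intro!: restrict_ext abelian_monoid.a_comm abelian_group.axioms(1))
  next
    fix x assume x: "x \<in> carrier (direct_sum I M)"
    then have x': "x \<in> (\<Pi>\<^sub>E i\<in>I. carrier (M i))" by simp
    have "(\<lambda>i\<in>I. \<zero>\<^bsub>M i\<^esub> \<oplus>\<^bsub>M i\<^esub> x i) = (\<lambda>i\<in>I. x i)"
      using ag by (auto simp: mem[OF x'] intro!: restrict_ext abelian_monoid.l_zero abelian_group.axioms(1))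
    then show "\<zero>\<^bsub>direct_sum I M\<^esub> \<oplus>\<^bsub>direct_sum I M\<^esub> x = x"
      using PiE_restrict[OF x'] by (simp cong: restrict_cong)
    show "\<exists>y\<in>carrier (direct_sum I M). y \<oplus>\<^bsub>direct_sum I M\<^esub> x = \<zero>\<^bsub>direct_sum I M\<^esub>"
      using ag by (intro bexI[of _ "\<lambda>i\<in>I. \<ominus>\<^bsub>M i\<^esub> x i"])
        (auto simp: mem[OF x'] abelian_group.l_neg abelian_group.a_inv_closed intro!: restrict_ext)
  qed
  then show ?thesis
  proof (rule right_moduleI[OF R])
    fix x assume "x \<in> carrier (direct_sum I M)"
    then have x': "x \<in> (\<Pi>\<^sub>E i\<in>I. carrier (M i))" by simp
    have "(\<lambda>i\<in>I. ract (M i) (x i) \<one>\<^bsub>R\<^esub>) = (\<lambda>i\<in>I. x i)"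
      by (intro restrict_ext) (simp add: mem[OF x'] right_module.ract_one[OF M])
    then show "ract (direct_sum I M) x \<one>\<^bsub>R\<^esub> = x"
      using PiE_restrict[OF x'] by simp
  qed (auto simp: mem right_module.ract_closed[OF M] right_module.ract_add_left[OF M]
      right_module.ract_add_right[OF M] right_module.ract_assoc[OF M])
qed

lemma direct_sum_proj_rhom:
  assumes "ring R" "\<And>i. i \<in> I \<Longrightarrow> right_module R (M i)" "j \<in> I"
  shows "(\<lambda>x\<in>carrier (direct_sum I M). x j) \<in> rhom R (direct_sum I M) (M j)"
  using assms by (intro rhomI right_module_direct_sum) auto

lemma direct_sum_inj_rhom:
  assumes R: "ring R" and M: "\<And>i. i \<in> I \<Longrightarrow> right_module R (M i)" and j: "j \<in> I"
  shows "(\<lambda>y\<in>carrier (M j). \<lambda>i\<in>I. if i = j then y else \<zero>\<^bsub>M i\<^esub>) \<in> rhom R (M j) (direct_sum I M)"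
proof (rule rhomI[OF _ _ _ M[OF j]])
  have z: "\<zero>\<^bsub>M i\<^esub> \<in> carrier (M i)" if "i \<in> I" for i
    using right_module_abelian_group[OF M[OF that]] by (simp add: abelian_groupE(2))
  then show "x \<in> carrier (M j) \<Longrightarrow> (\<lambda>i\<in>I. if i = j then x else \<zero>\<^bsub>M i\<^esub>) \<in> carrier (direct_sum I M)" for x
    by auto
  have "\<zero>\<^bsub>M i\<^esub> \<oplus>\<^bsub>M i\<^esub> \<zero>\<^bsub>M i\<^esub> = \<zero>\<^bsub>M i\<^esub>" if "i \<in> I" for i
    using right_module_abelian_group[OF M[OF that]] z[OF that] by (simp add: abelian_groupE(5))
  then show "(\<lambda>i\<in>I. if i = j then x \<oplus>\<^bsub>M j\<^esub> y else \<zero>\<^bsub>M i\<^esub>) =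
      (\<lambda>i\<in>I. if i = j then x else \<zero>\<^bsub>M i\<^esub>) \<oplus>\<^bsub>direct_sum I M\<^esub> (\<lambda>i\<in>I. if i = j then y else \<zero>\<^bsub>M i\<^esub>)" for x y
    by (auto intro!: restrict_ext)
  show "(\<lambda>i\<in>I. if i = j then ract (M j) x a else \<zero>\<^bsub>M i\<^esub>) =
      ract (direct_sum I M) (\<lambda>i\<in>I. if i = j then x else \<zero>\<^bsub>M i\<^esub>) a" if "a \<in> carrier R" for x a
    using right_module.ract_zero_left[OF M that] by (auto intro!: restrict_ext)
qed

text \<open>The identity is the sum over \<open>j\<close> of injection after projection. Each
  summand factors through the identity of \<open>M j\<close>, hence has finite rank; the induction
  on \<open>J\<close> adds them up one index at a time.\<close>

lemma dbproj_direct_sum: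
  assumes R: "ring R" and "finite I" and M: "\<And>i. i \<in> I \<Longrightarrow> dbproj R (M i)"
  shows "dbproj R (direct_sum I M)"
proof -
  note M' = dbproj_right_module[OF M]
  let ?S = "direct_sum I M"
  have S: "right_module R ?S" by (rule right_module_direct_sum[OF R M'])
  have mem: "x i \<in> carrier (M i)" if "x \<in> (\<Pi>\<^sub>E i\<in>I. carrier (M i))" "i \<in> I" for x i
    using that by (rule PiE_mem)
  have z: "\<zero>\<^bsub>M i\<^esub> \<in> carrier (M i)" if "i \<in> I" for i
    using right_module_abelian_group[OF M'[OF that]] by (simp add: abelian_groupE(2))
  have l: "\<zero>\<^bsub>M i\<^esub> \<oplus>\<^bsub>M i\<^esub> x = x" "x \<oplus>\<^bsub>M i\<^esub> \<zero>\<^bsub>M i\<^esub> = x" if "i \<in> I" "x \<in> carrier (M i)" for i x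
    using right_module_abelian_group[OF M'[OF that(1)]] that(2) z[OF that(1)]
    by (simp_all add: abelian_groupE(5) abelian_groupE(4)[of _ x])
  have "(\<lambda>x\<in>carrier ?S. \<lambda>i\<in>I. if i \<in> J then x i else \<zero>\<^bsub>M i\<^esub>) \<in> frank R ?S ?S" if "finite J" "J \<subseteq> I" for J
    using that
  proof induction
    case empty
    show ?case using frank.zero[where M="?S" and N="?S" and R=R]
      by (simp only: direct_sum_simps empty_iff if_False)
  next
    case (insert j J)
    let ?inj = "\<lambda>y\<in>carrier (M j). \<lambda>i\<in>I. if i = j then y else \<zero>\<^bsub>M i\<^esub>"
    let ?pr = "\<lambda>x\<in>carrier ?S. x j"
    have j: "j \<in> I" using insert by simp
    have "(\<lambda>x\<in>carrier (M j). x) \<in> frank R (M j) (M j)"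
      using M[OF j] by (simp add: dbproj_def)
    then have "compose (carrier ?S) (compose (carrier (M j)) ?inj (\<lambda>x\<in>carrier (M j). x)) ?pr \<in> frank R ?S ?S"
      by (intro frank_compose_right[OF frank_compose_left[OF _ direct_sum_inj_rhom[OF R M' j] M'[OF j] M'[OF j] S]
          direct_sum_proj_rhom[OF R M' j] S]) simp_all
    moreover have "(\<lambda>x\<in>carrier ?S. \<lambda>i\<in>I. if i \<in> J then x i else \<zero>\<^bsub>M i\<^esub>) \<in> frank R ?S ?S"
      by (rule insert.IH) (use insert.prems in simp)
    ultimately have "(\<lambda>x\<in>carrier ?S. compose (carrier ?S) (compose (carrier (M j)) ?inj (\<lambda>x\<in>carrier (M j). x)) ?pr x
        \<oplus>\<^bsub>?S\<^esub> (\<lambda>x\<in>carrier ?S. \<lambda>i\<in>I. if i \<in> J then x i else \<zero>\<^bsub>M i\<^esub>) x) \<in> frank R ?S ?S"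
      by (rule frank_plus[OF _ _ S S])
    moreover have "(\<lambda>x\<in>carrier ?S. compose (carrier ?S) (compose (carrier (M j)) ?inj (\<lambda>x\<in>carrier (M j). x)) ?pr x
        \<oplus>\<^bsub>?S\<^esub> (\<lambda>x\<in>carrier ?S. \<lambda>i\<in>I. if i \<in> J then x i else \<zero>\<^bsub>M i\<^esub>) x) =
        (\<lambda>x\<in>carrier ?S. \<lambda>i\<in>I. if i \<in> insert j J then x i else \<zero>\<^bsub>M i\<^esub>)"
      using j insert(2) by (intro restrict_ext) (auto simp: compose_def l z mem intro!: restrict_ext)
    ultimately show ?case by (simp only:)
  qed
  from this[OF assms(2) order_refl]
  have "(\<lambda>x\<in>carrier ?S. \<lambda>i\<in>I. if i \<in> I then x i else \<zero>\<^bsub>M i\<^esub>) \<in> frank R ?S ?S" .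
  moreover have "(\<lambda>x\<in>carrier ?S. \<lambda>i\<in>I. if i \<in> I then x i else \<zero>\<^bsub>M i\<^esub>) = (\<lambda>x\<in>carrier ?S. x)"
  proof (rule restrict_ext)
    fix x assume "x \<in> carrier ?S"
    then have "restrict x I = x" by (intro PiE_restrict) simp
    moreover have "(\<lambda>i\<in>I. if i \<in> I then x i else \<zero>\<^bsub>M i\<^esub>) = restrict x I" by (intro restrict_ext) simp
    ultimately show "(\<lambda>i\<in>I. if i \<in> I then x i else \<zero>\<^bsub>M i\<^esub>) = x" by simp
  qed
  ultimately have "(\<lambda>x\<in>carrier ?S. x) \<in> frank R ?S ?S" by (simp only:)
  then show ?thesis using S unfolding dbproj_def by blast
qed

text \<open>The index set of naturals places the elements in \<open>nat \<Rightarrow> 'a\<close>, so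
  that a free module can be a test module of \<open>fg_projective\<close> and a term of a chosen
  resolution.\<close>

definition free_rmodule :: "('a, 'r) ring_scheme \<Rightarrow> nat \<Rightarrow> ('a, nat \<Rightarrow> 'a) rmodule" where
  "free_rmodule R m = direct_sum {..<m} (\<lambda>_. submod (regular_bimod R) (carrier R))"

lemma regular_submod_UNIV:
  assumes "ring R"
  shows "is_submod R (regular_bimod R) (carrier R)"
proof -
  interpret ring R by fact
  show ?thesis by (simp add: is_submod_def)
qed

lemma dbproj_regular:
  assumes "ring R"
  shows "dbproj R (submod (regular_bimod R) (carrier R))"
proof -
  interpret ring R by fact
  let ?M = "submod (regular_bimod R) (carrier R)"
  have M: "right_module R ?M"
    by (rule right_module_submod[OF right_module_regular regular_submod_UNIV]) (rule assms)+
  have "(\<lambda>x\<in>carrier ?M. x) \<in> rhom R ?M (regular_bimod R)"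
    by (intro rhomI M) auto
  then have "(\<lambda>x\<in>carrier ?M. ract ?M \<one>\<^bsub>R\<^esub> ((\<lambda>x\<in>carrier ?M. x) x)) \<in> frank R ?M ?M"
    by (intro frank_scaled M) simp
  moreover have "(\<lambda>x\<in>carrier ?M. ract ?M \<one>\<^bsub>R\<^esub> ((\<lambda>x\<in>carrier ?M. x) x)) = (\<lambda>x\<in>carrier ?M. x)"
    by (intro restrict_ext) simp
  ultimately show ?thesis using M unfolding dbproj_def by (simp only:)
qed

lemma dbproj_free_rmodule: "ring R \<Longrightarrow> dbproj R (free_rmodule R m)"
  unfolding free_rmodule_def by (intro dbproj_direct_sum dbproj_regular) simp_all

text \<open>Only the generators need to be hit, since the image is a submodule. The induction adds
  one coordinate for each generator.\<close>

lemma free_rmodule_cover_set: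
  assumes N: "right_module R N" and "finite S" "S \<subseteq> carrier N"
  shows "\<exists>m. \<exists>g \<in> rhom R (free_rmodule R m) N. S \<subseteq> g ` carrier (free_rmodule R m)"
  using assms(2,3)
proof induction
  case empty
  then show ?case
    using zero_rhom[OF dbproj_right_module[OF dbproj_free_rmodule[OF right_module_ring[OF N]]] N] by blast
next
  case (insert s S)
  interpret N: right_module R N by fact
  obtain m g where g: "g \<in> rhom R (free_rmodule R m) N" "S \<subseteq> g ` carrier (free_rmodule R m)"
    using insert by blast
  let ?F = "free_rmodule R m" and ?F' = "free_rmodule R (Suc m)"
  have F: "right_module R ?F" "right_module R ?F'"
    by (rule dbproj_right_module[OF dbproj_free_rmodule[OF right_module_ring[OF N]]])+
  have car: "carrier (free_rmodule R k) = {..<k} \<rightarrow>\<^sub>E carrier R" for k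
    by (simp add: free_rmodule_def)
  have res: "restrict c {..<m} \<in> carrier ?F" if "c \<in> carrier ?F'" for c
    using PiE_mem[of c "{..<Suc m}" "\<lambda>_. carrier R"] that by (simp add: car)
  have top: "c m \<in> carrier R" if "c \<in> carrier ?F'" for c
    using PiE_mem[of c "{..<Suc m}" "\<lambda>_. carrier R"] that by (simp add: car)
  have s: "s \<in> carrier N" using insert by simp
  \<comment> \<open>The new last coordinate is the coefficient of \<open>s\<close>; the others are
    evaluated by the map found so far.\<close>
  let ?g = "\<lambda>c\<in>carrier ?F'. ract N s (c m) \<oplus>\<^bsub>N\<^esub> g (restrict c {..<m})"
  have "?g \<in> rhom R ?F' N"
  proof (rule rhomI[OF _ _ _ F(2)])
    fix c assume c: "c \<in> carrier ?F'"
    show "ract N s (c m) \<oplus>\<^bsub>N\<^esub> g (restrict c {..<m}) \<in> carrier N"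
      by (simp add: N.ract_closed s top c rhom_closed[OF g(1)] res)
    show "ract N s (ract ?F' c a m) \<oplus>\<^bsub>N\<^esub> g (restrict (ract ?F' c a) {..<m}) =
        ract N (ract N s (c m) \<oplus>\<^bsub>N\<^esub> g (restrict c {..<m})) a" if a: "a \<in> carrier R" for a
    proof -
      have "restrict (ract ?F' c a) {..<m} = ract ?F (restrict c {..<m}) a"
        by (auto simp: free_rmodule_def)
      moreover have "ract ?F' c a m = c m \<otimes>\<^bsub>R\<^esub> a" by (simp add: free_rmodule_def)
      ultimately show ?thesis
        by (simp add: rhom_ract[OF g(1) res[OF c] a] N.ract_add_left N.ract_closed s top c a
            rhom_closed[OF g(1)] res N.ract_assoc)
    qed
    fix d assume d: "d \<in> carrier ?F'"
    have "restrict (c \<oplus>\<^bsub>?F'\<^esub> d) {..<m} = restrict c {..<m} \<oplus>\<^bsub>?F\<^esub> restrict d {..<m}"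
      by (auto simp: free_rmodule_def)
    moreover have "(c \<oplus>\<^bsub>?F'\<^esub> d) m = c m \<oplus>\<^bsub>R\<^esub> d m" by (simp add: free_rmodule_def)
    ultimately show "ract N s ((c \<oplus>\<^bsub>?F'\<^esub> d) m) \<oplus>\<^bsub>N\<^esub> g (restrict (c \<oplus>\<^bsub>?F'\<^esub> d) {..<m}) =
        ract N s (c m) \<oplus>\<^bsub>N\<^esub> g (restrict c {..<m}) \<oplus>\<^bsub>N\<^esub> (ract N s (d m) \<oplus>\<^bsub>N\<^esub> g (restrict d {..<m}))"
      by (simp add: rhom_add[OF g(1)] res c d N.ract_add_right s top N.M.a_ac N.ract_closed rhom_closed[OF g(1)])
  qed
  moreover have "x \<in> ?g ` carrier ?F'" if "x \<in> insert s S" for x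
  proof (cases "x = s")
    case True
    let ?c = "\<lambda>i\<in>{..<Suc m}. if i = m then \<one>\<^bsub>R\<^esub> else \<zero>\<^bsub>R\<^esub>"
    have c: "?c \<in> carrier ?F'" by (simp add: car)
    have "restrict ?c {..<m} = \<zero>\<^bsub>?F\<^esub>" by (auto simp: free_rmodule_def)
    then have "g (restrict ?c {..<m}) = \<zero>\<^bsub>N\<^esub>"
      using rhom_zero[OF g(1) right_module_abelian_group[OF F(1)] N.M.abelian_group_axioms] by simp
    then have "?g ?c = x" using c s True by (simp add: N.ract_one)
    moreover have "?g ?c \<in> ?g ` carrier ?F'" using c by (rule imageI)
    ultimately show ?thesis by (simp only:)
  next
    case False
    then have "x \<in> g ` carrier ?F" using g(2) that by blast
    then obtain c where c: "c \<in> carrier ?F" "g c = x" by blast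
    let ?c = "\<lambda>i\<in>{..<Suc m}. if i = m then \<zero>\<^bsub>R\<^esub> else c i"
    have c': "?c \<in> carrier ?F'"
      using PiE_mem[of c "{..<m}" "\<lambda>_. carrier R"] c(1) by (simp add: car less_Suc_eq)
    have "restrict ?c {..<m} = restrict c {..<m}" by auto
    also have "\<dots> = c" using c(1) unfolding car by (rule PiE_restrict)
    finally have "?g ?c = x"
      using c' c s rhom_closed[OF g(1) c(1)] by (simp add: N.ract_zero_right)
    moreover have "?g ?c \<in> ?g ` carrier ?F'" using c' by (rule imageI)
    ultimately show ?thesis by (simp only:)
  qed
  ultimately show ?case by blast
qed

lemma free_rmodule_cover:
  assumes N: "right_module R N" and "fin_gen R N"
  shows "\<exists>m. \<exists>g \<in> rhom R (free_rmodule R m) N. g ` carrier (free_rmodule R m) = carrier N"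
proof -
  obtain S where S: "finite S" "S \<subseteq> carrier N" "carrier N \<subseteq> rhull R N S"
    using assms by (auto simp: fin_gen_iff)
  obtain m g where g: "g \<in> rhom R (free_rmodule R m) N" "S \<subseteq> g ` carrier (free_rmodule R m)"
    using free_rmodule_cover_set[OF N S(1,2)] by blast
  have F: "right_module R (free_rmodule R m)"
    by (rule dbproj_right_module[OF dbproj_free_rmodule[OF right_module_ring[OF N]]])
  have "carrier N \<subseteq> g ` carrier (free_rmodule R m)"
    using rhull_minimal[OF image_submod[OF g(1) F N] g(2)] S(3) by blast
  then show ?thesis
    using g(1) rhom_closed[OF g(1)] by blast
qed

text \<open>From left to right, the lifting property is applied once, to the identity of
  \<open>P\<close> against a free cover. Cover and \<open>P\<close> both have elements in
  \<open>nat \<Rightarrow> 'a\<close>, so they are admissible test modules. Thus \<open>P\<close> is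
  a retract of a free module and inherits its dual basis.\<close>

lemma fg_projective_iff_dbproj:
  fixes P :: "('a, nat \<Rightarrow> 'a) rmodule"
  shows "fg_projective R P \<longleftrightarrow> dbproj R P"
proof
  assume fg: "fg_projective R P"
  then have P: "right_module R P" "fin_gen R P" by (auto simp: fg_projective_def)
  obtain m g where g: "g \<in> rhom R (free_rmodule R m) P" "g ` carrier (free_rmodule R m) = carrier P"
    using free_rmodule_cover[OF P] by blast
  let ?F = "free_rmodule R m"
  have F: "dbproj R ?F" by (rule dbproj_free_rmodule[OF right_module_ring[OF P(1)]])
  note F' = dbproj_right_module[OF F]
  have "\<exists>l \<in> rhom R P ?F. \<forall>x\<in>carrier P. g (l x) = (\<lambda>x\<in>carrier P. x) x"
    using fg g id_rhom[OF P(1)] F' dbproj_fin_gen[OF F] P unfolding fg_projective_def by blast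
  then obtain l where l: "l \<in> rhom R P ?F" "\<And>x. x \<in> carrier P \<Longrightarrow> g (l x) = x" by auto
  have "compose (carrier P) (compose (carrier ?F) g (\<lambda>x\<in>carrier ?F. x)) l \<in> frank R P P"
    using F by (intro frank_compose_right[OF frank_compose_left[OF _ g(1) F' F' P(1)] l(1) P(1)])
      (simp add: dbproj_def)
  moreover have "compose (carrier P) (compose (carrier ?F) g (\<lambda>x\<in>carrier ?F. x)) l = (\<lambda>x\<in>carrier P. x)"
    unfolding compose_def by (intro restrict_ext) (simp add: l(2) rhom_closed[OF l(1)])
  ultimately show "dbproj R P" using P(1) unfolding dbproj_def by (simp only:)
next
  assume P: "dbproj R P"
  note P' = dbproj_right_module[OF P]
  show "fg_projective R P"
    unfolding fg_projective_def
  proof (intro conjI allI ballI impI)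
    fix M N :: "('a, nat \<Rightarrow> 'a) rmodule" and g h
    assume g: "g \<in> rhom R M N" and h: "h \<in> rhom R P N"
      and *: "right_module R M \<and> fin_gen R M \<and> right_module R N \<and> fin_gen R N \<and> g ` carrier M = carrier N"
    then have "h ` carrier P \<subseteq> g ` carrier M" using rhom_closed[OF h] by auto
    then show "\<exists>l\<in>rhom R P M. \<forall>x\<in>carrier P. g (l x) = h x"
      using dbproj_lift[OF P g h] * by simp
  qed (use P' dbproj_fin_gen[OF P] in simp_all)
qed

section \<open>Finite dimensional vector spaces and algebras\<close>

lemma rhull_mono: "x \<in> rhull R M S \<Longrightarrow> S \<subseteq> T \<Longrightarrow> x \<in> rhull R M T"
proof (induction rule: rhull.induct)
  case zero
  show ?case by (rule rhull.zero)
next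
  case (add s a x)
  then show ?case using rhull.add[of s T a R x M] by blast
qed

lemma rhull_insertE:
  assumes "x \<in> rhull R M (insert s S)" and M: "right_module R M" and S: "insert s S \<subseteq> carrier M"
  obtains a y where "a \<in> carrier R" "y \<in> rhull R M S" "x = ract M s a \<oplus>\<^bsub>M\<^esub> y"
proof -
  interpret right_module R M by fact
  have c: "y \<in> carrier M" if "y \<in> rhull R M S" for y
    using rhull_closed[OF that M] S by simp
  have s: "s \<in> carrier M" using S by simp
  have "\<exists>a y. a \<in> carrier R \<and> y \<in> rhull R M S \<and> x = ract M s a \<oplus>\<^bsub>M\<^esub> y"
    using assms(1)
  proof induction
    case zero
    have "\<zero>\<^bsub>M\<^esub> = ract M s \<zero>\<^bsub>R\<^esub> \<oplus>\<^bsub>M\<^esub> \<zero>\<^bsub>M\<^esub>" using s by (simp add: ract_zero_right)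
    then show ?case using rhull.zero[of M R S] R.zero_closed by blast
  next
    case (add t b x)
    then obtain a y where ay: "a \<in> carrier R" "y \<in> rhull R M S" "x = ract M s a \<oplus>\<^bsub>M\<^esub> y" by blast
    have t: "t \<in> carrier M" using add(1) S by auto
    show ?case
    proof (cases "t = s")
      case True
      have "ract M t b \<oplus>\<^bsub>M\<^esub> x = ract M s (b \<oplus>\<^bsub>R\<^esub> a) \<oplus>\<^bsub>M\<^esub> y"
        using ay add(2) c[OF ay(2)] s True by (simp add: ract_add_right M.a_assoc ract_closed)
      then show ?thesis using ay add(2) R.a_closed by blast
    next
      case False
      then have "ract M t b \<oplus>\<^bsub>M\<^esub> y \<in> rhull R M S" using add(1,2) ay(2) by (intro rhull.add) auto
      moreover have "ract M t b \<oplus>\<^bsub>M\<^esub> x = ract M s a \<oplus>\<^bsub>M\<^esub> (ract M t b \<oplus>\<^bsub>M\<^esub> y)"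
        using ay add(2) c[OF ay(2)] s t by (simp add: ract_closed M.a_ac)
      ultimately show ?thesis using ay by blast
    qed
  qed
  then show thesis using that by blast
qed

text \<open>Elimination of one generator: if some \<open>w\<close> in \<open>N\<close> involves
  \<open>s\<close>, subtracting a multiple of \<open>w\<close> from any element of \<open>N\<close>
  brings it into \<open>N \<inter> rhull K M S\<close>, which is finitely spanned by induction. So
  \<open>w\<close> is the only vector to add.\<close>

lemma subspace_rhull_finite:
  assumes K: "field K" and M: "right_module K M" and "finite S" "S \<subseteq> carrier M"
    "is_submod K M N" "N \<subseteq> rhull K M S"
  shows "\<exists>T. finite T \<and> T \<subseteq> N \<and> N \<subseteq> rhull K M T"
proof -
  interpret K: field K by fact
  interpret M: right_module K M by fact
  show ?thesis using assms(3-)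
  proof (induction S arbitrary: N)
    case empty
    then show ?case by (intro exI[of _ "{}"]) auto
  next
    case (insert s S)
    have sub: "is_submod K M (N \<inter> rhull K M S)"
      using insert.prems is_submod_rhull[OF M, of S] by (auto simp: is_submod_def)
    then obtain T where T: "finite T" "T \<subseteq> N \<inter> rhull K M S" "N \<inter> rhull K M S \<subseteq> rhull K M T"
      using insert.IH[of "N \<inter> rhull K M S"] insert.prems by auto
    show ?case
    proof (cases "N \<subseteq> rhull K M S")
      case True
      then have "N \<inter> rhull K M S = N" by blast
      then show ?thesis using T by auto
    next
      case False
      then obtain w where w: "w \<in> N" "w \<notin> rhull K M S" by blast
      have c: "y \<in> carrier M" if "y \<in> rhull K M S" for y
        using rhull_closed[OF that M] insert.prems by simp
      have Nc: "y \<in> carrier M" if "y \<in> N" for y using that insert.prems(2) by (auto simp: is_submod_def)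
      have s: "s \<in> carrier M" using insert.prems by simp
      obtain a u where u: "a \<in> carrier K" "u \<in> rhull K M S" "w = ract M s a \<oplus>\<^bsub>M\<^esub> u"
        using rhull_insertE[OF _ M] w insert.prems by (metis subsetD)
      have "a \<noteq> \<zero>\<^bsub>K\<^esub>"
        using u w(2) s c[OF u(2)] by (auto simp: M.ract_zero_right)
      then have "a \<in> Units K" using u(1) by (simp add: K.field_Units)
      have "x \<in> rhull K M (insert w T)" if x: "x \<in> N" for x
      proof -
        obtain b y where y: "b \<in> carrier K" "y \<in> rhull K M S" "x = ract M s b \<oplus>\<^bsub>M\<^esub> y"
          using rhull_insertE[OF _ M] x insert.prems by (metis subsetD)
        \<comment> \<open>With \<open>w = s a + u\<close> and \<open>x = s b + y\<close>, this is
          the factor for which \<open>x - w d\<close> no longer contains \<open>s\<close>.\<close>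
        define d where "d = inv\<^bsub>K\<^esub> a \<otimes>\<^bsub>K\<^esub> b"
        have d: "d \<in> carrier K" "a \<otimes>\<^bsub>K\<^esub> d = b"
          using \<open>a \<in> Units K\<close> y(1) u(1) by (simp_all add: d_def K.m_assoc[symmetric])
        define x' where "x' = x \<oplus>\<^bsub>M\<^esub> \<ominus>\<^bsub>M\<^esub> ract M w d"
        have wd: "ract M w d = ract M s b \<oplus>\<^bsub>M\<^esub> ract M u d"
          using u s d c[OF u(2)] by (simp add: M.ract_add_left M.ract_closed M.ract_assoc[symmetric])
        have "x' = y \<oplus>\<^bsub>M\<^esub> \<ominus>\<^bsub>M\<^esub> ract M u d"
          using y s d c[OF u(2)] c[OF y(2)]
          by (simp add: x'_def wd M.ract_closed M.M.minus_add M.M.a_ac M.M.r_neg2 M.M.r_neg1)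
        then have "x' \<in> rhull K M S"
          using y(2) u(2) d(1) submod_minus_closed[OF M is_submod_rhull[OF M]] insert.prems
          by (auto intro!: rhull_plus[OF _ _ M] rhull_ract[OF _ _ M])
        moreover have "x' \<in> N"
          using x w(1) d(1) submod_minus_closed[OF M insert.prems(2)] insert.prems(2)
          by (simp add: x'_def is_submod_def)
        ultimately have "x' \<in> rhull K M (insert w T)"
          using T(3) by (blast intro: rhull_mono)
        moreover have "x = ract M w d \<oplus>\<^bsub>M\<^esub> x'"
          using Nc[OF x] Nc[OF w(1)] d(1) by (simp add: x'_def M.ract_closed M.M.a_ac M.M.r_neg)
        ultimately show ?thesis using rhull.add[of w "insert w T" d K x' M] d(1) by simp
      qed
      then show ?thesis
        using T w by (intro exI[of _ "insert w T"]) auto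
    qed
  qed
qed

text \<open>Existence of a dual basis of a finitely spanned space. If \<open>s\<close> is outside
  the span of \<open>S\<close>, its coordinate is a functional \<open>\<chi>\<close>, and the
  identity is \<open>s \<chi>\<close> plus the projection to the old span along \<open>s\<close>,
  which factors through a space that has a dual basis by induction.\<close>

lemma subspace_identity_frank:
  assumes K: "field K" and M: "right_module K M" and "finite S" "S \<subseteq> carrier M"
  shows "dbproj K (submod M (rhull K M S))"
proof -
  interpret K: field K by fact
  interpret M: right_module K M by fact
  show ?thesis using assms(3-)
  proof (induction S)
    case empty
    have "rhull K M {} = {\<zero>\<^bsub>M\<^esub>}"
      using rhull_minimal[of K M "{\<zero>\<^bsub>M\<^esub>}" "{}"] rhull.zero[of M K "{}"]
      by (auto simp: is_submod_def M.ract_zero_left)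
    moreover have "(\<lambda>x\<in>{\<zero>\<^bsub>M\<^esub>}. x) = (\<lambda>x\<in>{\<zero>\<^bsub>M\<^esub>}. \<zero>\<^bsub>M\<^esub>)" by auto
    ultimately show ?case
      using frank.zero[where M="submod M (rhull K M {})" and N="submod M (rhull K M {})" and R=K]
        right_module_submod[OF M is_submod_rhull[OF M, of "{}"]]
      by (simp add: dbproj_def)
  next
    case (insert s S)
    let ?V = "submod M (rhull K M S)" and ?V' = "submod M (rhull K M (insert s S))"
    have V: "dbproj K ?V" using insert by simp
    have sub: "is_submod K M (rhull K M S)" "is_submod K M (rhull K M (insert s S))"
      using insert.prems by (auto intro!: is_submod_rhull[OF M])
    note V1 = right_module_submod[OF M sub(1)] and V2 = right_module_submod[OF M sub(2)]
    show ?case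
    proof (cases "s \<in> rhull K M S")
      case True
      have "rhull K M (insert s S) = rhull K M S"
      proof
        show "rhull K M (insert s S) \<subseteq> rhull K M S"
          using True rhull_inc[OF _ M] insert.prems by (intro rhull_minimal[OF sub(1)]) auto
      qed (blast intro: rhull_mono)
      then show ?thesis using V by simp
    next
      case False
      have c: "y \<in> carrier M" if "y \<in> rhull K M S" for y
        using rhull_closed[OF that M] insert.prems by simp
      have s: "s \<in> carrier M" using insert.prems by simp
      have ex: "\<exists>a y. a \<in> carrier K \<and> y \<in> rhull K M S \<and> x = ract M s a \<oplus>\<^bsub>M\<^esub> y"
        if "x \<in> rhull K M (insert s S)" for x
        using rhull_insertE[OF that M insert.prems] by metis
      \<comment> \<open>If the coefficients of \<open>s\<close> differed, dividing by their
        difference would put \<open>s\<close> into the span of \<open>S\<close>.\<close>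
      have uniq: "a = b" if "a \<in> carrier K" "b \<in> carrier K" "y \<in> rhull K M S" "z \<in> rhull K M S"
        "ract M s a \<oplus>\<^bsub>M\<^esub> y = ract M s b \<oplus>\<^bsub>M\<^esub> z" for a b y z
      proof (rule ccontr)
        assume "a \<noteq> b"
        define d where "d = a \<ominus>\<^bsub>K\<^esub> b"
        have d: "d \<in> Units K"
          using \<open>a \<noteq> b\<close> that by (simp add: d_def K.field_Units)
        have "ract M s d = z \<oplus>\<^bsub>M\<^esub> \<ominus>\<^bsub>M\<^esub> y"
        proof -
          have a: "a = d \<oplus>\<^bsub>K\<^esub> b" using that by (simp add: d_def a_minus_def K.a_assoc K.l_neg)
          have dc: "d \<in> carrier K" using that by (simp add: d_def)
          have "ract M s b \<oplus>\<^bsub>M\<^esub> (ract M s d \<oplus>\<^bsub>M\<^esub> y) = ract M s b \<oplus>\<^bsub>M\<^esub> z"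
            using that(5) dc that(2) s c[OF that(3)]
            by (simp add: a M.ract_add_right M.ract_closed M.M.a_ac)
          then have "ract M s d \<oplus>\<^bsub>M\<^esub> y = z"
            using dc that s c by (simp add: M.ract_closed)
          then show ?thesis using dc s c[OF that(3)]
            by (simp add: M.ract_closed M.M.a_assoc M.M.r_neg flip: \<open>ract M s d \<oplus>\<^bsub>M\<^esub> y = z\<close>)
        qed
        then have "ract M s d \<in> rhull K M S"
          using that submod_minus_closed[OF M sub(1)] insert.prems by (auto intro!: rhull_plus[OF _ _ M])
        from rhull_ract[OF this _ M, of "inv\<^bsub>K\<^esub> d"]
        have "ract M (ract M s d) (inv\<^bsub>K\<^esub> d) \<in> rhull K M S"
          using d insert.prems by simp
        moreover have "ract M (ract M s d) (inv\<^bsub>K\<^esub> d) = s"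
          using d s M.ract_assoc[of s d "inv\<^bsub>K\<^esub> d"] by (simp add: M.ract_one K.Units_closed)
        ultimately show False
          using False by simp
      qed
      define \<chi> where "\<chi> = (\<lambda>x\<in>rhull K M (insert s S).
        THE a. a \<in> carrier K \<and> (\<exists>y\<in>rhull K M S. x = ract M s a \<oplus>\<^bsub>M\<^esub> y))"
      have \<chi>: "\<chi> x = a"
        if "a \<in> carrier K" "y \<in> rhull K M S" "x = ract M s a \<oplus>\<^bsub>M\<^esub> y" for x a y
      proof -
        have "x \<in> rhull K M (insert s S)"
          unfolding that(3) using that by (intro rhull.add) (auto intro: rhull_mono)
        moreover have "(THE a. a \<in> carrier K \<and> (\<exists>y\<in>rhull K M S. x = ract M s a \<oplus>\<^bsub>M\<^esub> y)) = a"
          by (rule the_equality) (use that uniq in blast)+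
        ultimately show ?thesis by (simp add: \<chi>_def)
      qed
      have \<chi>_hom: "\<chi> \<in> rhom K ?V' (regular_bimod K)"
      proof -
        have "(\<lambda>x\<in>carrier ?V'. \<chi> x) \<in> rhom K ?V' (regular_bimod K)"
        proof (rule rhomI[OF _ _ _ V2])
          fix x assume "x \<in> carrier ?V'"
          then obtain a y where x: "a \<in> carrier K" "y \<in> rhull K M S" "x = ract M s a \<oplus>\<^bsub>M\<^esub> y"
            using ex[of x] by auto
          show "\<chi> x \<in> carrier (regular_bimod K)" using \<chi>[OF x] x(1) by simp
          show "\<chi> (ract ?V' x b) = ract (regular_bimod K) (\<chi> x) b" if b: "b \<in> carrier K" for b
          proof -
            have "ract M x b = ract M s (a \<otimes>\<^bsub>K\<^esub> b) \<oplus>\<^bsub>M\<^esub> ract M y b"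
              using x b s c[OF x(2)] by (simp add: M.ract_add_left M.ract_closed M.ract_assoc)
            moreover have "ract M y b \<in> rhull K M S" using x(2) b insert.prems by (auto intro: rhull_ract[OF _ _ M])
            ultimately show ?thesis using \<chi>[OF x] \<chi>[of "a \<otimes>\<^bsub>K\<^esub> b"] x(1) b by simp
          qed
          fix x' assume "x' \<in> carrier ?V'"
          then obtain a' y' where x': "a' \<in> carrier K" "y' \<in> rhull K M S" "x' = ract M s a' \<oplus>\<^bsub>M\<^esub> y'"
            using ex[of x'] by auto
          have "x \<oplus>\<^bsub>M\<^esub> x' = ract M s (a \<oplus>\<^bsub>K\<^esub> a') \<oplus>\<^bsub>M\<^esub> (y \<oplus>\<^bsub>M\<^esub> y')"
            using x x' s c[OF x(2)] c[OF x'(2)] by (simp add: M.ract_add_right M.ract_closed M.M.a_ac)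
          moreover have "y \<oplus>\<^bsub>M\<^esub> y' \<in> rhull K M S" using x(2) x'(2) insert.prems by (auto intro: rhull_plus[OF _ _ M])
          ultimately show "\<chi> (x \<oplus>\<^bsub>?V'\<^esub> x') = \<chi> x \<oplus>\<^bsub>regular_bimod K\<^esub> \<chi> x'"
            using \<chi>[OF x] \<chi>[OF x'] \<chi>[of "a \<oplus>\<^bsub>K\<^esub> a'"] x(1) x'(1) by simp
        qed
        moreover have "(\<lambda>x\<in>carrier ?V'. \<chi> x) = \<chi>"
          unfolding \<chi>_def submod_simps by (rule ext) simp
        ultimately show ?thesis by (simp only:)
      qed
      have s': "s \<in> carrier ?V'" using rhull_inc[of s "insert s S", OF _ M insert.prems] by simp
      let ?f = "\<lambda>x\<in>carrier ?V'. ract ?V' s (\<chi> x)"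
      have f: "?f \<in> frank K ?V' ?V'" by (rule frank_scaled[OF s' \<chi>_hom V2])
      \<comment> \<open>The projection to the span of \<open>S\<close> along
        \<open>s\<close>.\<close>
      let ?r = "\<lambda>x\<in>carrier ?V'. (\<lambda>x\<in>carrier ?V'. x) x \<ominus>\<^bsub>?V'\<^esub> ?f x"
      have r_eq: "?r x = y" if x: "a \<in> carrier K" "y \<in> rhull K M S" "x = ract M s a \<oplus>\<^bsub>M\<^esub> y" for x a y
      proof -
        interpret V2: right_module K ?V' by (rule V2)
        have "x \<in> rhull K M (insert s S)"
          unfolding x(3) using x by (intro rhull.add) (auto intro: rhull_mono)
        moreover have "y \<in> rhull K M (insert s S)" using x(2) by (rule rhull_mono) auto
        moreover have "ract M s a \<in> rhull K M (insert s S)"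
          using x(1) insert.prems by (intro rhull_ract[OF rhull_inc[OF _ M] _ M]) auto
        ultimately show ?thesis
          using \<chi>[OF x] V2.M.r_neg[of "ract M s a"] V2.M.a_assoc[of y "ract M s a" "\<ominus>\<^bsub>?V'\<^esub> ract M s a"]
            V2.M.r_zero[of y] c[OF x(2)] x s
          by (simp add: a_minus_def M.M.a_comm[of "ract M s a"] M.ract_closed V2.M.a_inv_closed[simplified])
      qed
      have r: "?r \<in> rhom K ?V' ?V"
      proof -
        have "?r \<in> rhom K ?V' ?V'"
          by (rule diff_rhom[OF id_rhom[OF V2] frank_rhom[OF f V2 V2] V2 V2])
        moreover have "?r x \<in> rhull K M S" if x: "x \<in> carrier ?V'" for x
        proof -
          obtain a y where ay: "a \<in> carrier K" "y \<in> rhull K M S" "x = ract M s a \<oplus>\<^bsub>M\<^esub> y"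
            using ex[of x] x by auto
          show ?thesis unfolding r_eq[OF ay] by (rule ay(2))
        qed
        then have "?r ` carrier ?V' \<subseteq> rhull K M S" by (rule image_subsetI)
        ultimately have "?r \<in> rhom K ?V' (submod ?V' (rhull K M S))"
          by (rule corestrict_rhom)
        then show ?thesis by (simp add: submod_def)
      qed
      obtain rr where rr: "rr \<in> rhom K ?V' ?V"
        "\<And>x a y. a \<in> carrier K \<Longrightarrow> y \<in> rhull K M S \<Longrightarrow> x = ract M s a \<oplus>\<^bsub>M\<^esub> y \<Longrightarrow> rr x = y"
        by (rule that[OF r r_eq])
      have incl: "(\<lambda>x\<in>carrier ?V. x) \<in> rhom K ?V ?V'"
        by (intro rhomI V1) (auto intro: rhull_mono)
      have "compose (carrier ?V') (compose (carrier ?V) (\<lambda>x\<in>carrier ?V. x) (\<lambda>x\<in>carrier ?V. x)) rr \<in> frank K ?V' ?V'"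
        using V by (intro frank_compose_right[OF frank_compose_left[OF _ incl V1 V1 V2] rr(1) V2]) (simp add: dbproj_def)
      from frank_plus[OF f this V2 V2]
      have "(\<lambda>x\<in>carrier ?V'. ?f x \<oplus>\<^bsub>?V'\<^esub> compose (carrier ?V') (compose (carrier ?V) (\<lambda>x\<in>carrier ?V. x)
          (\<lambda>x\<in>carrier ?V. x)) rr x) \<in> frank K ?V' ?V'" .
      moreover have "(\<lambda>x\<in>carrier ?V'. ?f x \<oplus>\<^bsub>?V'\<^esub> compose (carrier ?V') (compose (carrier ?V) (\<lambda>x\<in>carrier ?V. x)
          (\<lambda>x\<in>carrier ?V. x)) rr x) = (\<lambda>x\<in>carrier ?V'. x)"
      proof (rule restrict_ext)
        fix x assume x: "x \<in> carrier ?V'"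
        then obtain a y where ay: "a \<in> carrier K" "y \<in> rhull K M S" "x = ract M s a \<oplus>\<^bsub>M\<^esub> y"
          using ex[of x] by auto
        have "compose (carrier ?V') (compose (carrier ?V) (\<lambda>x\<in>carrier ?V. x) (\<lambda>x\<in>carrier ?V. x)) rr x = y"
          using x rr(2)[OF ay] ay(2) by (simp add: compose_def)
        then show "?f x \<oplus>\<^bsub>?V'\<^esub> compose (carrier ?V') (compose (carrier ?V) (\<lambda>x\<in>carrier ?V. x)
          (\<lambda>x\<in>carrier ?V. x)) rr x = x" using x \<chi>[OF ay] ay(3) by simp
      qed
      ultimately show ?thesis using V2 unfolding dbproj_def by (simp only:)
    qed
  qed
qed

section \<open>Algebras and their modules as vector spaces\<close>

abbreviation scalars :: "('k, 'a, 's) module_scheme \<Rightarrow> ('a, 'm, 'z) rmodule_scheme \<Rightarrow> ('k, 'm) rmodule" where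
  "scalars A M \<equiv> restrict_scalars (\<lambda>c. c \<odot>\<^bsub>A\<^esub> \<one>\<^bsub>A\<^esub>) M"

context k_algebra
begin

lemma ring_A: "ring A" and ring_K: "ring K" and field_K: "field K"
  by (rule A.ring_axioms K.ring_axioms K.field_axioms)+

lemma scalar_closed [simp]: "c \<in> carrier K \<Longrightarrow> c \<odot>\<^bsub>A\<^esub> \<one>\<^bsub>A\<^esub> \<in> carrier A"
  by (simp add: smult_closed)

lemma mult_scalar: "c \<in> carrier K \<Longrightarrow> x \<in> carrier A \<Longrightarrow> x \<otimes>\<^bsub>A\<^esub> (c \<odot>\<^bsub>A\<^esub> \<one>\<^bsub>A\<^esub>) = c \<odot>\<^bsub>A\<^esub> x"
  by (simp add: smult_mult_right)

lemma scalar_mult: "c \<in> carrier K \<Longrightarrow> x \<in> carrier A \<Longrightarrow> (c \<odot>\<^bsub>A\<^esub> \<one>\<^bsub>A\<^esub>) \<otimes>\<^bsub>A\<^esub> x = c \<odot>\<^bsub>A\<^esub> x"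
  by (simp add: smult_mult_left)

lemma scalar_central:
  "c \<in> carrier K \<Longrightarrow> x \<in> carrier A \<Longrightarrow>
    (c \<odot>\<^bsub>A\<^esub> \<one>\<^bsub>A\<^esub>) \<otimes>\<^bsub>A\<^esub> x = x \<otimes>\<^bsub>A\<^esub> (c \<odot>\<^bsub>A\<^esub> \<one>\<^bsub>A\<^esub>)"
  by (simp add: mult_scalar scalar_mult)

lemma scalar_hom: "(\<lambda>c. c \<odot>\<^bsub>A\<^esub> \<one>\<^bsub>A\<^esub>) \<in> ring_hom K A"
  by (rule ring_hom_memI) (simp_all add: scalar_mult smult_assoc1 smult_l_distr smult_one)

lemma right_module_scalars: "right_module A M \<Longrightarrow> right_module K (scalars A M)"
  by (rule right_module_restrict_scalars[OF scalar_hom ring_K])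

text \<open>\<open>finite_dim\<close> uses the left scalar multiplication of the algebra,
  \<open>scalars\<close> the right action of \<open>c \<odot> \<one>\<close>; on elements of the
  algebra the two coincide.\<close>

lemma finite_dim_fin_gen:
  assumes "finite_dim K A"
  shows "fin_gen K (scalars A (regular_bimod A))"
proof -
  obtain S where S: "finite S" "S \<subseteq> carrier A"
    "\<And>x. x \<in> carrier A \<Longrightarrow> \<exists>c \<in> S \<rightarrow> carrier K. x = (\<Oplus>\<^bsub>A\<^esub>s\<in>S. c s \<odot>\<^bsub>A\<^esub> s)"
    using assms unfolding finite_dim_def by blast
  let ?V = "scalars A (regular_bimod A)"
  have "(\<Oplus>\<^bsub>A\<^esub>s\<in>T. c s \<odot>\<^bsub>A\<^esub> s) \<in> rhull K ?V S" if "finite T" "T \<subseteq> S" "c \<in> S \<rightarrow> carrier K" for T c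
    using that
  proof induction
    case empty
    show ?case using rhull.zero[of ?V K S] by simp
  next
    case (insert t T)
    have t: "t \<in> S" "t \<in> carrier A" "c t \<in> carrier K" "T \<subseteq> S"
      using insert.prems S(2) by auto
    have "(\<Oplus>\<^bsub>A\<^esub>s\<in>insert t T. c s \<odot>\<^bsub>A\<^esub> s) = c t \<odot>\<^bsub>A\<^esub> t \<oplus>\<^bsub>A\<^esub> (\<Oplus>\<^bsub>A\<^esub>s\<in>T. c s \<odot>\<^bsub>A\<^esub> s)"
      using insert S(2) by (intro abelian_monoid.finsum_insert[OF abelian_group.axioms(1)[OF ring.is_abelian_group[OF ring_A]]]) (auto intro!: smult_closed)
    moreover have "ract ?V t (c t) \<oplus>\<^bsub>?V\<^esub> (\<Oplus>\<^bsub>A\<^esub>s\<in>T. c s \<odot>\<^bsub>A\<^esub> s) \<in> rhull K ?V S"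
      by (intro rhull.add t(1,3) insert.IH[OF t(4) insert.prems(2)])
    ultimately show ?case using t by (simp add: mult_scalar)
  qed
  then have "carrier A \<subseteq> rhull K ?V S"
    using S(1,3) by blast
  then show ?thesis
    using S(1,2) by (subst fin_gen_iff[OF right_module_scalars[OF right_module_regular[OF ring_A]]]) auto
qed

text \<open>The products of the generators of \<open>M\<close> with a spanning set of
  \<open>A\<close> span \<open>M\<close> over the field.\<close>

lemma finite_dim_module_rhull:
  assumes A: "fin_gen K (scalars A (regular_bimod A))"
    and M: "right_module A M" and "fin_gen A M"
  shows "\<exists>S. finite S \<and> S \<subseteq> carrier M \<and> carrier M \<subseteq> rhull K (scalars A M) S"
proof -
  interpret M: right_module A M by fact
  obtain D where fd: "carrier A \<subseteq> rhull K (scalars A (regular_bimod A)) D" "finite D" "D \<subseteq> carrier A"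
    using A by (auto simp: fin_gen_iff[OF right_module_scalars[OF right_module_regular[OF ring_A]]])
  obtain G where G: "finite G" "G \<subseteq> carrier M" "carrier M \<subseteq> rhull A M G"
    using \<open>fin_gen A M\<close> by (auto simp: fin_gen_iff[OF M])
  note SM = right_module_scalars[OF M]
  let ?S = "(\<lambda>(g, d). ract M g d) ` (G \<times> D)"
  have S: "?S \<subseteq> carrier (scalars A M)" using G(2) fd(3) by (auto intro!: M.ract_closed)
  have gen: "ract M g a \<in> rhull K (scalars A M) ?S"
    if g: "g \<in> G" and "a \<in> rhull K (scalars A (regular_bimod A)) D" for g a
    using that(2)
  proof induction
    case zero
    then show ?case using rhull.zero[of "scalars A M" K ?S] g G(2) by (auto simp: M.ract_zero_right)
  next
    case (add d c x)
    have x: "x \<in> carrier A"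
      using rhull_closed[OF add(3) right_module_scalars[OF right_module_regular[OF ring_A]]] fd(3) by simp
    have "ract (scalars A M) (ract M g d) c \<oplus>\<^bsub>scalars A M\<^esub> ract M g x \<in> rhull K (scalars A M) ?S"
      using add g by (intro rhull.add) auto
    moreover have "g \<in> carrier M" "d \<in> carrier A" using g add(1) G(2) fd(3) by auto
    ultimately show ?case using add(2) x
      by (simp add: M.ract_add_right M.ract_assoc)
  qed
  have "x \<in> rhull K (scalars A M) ?S" if "x \<in> rhull A M G" for x
    using that
  proof induction
    case zero
    then show ?case using rhull.zero[of "scalars A M" K ?S] by simp
  next
    case (add g a x)
    then show ?case using rhull_plus[OF gen _ SM S, of g a x] fd(1) by auto
  qed
  then show ?thesis using G fd S by (intro exI[of _ ?S]) auto
qed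

text \<open>A submodule is a subspace of a finite dimensional space, and a set that spans it over
  the field generates it over \<open>A\<close>. This makes kernels finitely generated, so that a
  resolution can be continued by free covers.\<close>

lemma fin_gen_submod:
  assumes fd: "fin_gen K (scalars A (regular_bimod A))" and M: "right_module A M" and "fin_gen A M" and N: "is_submod A M N"
  shows "fin_gen A (submod M N)"
proof -
  obtain S where S: "finite S" "S \<subseteq> carrier M" "carrier M \<subseteq> rhull K (scalars A M) S"
    using finite_dim_module_rhull[OF fd M assms(3)] by blast
  have "is_submod K (scalars A M) N" using N by (auto simp: is_submod_def)
  moreover have "N \<subseteq> rhull K (scalars A M) S" "S \<subseteq> carrier (scalars A M)"
    using N S by (auto simp: is_submod_def)
  ultimately obtain T where T: "finite T" "T \<subseteq> N" "N \<subseteq> rhull K (scalars A M) T"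
    using subspace_rhull_finite[OF field_K right_module_scalars[OF M] S(1), of N] by blast
  have "x \<in> rhull A M T" if "x \<in> rhull K (scalars A M) T" for x
    using that
  proof induction
    case zero
    then show ?case using rhull.zero[of M A T] by simp
  next
    case (add s c x)
    then show ?case using rhull.add[of s T "c \<odot>\<^bsub>A\<^esub> \<one>\<^bsub>A\<^esub>" A x M] by simp
  qed
  then have "N \<subseteq> rhull A (submod M N) T"
    using T(3) rhull_submod_subset[of A M T N] by blast
  then show ?thesis
    using T by (subst fin_gen_iff[OF right_module_submod[OF M N]]) auto
qed

end

section \<open>Projective resolutions and chain maps\<close>

text \<open>\<open>proj_resolution\<close> with the dual basis criterion, hence meaningful for terms
  of any element type. Resolutions inflated from \<open>C\<close> to \<open>B\<close> have terms
  with elements in the type that belongs to \<open>C\<close>.\<close>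

definition pres ::
    "('a, 'r) ring_scheme \<Rightarrow> ('a, 'x, 'z) rmodule_scheme \<Rightarrow> ('a, 'm, 'x) resolution \<Rightarrow> bool" where
  "pres R V Q \<longleftrightarrow>
    right_module R V \<and>
    (\<forall>i. dbproj R (rterm Q i)) \<and>
    (\<forall>i. rdiff Q i \<in> rhom R (rterm Q (Suc i)) (rterm Q i)) \<and>
    raug Q \<in> rhom R (rterm Q 0) V \<and>
    raug Q ` carrier (rterm Q 0) = carrier V \<and>
    rdiff Q 0 ` carrier (rterm Q 1) = {x \<in> carrier (rterm Q 0). raug Q x = \<zero>\<^bsub>V\<^esub>} \<and>
    (\<forall>i. rdiff Q (Suc i) ` carrier (rterm Q (Suc (Suc i))) =
      {x \<in> carrier (rterm Q (Suc i)). rdiff Q i x = \<zero>\<^bsub>rterm Q i\<^esub>})"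

lemma proj_resolution_iff_pres:
  fixes Q :: "('a, nat \<Rightarrow> 'a, 'x) resolution"
  shows "right_module R V \<Longrightarrow> proj_resolution R V Q \<longleftrightarrow> pres R V Q"
  by (simp add: proj_resolution_def pres_def fg_projective_iff_dbproj)

lemma pres_dbproj: "pres R V Q \<Longrightarrow> dbproj R (rterm Q i)"
  by (simp add: pres_def)

lemma pres_term: "pres R V Q \<Longrightarrow> right_module R (rterm Q i)"
  by (simp add: pres_def dbproj_def)

lemma pres_term_group: "pres R V Q \<Longrightarrow> abelian_group (rterm Q i)"
  by (simp add: pres_term[THEN right_module_abelian_group])

lemma pres_target: "pres R V Q \<Longrightarrow> right_module R V"
  by (simp add: pres_def)

lemma pres_diff: "pres R V Q \<Longrightarrow> rdiff Q i \<in> rhom R (rterm Q (Suc i)) (rterm Q i)"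
  by (simp add: pres_def)

lemma pres_aug: "pres R V Q \<Longrightarrow> raug Q \<in> rhom R (rterm Q 0) V"
  by (simp add: pres_def)

lemma pres_exact:
  "pres R V Q \<Longrightarrow> rdiff Q (Suc i) ` carrier (rterm Q (Suc (Suc i))) =
    {x \<in> carrier (rterm Q (Suc i)). rdiff Q i x = \<zero>\<^bsub>rterm Q i\<^esub>}"
  by (simp add: pres_def)

lemma pres_exact0:
  "pres R V Q \<Longrightarrow> rdiff Q 0 ` carrier (rterm Q (Suc 0)) =
    {x \<in> carrier (rterm Q 0). raug Q x = \<zero>\<^bsub>V\<^esub>}"
  by (simp add: pres_def)

lemma pres_surj: "pres R V Q \<Longrightarrow> raug Q ` carrier (rterm Q 0) = carrier V"
  by (simp add: pres_def)

lemma pres_dd: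
  assumes "pres R V Q" "x \<in> carrier (rterm Q (Suc (Suc i)))"
  shows "rdiff Q i (rdiff Q (Suc i) x) = \<zero>\<^bsub>rterm Q i\<^esub>"
  using pres_exact[OF assms(1), of i] assms(2) by blast

lemma pres_d_aug:
  assumes "pres R V Q" "x \<in> carrier (rterm Q (Suc 0))"
  shows "raug Q (rdiff Q 0 x) = \<zero>\<^bsub>V\<^esub>"
  using pres_exact0[OF assms(1)] assms(2) by blast

lemma proj_resolution_exists:
  fixes A :: "('k, 'a, 's) module_scheme" and V :: "('a, 'x, 'z) rmodule_scheme"
  assumes alg: "k_algebra K A" and fd: "fin_gen K (scalars A (regular_bimod A))" and V: "right_module A V" and fg: "fin_gen A V"
  shows "\<exists>Q :: ('a, nat \<Rightarrow> 'a, 'x) resolution. proj_resolution A V Q"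
proof -
  interpret k_algebra K A by (rule alg)
  obtain m g where g: "g \<in> rhom A (free_rmodule A m) V" "g ` carrier (free_rmodule A m) = carrier V"
    using free_rmodule_cover[OF V fg] by blast
  let ?F = "free_rmodule A m"
  have F: "dbproj A ?F" by (rule dbproj_free_rmodule[OF ring_A])
  \<comment> \<open>A state consists of a term, the differential that leaves it, and the kernel that
    the next term has to cover.\<close>
  let ?P = "\<lambda>n s :: ('a, nat \<Rightarrow> 'a) rmodule \<times> ((nat \<Rightarrow> 'a) \<Rightarrow> (nat \<Rightarrow> 'a)) \<times> (nat \<Rightarrow> 'a) set.
    dbproj A (fst s) \<and> is_submod A (fst s) (snd (snd s)) \<and>
    (n = (0::nat) \<longrightarrow> fst s = ?F \<and> snd (snd s) = {x \<in> carrier ?F. g x = \<zero>\<^bsub>V\<^esub>})"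
  let ?Q = "\<lambda>n::nat. \<lambda>s s'. fst (snd s') \<in> rhom A (fst s') (fst s) \<and>
    fst (snd s') ` carrier (fst s') = snd (snd s) \<and>
    snd (snd s') = {x \<in> carrier (fst s'). fst (snd s') x = \<zero>\<^bsub>fst s\<^esub>}"
  have "\<exists>s. \<forall>n. ?P n (s n) \<and> ?Q n (s n) (s (Suc n))"
  proof (rule dependent_nat_choice)
    show "\<exists>s. ?P 0 s"
      using F kernel_submod[OF g(1) dbproj_right_module[OF F] V]
      \<comment> \<open>The differential of the initial state is a placeholder: the resolution reads
        differentials from the states \<open>s (Suc n)\<close> only, while the map leaving degree 0
        is the augmentation \<open>g\<close>.\<close>
      by (intro exI[of _ "(?F, undefined, {x \<in> carrier ?F. g x = \<zero>\<^bsub>V\<^esub>})"]) simp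
  next
    fix s and n :: nat assume s: "?P n s"
    then have M: "right_module A (fst s)" and N: "is_submod A (fst s) (snd (snd s))"
      by (auto simp: dbproj_def)
    have N': "right_module A (submod (fst s) (snd (snd s)))" by (rule right_module_submod[OF M N])
    have "fin_gen A (submod (fst s) (snd (snd s)))"
      using fin_gen_submod[OF fd M _ N] s dbproj_fin_gen by blast
    then obtain m' d where d: "d \<in> rhom A (free_rmodule A m') (submod (fst s) (snd (snd s)))"
      "d ` carrier (free_rmodule A m') = snd (snd s)"
      using free_rmodule_cover[OF N'] by auto
    let ?F' = "free_rmodule A m'"
    have F': "dbproj A ?F'" by (rule dbproj_free_rmodule[OF ring_A])
    have d': "d \<in> rhom A ?F' (fst s)"
      using rhom_from_submod_extend[OF d(1)] N by (simp add: is_submod_def)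
    show "\<exists>s'. ?P (Suc n) s' \<and> ?Q n s s'"
      using F' kernel_submod[OF d' dbproj_right_module[OF F'] M] d(2) d'
      by (intro exI[of _ "(?F', d, {x \<in> carrier ?F'. d x = \<zero>\<^bsub>fst s\<^esub>})"]) simp
  qed
  then obtain s where "\<forall>n. ?P n (s n) \<and> ?Q n (s n) (s (Suc n))" by (rule exE)
  then have s: "?P n (s n)" "?Q n (s n) (s (Suc n))" for n by simp_all
  let ?Q = "\<lparr>rterm = (\<lambda>n. fst (s n)), rdiff = (\<lambda>n. fst (snd (s (Suc n)))), raug = g\<rparr>"
  have "pres A V ?Q"
    unfolding pres_def using V g s(1)[of 0] s(1) s(2)[of 0] s(2) by (intro conjI allI) simp_all
  then show ?thesis
    using proj_resolution_iff_pres[OF V] by blast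
qed

section \<open>Chain maps and the comparison theorem\<close>

definition chain_map ::
    "('a, 'r) ring_scheme \<Rightarrow> ('a, 'm, 'x) resolution \<Rightarrow> ('a, 'n, 'y) resolution \<Rightarrow> ('x \<Rightarrow> 'y) \<Rightarrow>
      (nat \<Rightarrow> 'm \<Rightarrow> 'n) \<Rightarrow> bool" where
  "chain_map R Q Q' h \<phi> \<longleftrightarrow>
    (\<forall>i. \<phi> i \<in> rhom R (rterm Q i) (rterm Q' i)) \<and>
    (\<forall>q \<in> carrier (rterm Q 0). raug Q' (\<phi> 0 q) = h (raug Q q)) \<and>
    (\<forall>i. \<forall>q \<in> carrier (rterm Q (Suc i)). rdiff Q' i (\<phi> (Suc i) q) = \<phi> i (rdiff Q i q))"

lemma chain_lift_eq_chain_map: "chain_lift R Q h \<phi> \<longleftrightarrow> chain_map R Q Q h \<phi>"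
  by (simp add: chain_lift_def chain_map_def)

lemma chain_map_rhom: "chain_map R Q Q' h \<phi> \<Longrightarrow> \<phi> i \<in> rhom R (rterm Q i) (rterm Q' i)"
  by (simp add: chain_map_def)

lemma chain_map_diff:
  "chain_map R Q Q' h \<phi> \<Longrightarrow> q \<in> carrier (rterm Q (Suc i)) \<Longrightarrow>
    rdiff Q' i (\<phi> (Suc i) q) = \<phi> i (rdiff Q i q)"
  by (simp add: chain_map_def)

lemma chain_map_aug:
  "chain_map R Q Q' h \<phi> \<Longrightarrow> q \<in> carrier (rterm Q 0) \<Longrightarrow> raug Q' (\<phi> 0 q) = h (raug Q q)"
  by (simp add: chain_map_def)

lemma chain_map_compose:
  assumes Q: "pres R V Q" and \<phi>: "chain_map R Q Q' h \<phi>" and \<psi>: "chain_map R Q' Q'' k \<psi>"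
    and l: "\<And>v. v \<in> carrier V \<Longrightarrow> k (h v) = l v"
  shows "chain_map R Q Q'' l (\<lambda>i. compose (carrier (rterm Q i)) (\<psi> i) (\<phi> i))"
  unfolding chain_map_def
proof (intro conjI allI ballI)
  fix i
  show "compose (carrier (rterm Q i)) (\<psi> i) (\<phi> i) \<in> rhom R (rterm Q i) (rterm Q'' i)"
    by (rule compose_rhom[OF chain_map_rhom[OF \<phi>] chain_map_rhom[OF \<psi>] pres_term[OF Q]])
next
  fix q assume q: "q \<in> carrier (rterm Q 0)"
  then show "raug Q'' (compose (carrier (rterm Q 0)) (\<psi> 0) (\<phi> 0) q) = l (raug Q q)"
    using rhom_closed[OF chain_map_rhom[OF \<phi>] q] l[OF rhom_closed[OF pres_aug[OF Q] q]]
    by (simp add: compose_def chain_map_aug[OF \<phi>] chain_map_aug[OF \<psi>])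
next
  fix i q assume q: "q \<in> carrier (rterm Q (Suc i))"
  then show "rdiff Q'' i (compose (carrier (rterm Q (Suc i))) (\<psi> (Suc i)) (\<phi> (Suc i)) q) =
      compose (carrier (rterm Q i)) (\<psi> i) (\<phi> i) (rdiff Q i q)"
    using rhom_closed[OF chain_map_rhom[OF \<phi>] q] rhom_closed[OF pres_diff[OF Q] q]
    by (simp add: compose_def chain_map_diff[OF \<phi>] chain_map_diff[OF \<psi>])
qed

lemma chain_map_id:
  assumes Q: "pres R V Q" and h: "\<And>v. v \<in> carrier V \<Longrightarrow> h v = v"
  shows "chain_map R Q Q h (\<lambda>i. \<lambda>q\<in>carrier (rterm Q i). q)"
  using id_rhom[OF pres_term[OF Q]] rhom_closed[OF pres_aug[OF Q]] rhom_closed[OF pres_diff[OF Q]] h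
  by (simp add: chain_map_def)

text \<open>The comparison theorem: each component is a lift of the previous one composed with the
  differential, possible because the terms of \<open>Q\<close> are projective and \<open>Q'\<close>
  is exact.\<close>

lemma chain_map_exists:
  assumes Q: "pres R V Q" and Q': "pres R V' Q'" and h: "h \<in> rhom R V V'"
  shows "\<exists>\<phi>. chain_map R Q Q' h \<phi>"
proof -
  note ag = pres_term_group[OF Q] pres_term_group[OF Q'] right_module_abelian_group[OF pres_target[OF Q]]
    right_module_abelian_group[OF pres_target[OF Q']]
  have "compose (carrier (rterm Q 0)) h (raug Q) ` carrier (rterm Q 0) \<subseteq> raug Q' ` carrier (rterm Q' 0)"
    using pres_surj[OF Q'] rhom_closed[OF h] rhom_closed[OF pres_aug[OF Q]] by (auto simp: compose_def)
  then obtain \<phi>0 where \<phi>0: "\<phi>0 \<in> rhom R (rterm Q 0) (rterm Q' 0)"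
    "\<forall>x\<in>carrier (rterm Q 0). raug Q' (\<phi>0 x) = compose (carrier (rterm Q 0)) h (raug Q) x"
    using dbproj_lift[OF pres_dbproj[OF Q] pres_aug[OF Q'] compose_rhom[OF pres_aug[OF Q] h pres_term[OF Q]]
        _ pres_term[OF Q'] pres_target[OF Q']] by blast
  \<comment> \<open>The last conjunct says that \<open>p\<close> sends cycles to cycles. It is
    carried along because the choice of the next component sees the current one only, and needs this
    to know that the map to be lifted ends in the boundaries of \<open>Q'\<close>.\<close>
  let ?P = "\<lambda>n p. p \<in> rhom R (rterm Q n) (rterm Q' n) \<and>
    (n = 0 \<longrightarrow> (\<forall>x\<in>carrier (rterm Q 0). raug Q' (p x) = h (raug Q x))) \<and>
    (\<forall>m. n = Suc m \<longrightarrow> (\<forall>x\<in>carrier (rterm Q n). rdiff Q m x = \<zero>\<^bsub>rterm Q m\<^esub> \<longrightarrow> rdiff Q' m (p x) = \<zero>\<^bsub>rterm Q' m\<^esub>))"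
  have "\<exists>\<phi>. \<forall>n. ?P n (\<phi> n) \<and> (\<forall>q\<in>carrier (rterm Q (Suc n)). rdiff Q' n (\<phi> (Suc n) q) = \<phi> n (rdiff Q n q))"
  proof (rule dependent_nat_choice)
    show "\<exists>p. ?P 0 p" using \<phi>0 by (intro exI[of _ \<phi>0]) (simp add: compose_def)
  next
    fix p n assume p: "?P n p"
    then have p': "p \<in> rhom R (rterm Q n) (rterm Q' n)" by simp
    let ?h = "compose (carrier (rterm Q (Suc n))) p (rdiff Q n)"
    have "?h x \<in> rdiff Q' n ` carrier (rterm Q' (Suc n))" if x: "x \<in> carrier (rterm Q (Suc n))" for x
    proof -
      have dx: "rdiff Q n x \<in> carrier (rterm Q n)" by (rule rhom_closed[OF pres_diff[OF Q] x])
      show ?thesis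
      proof (cases n)
        case 0
        have "raug Q (rdiff Q 0 x) = \<zero>\<^bsub>V\<^esub>" using pres_d_aug[OF Q] x 0 by simp
        then have "raug Q' (p (rdiff Q 0 x)) = \<zero>\<^bsub>V'\<^esub>"
          using p dx 0 rhom_zero[OF h ag(3,4)] by simp
        then show ?thesis
          using pres_exact0[OF Q'] x 0 rhom_closed[OF p' dx] by (auto simp: compose_def)
      next
        case (Suc m)
        have "rdiff Q m (rdiff Q n x) = \<zero>\<^bsub>rterm Q m\<^esub>" using pres_dd[OF Q] x Suc by simp
        then have "rdiff Q' m (p (rdiff Q n x)) = \<zero>\<^bsub>rterm Q' m\<^esub>" using p dx Suc by simp
        then show ?thesis
          using pres_exact[OF Q', of m] x Suc rhom_closed[OF p' dx] by (auto simp: compose_def)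
      qed
    qed
    then have "?h ` carrier (rterm Q (Suc n)) \<subseteq> rdiff Q' n ` carrier (rterm Q' (Suc n))" by blast
    then obtain l where l: "l \<in> rhom R (rterm Q (Suc n)) (rterm Q' (Suc n))"
      "\<forall>x\<in>carrier (rterm Q (Suc n)). rdiff Q' n (l x) = ?h x"
      using dbproj_lift[OF pres_dbproj[OF Q] pres_diff[OF Q'] compose_rhom[OF pres_diff[OF Q] p' pres_term[OF Q]]
        _ pres_term[OF Q'] pres_term[OF Q']] by blast
    have "?P (Suc n) l"
      using l rhom_zero[OF p' ag(1,2)] by (simp add: compose_def)
    then show "\<exists>l. ?P (Suc n) l \<and> (\<forall>q\<in>carrier (rterm Q (Suc n)). rdiff Q' n (l q) = p (rdiff Q n q))"
      using l(2) by (intro exI[of _ l]) (simp add: compose_def)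
  qed
  then show ?thesis unfolding chain_map_def by (metis (no_types, lifting))
qed

section \<open>Cocycles and coboundaries in degree 2\<close>

definition cohom ::
    "('a, 'r) ring_scheme \<Rightarrow> ('a, 'm, 'x) resolution \<Rightarrow> ('a, 'y, 'z) rmodule_scheme \<Rightarrow> ('m \<Rightarrow> 'y) \<Rightarrow> ('m \<Rightarrow> 'y) \<Rightarrow> bool"
  where
  "cohom R Q W f f' \<longleftrightarrow>
    (\<exists>g \<in> rhom R (rterm Q 1) W. \<forall>x \<in> carrier (rterm Q 2). f x = g (rdiff Q 1 x) \<oplus>\<^bsub>W\<^esub> f' x)"

definition cocycle ::
    "('a, 'r) ring_scheme \<Rightarrow> ('a, 'm, 'x) resolution \<Rightarrow> ('a, 'y, 'z) rmodule_scheme \<Rightarrow> ('m \<Rightarrow> 'y) \<Rightarrow> bool"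
  where
  "cocycle R Q W f \<longleftrightarrow>
    f \<in> rhom R (rterm Q 2) W \<and> (\<forall>x \<in> carrier (rterm Q 3). f (rdiff Q 2 x) = \<zero>\<^bsub>W\<^esub>)"

text \<open>The usual homotopy \<open>\<phi> - \<psi> = d s + s d\<close>, of which only the first two components are needed: a
  cocycle in degree 2 vanishes on the boundaries \<open>\<phi>\<^sub>2 x - \<psi>\<^sub>2 x - s\<^sub>1 d x\<close>.\<close>

lemma cohom_chain_maps:
  assumes Q: "pres R V Q" and Q': "pres R V' Q'" and \<phi>: "chain_map R Q Q' h \<phi>" and \<psi>: "chain_map R Q Q' h \<psi>"
    and f: "cocycle R Q' W f" and W: "right_module R W"
  shows "cohom R Q W (compose (carrier (rterm Q 2)) f (\<phi> 2)) (compose (carrier (rterm Q 2)) f (\<psi> 2))"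
proof -
  note Qm = pres_term[OF Q] and Qm' = pres_term[OF Q']
  note Qg = pres_term_group[OF Q] and Qg' = pres_term_group[OF Q']
  note Vg = right_module_abelian_group[OF pres_target[OF Q']]
  note cl\<phi> = rhom_closed[OF chain_map_rhom[OF \<phi>]] and cl\<psi> = rhom_closed[OF chain_map_rhom[OF \<psi>]]
  note cld = rhom_closed[OF pres_diff[OF Q]]
  interpret V': abelian_group V' by (rule Vg)
  have \<delta>: "(\<lambda>x\<in>carrier (rterm Q i). \<phi> i x \<ominus>\<^bsub>rterm Q' i\<^esub> \<psi> i x) \<in> rhom R (rterm Q i) (rterm Q' i)" for i
    by (rule diff_rhom[OF chain_map_rhom[OF \<phi>] chain_map_rhom[OF \<psi>] Qm Qm'])
  define \<delta> where "\<delta> i = (\<lambda>x\<in>carrier (rterm Q i). \<phi> i x \<ominus>\<^bsub>rterm Q' i\<^esub> \<psi> i x)" for i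
  have \<delta>h: "\<delta> i \<in> rhom R (rterm Q i) (rterm Q' i)" for i using \<delta> by (simp only: \<delta>_def)
  have \<delta>x: "\<delta> i x = \<phi> i x \<ominus>\<^bsub>rterm Q' i\<^esub> \<psi> i x" if "x \<in> carrier (rterm Q i)" for i x
    using that by (simp add: \<delta>_def)
  have \<delta>d: "rdiff Q' i (\<delta> (Suc i) x) = \<delta> i (rdiff Q i x)" if x: "x \<in> carrier (rterm Q (Suc i))" for i x
    using rhom_diff[OF pres_diff[OF Q'] Qg' Qg' cl\<phi>[OF x] cl\<psi>[OF x]] cld[OF x] x
    by (simp add: \<delta>x chain_map_diff[OF \<phi>] chain_map_diff[OF \<psi>])
  have "raug Q' (\<delta> 0 x) = \<zero>\<^bsub>V'\<^esub>" if x: "x \<in> carrier (rterm Q 0)" for x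
  proof -
    have "h (raug Q x) \<in> carrier V'"
      using rhom_closed[OF pres_aug[OF Q'] cl\<phi>[OF x]] by (simp add: chain_map_aug[OF \<phi> x])
    then show ?thesis
      using rhom_diff[OF pres_aug[OF Q'] Qg' Vg cl\<phi>[OF x] cl\<psi>[OF x]]
      by (simp add: \<delta>x[OF x] chain_map_aug[OF \<phi> x] chain_map_aug[OF \<psi> x] a_minus_def V'.r_neg)
  qed
  then have "\<delta> 0 ` carrier (rterm Q 0) \<subseteq> rdiff Q' 0 ` carrier (rterm Q' (Suc 0))"
    using rhom_closed[OF \<delta>h] by (auto simp: pres_exact0[OF Q'])
  then obtain s0 where s0: "s0 \<in> rhom R (rterm Q 0) (rterm Q' (Suc 0))"
    "\<And>x. x \<in> carrier (rterm Q 0) \<Longrightarrow> rdiff Q' 0 (s0 x) = \<delta> 0 x"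
    using dbproj_lift[OF pres_dbproj[OF Q] pres_diff[OF Q'] \<delta>h _ Qm' Qm'] by blast
  \<comment> \<open>What remains of \<delta> in degree 1 after removing the part explained by
    \<open>s0\<close>. It is a cycle, since both parts have the boundary
    \<open>\<delta> 0 (rdiff Q 0 x)\<close>, and so it lifts to \<open>s1\<close>.\<close>
  define \<epsilon> where "\<epsilon> = (\<lambda>x\<in>carrier (rterm Q 1). \<delta> 1 x \<ominus>\<^bsub>rterm Q' 1\<^esub> compose (carrier (rterm Q 1)) s0 (rdiff Q 0) x)"
  have c0: "compose (carrier (rterm Q 1)) s0 (rdiff Q 0) \<in> rhom R (rterm Q 1) (rterm Q' 1)"
    using compose_rhom[OF pres_diff[OF Q] s0(1) Qm] by simp
  have \<epsilon>h: "\<epsilon> \<in> rhom R (rterm Q 1) (rterm Q' 1)"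
    unfolding \<epsilon>_def by (rule diff_rhom[OF \<delta>h c0 Qm Qm'])
  have \<epsilon>x: "\<epsilon> x = \<delta> 1 x \<ominus>\<^bsub>rterm Q' 1\<^esub> s0 (rdiff Q 0 x)" if "x \<in> carrier (rterm Q 1)" for x
    using that by (simp add: \<epsilon>_def compose_def)
  have "rdiff Q' 0 (\<epsilon> x) = \<zero>\<^bsub>rterm Q' 0\<^esub>" if x: "x \<in> carrier (rterm Q 1)" for x
  proof -
    interpret T: abelian_group "rterm Q' 0" by (rule Qg')
    have x': "x \<in> carrier (rterm Q (Suc 0))" using x by simp
    have "s0 (rdiff Q 0 x) \<in> carrier (rterm Q' (Suc 0))" using rhom_closed[OF s0(1) cld[OF x']] .
    then show ?thesis
      using rhom_diff[OF pres_diff[OF Q'] Qg' Qg' rhom_closed[OF \<delta>h x']] \<delta>d[OF x'] s0(2)[OF cld[OF x']]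
        rhom_closed[OF \<delta>h cld[OF x']]
      by (simp add: \<epsilon>x[OF x] a_minus_def T.r_neg)
  qed
  then have im: "\<epsilon> ` carrier (rterm Q 1) \<subseteq> rdiff Q' (Suc 0) ` carrier (rterm Q' (Suc (Suc 0)))"
    using rhom_closed[OF \<epsilon>h] by (auto simp: pres_exact[OF Q'])
  have \<epsilon>h': "\<epsilon> \<in> rhom R (rterm Q 1) (rterm Q' (Suc 0))" using \<epsilon>h by simp
  obtain s1 where s1: "s1 \<in> rhom R (rterm Q 1) (rterm Q' (Suc (Suc 0)))"
    "\<And>x. x \<in> carrier (rterm Q 1) \<Longrightarrow> rdiff Q' (Suc 0) (s1 x) = \<epsilon> x"
    using dbproj_lift[OF pres_dbproj[OF Q] pres_diff[OF Q'] \<epsilon>h' im Qm' Qm'] by blast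
  have s1h: "s1 \<in> rhom R (rterm Q 1) (rterm Q' 2)" using s1(1) by (simp add: numeral_2_eq_2)
  have fh: "f \<in> rhom R (rterm Q' 2) W" using f by (simp add: cocycle_def)
  have main: "f (\<phi> 2 x) = f (s1 (rdiff Q 1 x)) \<oplus>\<^bsub>W\<^esub> f (\<psi> 2 x)" if x: "x \<in> carrier (rterm Q 2)" for x
  proof -
    interpret T: abelian_group "rterm Q' 2" by (rule Qg')
    interpret T1: abelian_group "rterm Q' (Suc 0)" by (rule Qg')
    interpret W: abelian_group W by (rule right_module_abelian_group[OF W])
    have x': "x \<in> carrier (rterm Q (Suc 1))" using x by (simp add: numeral_2_eq_2)
    note dx = cld[OF x']
    have sc: "s1 (rdiff Q 1 x) \<in> carrier (rterm Q' 2)" by (rule rhom_closed[OF s1h dx])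
    define y where "y = \<delta> 2 x \<ominus>\<^bsub>rterm Q' 2\<^esub> s1 (rdiff Q 1 x)"
    have y: "y \<in> carrier (rterm Q' 2)" using rhom_closed[OF \<delta>h x] sc by (simp add: y_def)
    have "\<epsilon> (rdiff Q 1 x) = \<delta> 1 (rdiff Q 1 x)"
    proof -
      have "rdiff Q 0 (rdiff Q 1 x) = \<zero>\<^bsub>rterm Q 0\<^esub>" using pres_dd[OF Q, of x 0] x' by simp
      then show ?thesis
        using \<epsilon>x[OF dx] rhom_zero[OF s0(1) Qg Qg'] rhom_closed[OF \<delta>h dx]
          T1.minus_equality[of "\<zero>\<^bsub>rterm Q' (Suc 0)\<^esub>" "\<zero>\<^bsub>rterm Q' (Suc 0)\<^esub>"]
        by (simp add: a_minus_def)
    qed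
    then have "rdiff Q' (Suc 0) (s1 (rdiff Q 1 x)) = \<delta> 1 (rdiff Q 1 x)" using s1(2)[OF dx] by simp
    moreover have "rdiff Q' 1 (\<delta> 2 x) = \<delta> 1 (rdiff Q 1 x)"
      using \<delta>d[OF x'] by (simp add: numeral_2_eq_2)
    ultimately have "rdiff Q' 1 y = \<zero>\<^bsub>rterm Q' 1\<^esub>"
      using rhom_diff[OF pres_diff[OF Q', of 1] Qg' Qg', of "\<delta> 2 x" "s1 (rdiff Q 1 x)"]
        rhom_closed[OF \<delta>h x] sc rhom_closed[OF \<delta>h dx]
      by (simp add: y_def a_minus_def T1.r_neg numeral_2_eq_2)
    then have "y \<in> rdiff Q' 2 ` carrier (rterm Q' 3)"
      using pres_exact[OF Q', of 1] y by (simp add: numeral_2_eq_2 numeral_3_eq_3)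
    then have "f y = \<zero>\<^bsub>W\<^esub>" using f by (auto simp: cocycle_def)
    moreover have "\<phi> 2 x = y \<oplus>\<^bsub>rterm Q' 2\<^esub> (s1 (rdiff Q 1 x) \<oplus>\<^bsub>rterm Q' 2\<^esub> \<psi> 2 x)"
      using cl\<phi>[OF x] cl\<psi>[OF x] sc
      by (simp add: y_def \<delta>x[OF x] a_minus_def T.a_ac T.l_neg T.r_neg T.r_neg1 T.r_neg2)
    ultimately show ?thesis
      using y sc cl\<psi>[OF x] rhom_closed[OF fh] by (simp add: rhom_add[OF fh])
  qed
  have "compose (carrier (rterm Q 1)) f s1 \<in> rhom R (rterm Q 1) W"
    by (rule compose_rhom[OF s1h fh Qm])
  moreover have "compose (carrier (rterm Q 2)) f (\<phi> 2) x =
      compose (carrier (rterm Q 1)) f s1 (rdiff Q 1 x) \<oplus>\<^bsub>W\<^esub> compose (carrier (rterm Q 2)) f (\<psi> 2) x"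
    if x: "x \<in> carrier (rterm Q 2)" for x
    using main[OF x] x cld[of x 1] by (simp add: compose_def numeral_2_eq_2)
  ultimately show ?thesis unfolding cohom_def by blast
qed

lemma cohom_refl:
  assumes "right_module R W" "pres R V Q" "f \<in> rhom R (rterm Q 2) W"
  shows "cohom R Q W f f"
proof -
  interpret W: right_module R W by fact
  have "f x = (\<lambda>x\<in>carrier (rterm Q 1). \<zero>\<^bsub>W\<^esub>) (rdiff Q 1 x) \<oplus>\<^bsub>W\<^esub> f x" if "x \<in> carrier (rterm Q 2)" for x
    using rhom_closed[OF pres_diff[OF assms(2), of 1], of x] rhom_closed[OF assms(3) that] that
    by (simp add: numeral_2_eq_2)
  then show ?thesis
    unfolding cohom_def using zero_rhom[OF pres_term[OF assms(2)] assms(1)] by blast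
qed

lemma cohom_sym:
  assumes W: "right_module R W" and Q: "pres R V Q" and f': "f' \<in> rhom R (rterm Q 2) W"
    and "cohom R Q W f f'"
  shows "cohom R Q W f' f"
proof -
  interpret W: right_module R W by fact
  obtain g where g: "g \<in> rhom R (rterm Q 1) W"
    "\<And>x. x \<in> carrier (rterm Q 2) \<Longrightarrow> f x = g (rdiff Q 1 x) \<oplus>\<^bsub>W\<^esub> f' x"
    using assms(4) by (auto simp: cohom_def)
  have "f' x = (\<lambda>x\<in>carrier (rterm Q 1). \<ominus>\<^bsub>W\<^esub> g x) (rdiff Q 1 x) \<oplus>\<^bsub>W\<^esub> f x" if x: "x \<in> carrier (rterm Q 2)" for x
  proof -
    have d: "rdiff Q 1 x \<in> carrier (rterm Q 1)"
      using rhom_closed[OF pres_diff[OF Q, of 1], of x] x by (simp add: numeral_2_eq_2)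
    show ?thesis
      unfolding g(2)[OF x] restrict_apply'[OF d]
      using rhom_closed[OF g(1) d] rhom_closed[OF f' x] by (simp add: W.M.r_neg1)
  qed
  then show ?thesis
    unfolding cohom_def using minus_rhom[OF g(1) pres_term[OF Q] W] by blast
qed

lemma cohom_plus:
  assumes W: "right_module R W" and Q: "pres R V Q"
    and "f \<in> rhom R (rterm Q 2) W" "g \<in> rhom R (rterm Q 2) W"
    and "f' \<in> rhom R (rterm Q 2) W" "g' \<in> rhom R (rterm Q 2) W"
    and "cohom R Q W f f'" "cohom R Q W g g'"
  shows "cohom R Q W (\<lambda>x\<in>carrier (rterm Q 2). f x \<oplus>\<^bsub>W\<^esub> g x) (\<lambda>x\<in>carrier (rterm Q 2). f' x \<oplus>\<^bsub>W\<^esub> g' x)"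
proof -
  interpret W: right_module R W by fact
  obtain a where a: "a \<in> rhom R (rterm Q 1) W"
    "\<And>x. x \<in> carrier (rterm Q 2) \<Longrightarrow> f x = a (rdiff Q 1 x) \<oplus>\<^bsub>W\<^esub> f' x"
    using assms(7) by (auto simp: cohom_def)
  obtain b where b: "b \<in> rhom R (rterm Q 1) W"
    "\<And>x. x \<in> carrier (rterm Q 2) \<Longrightarrow> g x = b (rdiff Q 1 x) \<oplus>\<^bsub>W\<^esub> g' x"
    using assms(8) by (auto simp: cohom_def)
  have "(\<lambda>x\<in>carrier (rterm Q 2). f x \<oplus>\<^bsub>W\<^esub> g x) x = (\<lambda>x\<in>carrier (rterm Q 1). a x \<oplus>\<^bsub>W\<^esub> b x) (rdiff Q 1 x) \<oplus>\<^bsub>W\<^esub>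
      (\<lambda>x\<in>carrier (rterm Q 2). f' x \<oplus>\<^bsub>W\<^esub> g' x) x" if x: "x \<in> carrier (rterm Q 2)" for x
  proof -
    have d: "rdiff Q 1 x \<in> carrier (rterm Q 1)"
      using rhom_closed[OF pres_diff[OF Q, of 1], of x] x by (simp add: numeral_2_eq_2)
    show ?thesis
      unfolding a(2)[OF x] b(2)[OF x] restrict_apply'[OF d] restrict_apply'[OF x]
      using rhom_closed[OF a(1) d] rhom_closed[OF b(1) d] rhom_closed[OF assms(5) x] rhom_closed[OF assms(6) x]
      by (simp add: W.M.a_ac)
  qed
  then show ?thesis
    unfolding cohom_def using plus_rhom[OF a(1) b(1) pres_term[OF Q] W] by blast
qed

lemma cohom_trans:
  assumes W: "right_module R W" and Q: "pres R V Q" and f'': "f'' \<in> rhom R (rterm Q 2) W"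
    and "cohom R Q W f f'" "cohom R Q W f' f''"
  shows "cohom R Q W f f''"
proof -
  interpret W: right_module R W by fact
  obtain a where a: "a \<in> rhom R (rterm Q 1) W"
    "\<And>x. x \<in> carrier (rterm Q 2) \<Longrightarrow> f x = a (rdiff Q 1 x) \<oplus>\<^bsub>W\<^esub> f' x"
    using assms(4) by (auto simp: cohom_def)
  obtain b where b: "b \<in> rhom R (rterm Q 1) W"
    "\<And>x. x \<in> carrier (rterm Q 2) \<Longrightarrow> f' x = b (rdiff Q 1 x) \<oplus>\<^bsub>W\<^esub> f'' x"
    using assms(5) by (auto simp: cohom_def)
  have "f x = (\<lambda>x\<in>carrier (rterm Q 1). a x \<oplus>\<^bsub>W\<^esub> b x) (rdiff Q 1 x) \<oplus>\<^bsub>W\<^esub> f'' x"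
    if x: "x \<in> carrier (rterm Q 2)" for x
  proof -
    have d: "rdiff Q 1 x \<in> carrier (rterm Q 1)"
      using rhom_closed[OF pres_diff[OF Q, of 1], of x] x by (simp add: numeral_2_eq_2)
    show ?thesis
      unfolding a(2)[OF x] b(2)[OF x] restrict_apply'[OF d]
      using rhom_closed[OF a(1) d] rhom_closed[OF b(1) d] rhom_closed[OF f'' x]
      by (simp add: W.M.a_assoc)
  qed
  then show ?thesis
    unfolding cohom_def using plus_rhom[OF a(1) b(1) pres_term[OF Q] W] by blast
qed

lemma cohom_compose_left:
  assumes Q: "pres R V Q" and h: "h \<in> rhom R W W'" and f': "f' \<in> rhom R (rterm Q 2) W"
    and "cohom R Q W f f'"
  shows "cohom R Q W' (compose (carrier (rterm Q 2)) h f) (compose (carrier (rterm Q 2)) h f')"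
proof -
  obtain a where a: "a \<in> rhom R (rterm Q 1) W"
    "\<And>x. x \<in> carrier (rterm Q 2) \<Longrightarrow> f x = a (rdiff Q 1 x) \<oplus>\<^bsub>W\<^esub> f' x"
    using assms(4) by (auto simp: cohom_def)
  have "compose (carrier (rterm Q 2)) h f x =
      compose (carrier (rterm Q 1)) h a (rdiff Q 1 x) \<oplus>\<^bsub>W'\<^esub> compose (carrier (rterm Q 2)) h f' x"
    if x: "x \<in> carrier (rterm Q 2)" for x
  proof -
    have d: "rdiff Q 1 x \<in> carrier (rterm Q 1)"
      using rhom_closed[OF pres_diff[OF Q, of 1], of x] x by (simp add: numeral_2_eq_2)
    show ?thesis
      unfolding compose_eq[OF x] compose_eq[OF d] a(2)[OF x]
      by (rule rhom_add[OF h rhom_closed[OF a(1) d] rhom_closed[OF f' x]])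
  qed
  then show ?thesis
    unfolding cohom_def using compose_rhom[OF a(1) h pres_term[OF Q]] by blast
qed

text \<open>A cochain \<open>a\<close> whose coboundary is the difference is pulled back along the
  degree 1 component of the chain map.\<close>

lemma cohom_compose_chain_map:
  assumes Q: "pres R V Q" and \<phi>: "chain_map R Q Q' h \<phi>" and "cohom R Q' W f f'"
  shows "cohom R Q W (compose (carrier (rterm Q 2)) f (\<phi> 2)) (compose (carrier (rterm Q 2)) f' (\<phi> 2))"
proof -
  obtain a where a: "a \<in> rhom R (rterm Q' 1) W"
    "\<And>x. x \<in> carrier (rterm Q' 2) \<Longrightarrow> f x = a (rdiff Q' 1 x) \<oplus>\<^bsub>W\<^esub> f' x"
    using assms(3) by (auto simp: cohom_def)
  have "compose (carrier (rterm Q 2)) f (\<phi> 2) x =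
      compose (carrier (rterm Q 1)) a (\<phi> 1) (rdiff Q 1 x) \<oplus>\<^bsub>W\<^esub> compose (carrier (rterm Q 2)) f' (\<phi> 2) x"
    if x: "x \<in> carrier (rterm Q 2)" for x
  proof -
    have d: "rdiff Q 1 x \<in> carrier (rterm Q 1)"
      using rhom_closed[OF pres_diff[OF Q, of 1], of x] x by (simp add: numeral_2_eq_2)
    have "rdiff Q' 1 (\<phi> 2 x) = \<phi> 1 (rdiff Q 1 x)"
      using chain_map_diff[OF \<phi>, of x 1] x by (simp add: numeral_2_eq_2)
    then show ?thesis
      unfolding compose_eq[OF x] compose_eq[OF d] a(2)[OF rhom_closed[OF chain_map_rhom[OF \<phi>] x]] by simp
  qed
  then show ?thesis
    unfolding cohom_def using compose_rhom[OF chain_map_rhom[OF \<phi>] a(1) pres_term[OF Q]] by blast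
qed

lemma cocycle_rhom: "cocycle R Q W f \<Longrightarrow> f \<in> rhom R (rterm Q 2) W"
  by (simp add: cocycle_def)

lemma cocycle_plus:
  assumes W: "right_module R W" and Q: "pres R V Q" and f: "cocycle R Q W f" and g: "cocycle R Q W g"
  shows "cocycle R Q W (\<lambda>x\<in>carrier (rterm Q 2). f x \<oplus>\<^bsub>W\<^esub> g x)"
proof -
  interpret W: right_module R W by fact
  have "rdiff Q 2 x \<in> carrier (rterm Q 2)" if "x \<in> carrier (rterm Q 3)" for x
    using rhom_closed[OF pres_diff[OF Q, of 2], of x] that by (simp add: numeral_3_eq_3 numeral_2_eq_2)
  then show ?thesis
    using plus_rhom[OF cocycle_rhom[OF f] cocycle_rhom[OF g] pres_term[OF Q] W] f g by (simp add: cocycle_def)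
qed

lemma cocycle_zero:
  assumes W: "right_module R W" and Q: "pres R V Q"
  shows "cocycle R Q W (\<lambda>x\<in>carrier (rterm Q 2). \<zero>\<^bsub>W\<^esub>)"
proof -
  have "rdiff Q 2 x \<in> carrier (rterm Q 2)" if "x \<in> carrier (rterm Q 3)" for x
    using rhom_closed[OF pres_diff[OF Q, of 2], of x] that by (simp add: numeral_3_eq_3 numeral_2_eq_2)
  then show ?thesis
    using zero_rhom[OF pres_term[OF Q] W] by (simp add: cocycle_def)
qed

lemma cocycle_compose_left:
  assumes W: "right_module R W" and W': "right_module R W'" and Q: "pres R V Q"
    and f: "cocycle R Q W f" and h: "h \<in> rhom R W W'"
  shows "cocycle R Q W' (compose (carrier (rterm Q 2)) h f)"
proof -
  have "rdiff Q 2 x \<in> carrier (rterm Q 2)" if "x \<in> carrier (rterm Q 3)" for x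
    using rhom_closed[OF pres_diff[OF Q, of 2], of x] that by (simp add: numeral_3_eq_3 numeral_2_eq_2)
  then show ?thesis
    using compose_rhom[OF cocycle_rhom[OF f] h pres_term[OF Q]] f
      rhom_zero[OF h right_module_abelian_group[OF W] right_module_abelian_group[OF W']]
    by (simp add: cocycle_def compose_def)
qed

lemma cocycle_compose_chain_map:
  assumes Q: "pres R V Q" and f: "cocycle R Q' W f" and \<phi>: "chain_map R Q Q' h \<phi>"
  shows "cocycle R Q W (compose (carrier (rterm Q 2)) f (\<phi> 2))"
proof -
  have "compose (carrier (rterm Q 2)) f (\<phi> 2) (rdiff Q 2 x) = \<zero>\<^bsub>W\<^esub>" if x: "x \<in> carrier (rterm Q 3)" for x
  proof -
    have "rdiff Q 2 x \<in> carrier (rterm Q 2)"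
      using rhom_closed[OF pres_diff[OF Q, of 2], of x] x by (simp add: numeral_3_eq_3 numeral_2_eq_2)
    moreover have "\<phi> 2 (rdiff Q 2 x) = rdiff Q' 2 (\<phi> 3 x)"
      using chain_map_diff[OF \<phi>, of x 2] x by (simp add: numeral_3_eq_3 numeral_2_eq_2)
    moreover have "\<phi> 3 x \<in> carrier (rterm Q' 3)" by (rule rhom_closed[OF chain_map_rhom[OF \<phi>] x])
    ultimately show ?thesis using f by (simp add: compose_def cocycle_def)
  qed
  then show ?thesis
    using compose_rhom[OF chain_map_rhom[OF \<phi>] cocycle_rhom[OF f] pres_term[OF Q]] by (simp add: cocycle_def)
qed

section \<open>The bimodule Ext\<close>

text \<open>\<open>Q\<close> is a name for the chosen resolution under which the definitions of
  \<open>Ext\<close> can be folded. Everything else known about it is \<open>pres\<close>.\<close>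

locale ext2 =
  fixes R :: "('a, 'r) ring_scheme" and V :: "('a, 'x, 'z) bimodule_scheme" and W :: "('a, 'y, 'w) bimodule_scheme"
    and Q :: "('a, nat \<Rightarrow> 'a, 'x) resolution"
  assumes Q_def: "Q = chosen_res R V" and Q: "pres R V Q" and W: "right_module R W"
begin

abbreviation "cls \<equiv> ext_class R 2 V W"
abbreviation "Q2 \<equiv> carrier (rterm Q 2)"

lemma coboundaries:
  "ext_coboundaries R 2 V W = (\<lambda>g. compose Q2 g (rdiff Q 1)) ` rhom R (rterm Q 1) W"
  by (simp add: ext_coboundaries_def numeral_2_eq_2 ext_cochains_def rhom_group_def Q_def[symmetric])

text \<open>Cosets are translated into the relation \<open>cohom\<close> here; afterwards all
  statements about \<open>Ext\<close> are proved on representatives.\<close>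

lemma mem_cls:
  assumes f: "f \<in> rhom R (rterm Q 2) W"
  shows "f' \<in> cls f \<longleftrightarrow> f' \<in> rhom R (rterm Q 2) W \<and> cohom R Q W f' f"
proof -
  have d: "x \<in> Q2 \<Longrightarrow> rdiff Q 1 x \<in> carrier (rterm Q 1)" for x
    using rhom_closed[OF pres_diff[OF Q, of 1], of x] by (simp add: numeral_2_eq_2)
  have d': "rdiff Q 1 \<in> rhom R (rterm Q 2) (rterm Q 1)"
    using pres_diff[OF Q, of 1] by (simp add: numeral_2_eq_2)
  have 1: "f' \<in> cls f \<longleftrightarrow> (\<exists>g \<in> rhom R (rterm Q 1) W. f' = (\<lambda>x\<in>Q2. compose Q2 g (rdiff Q 1) x \<oplus>\<^bsub>W\<^esub> f x))"
    by (simp add: ext_class_def a_r_coset_def' coboundaries ext_cochains_def rhom_group_def Q_def[symmetric])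
  show ?thesis
  proof
    assume "f' \<in> cls f"
    then obtain g where g: "g \<in> rhom R (rterm Q 1) W" "f' = (\<lambda>x\<in>Q2. compose Q2 g (rdiff Q 1) x \<oplus>\<^bsub>W\<^esub> f x)"
      using 1 by blast
    show "f' \<in> rhom R (rterm Q 2) W \<and> cohom R Q W f' f"
    proof
      show "f' \<in> rhom R (rterm Q 2) W"
        unfolding g(2) by (rule plus_rhom[OF compose_rhom[OF d' g(1) pres_term[OF Q]] f pres_term[OF Q] W])
      show "cohom R Q W f' f" unfolding cohom_def g(2) using g(1)
        by (intro bexI[of _ g]) (simp_all add: compose_def)
    qed
  next
    assume a: "f' \<in> rhom R (rterm Q 2) W \<and> cohom R Q W f' f"
    then obtain g where g: "g \<in> rhom R (rterm Q 1) W" "\<And>x. x \<in> Q2 \<Longrightarrow> f' x = g (rdiff Q 1 x) \<oplus>\<^bsub>W\<^esub> f x"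
      by (auto simp: cohom_def)
    have "f' = (\<lambda>x\<in>Q2. compose Q2 g (rdiff Q 1) x \<oplus>\<^bsub>W\<^esub> f x)"
      by (rule rhom_eqI[OF conjunct1[OF a] plus_rhom[OF compose_rhom[OF d' g(1) pres_term[OF Q]] f pres_term[OF Q] W]])
        (simp add: g(2) compose_def)
    then show "f' \<in> cls f" using 1 g(1) by blast
  qed
qed

lemma cls_eq_iff:
  assumes f: "f \<in> rhom R (rterm Q 2) W" and g: "g \<in> rhom R (rterm Q 2) W"
  shows "cls f = cls g \<longleftrightarrow> cohom R Q W f g"
proof
  assume "cls f = cls g"
  then show "cohom R Q W f g" using mem_cls[OF f] mem_cls[OF g] cohom_refl[OF W Q f] f by blast
next
  assume c: "cohom R Q W f g"
  show "cls f = cls g"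
    using c cohom_sym[OF W Q g c] cohom_trans[OF W Q f] cohom_trans[OF W Q g] mem_cls[OF f] mem_cls[OF g] by blast
qed

lemma ext_cocycles_eq: "ext_cocycles R 2 V W = {f. cocycle R Q W f}"
  by (auto simp: ext_cocycles_def ext_cochains_def rhom_group_def Q_def[symmetric] cocycle_def
      numeral_2_eq_2 numeral_3_eq_3)

lemma ext_carrier: "carrier (ext_bimod R 2 V W) = cls ` {f. cocycle R Q W f}"
  by (simp add: ext_bimod_def ext_cocycles_eq)

lemma ext_zero: "\<zero>\<^bsub>ext_bimod R 2 V W\<^esub> = cls (\<lambda>x\<in>Q2. \<zero>\<^bsub>W\<^esub>)"
proof -
  interpret W: right_module R W by (rule W)
  have d: "x \<in> Q2 \<Longrightarrow> rdiff Q 1 x \<in> carrier (rterm Q 1)" for x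
    using rhom_closed[OF pres_diff[OF Q, of 1], of x] by (simp add: numeral_2_eq_2)
  have "(\<lambda>x\<in>Q2. compose Q2 g (rdiff Q 1) x \<oplus>\<^bsub>W\<^esub> (\<lambda>x\<in>Q2. \<zero>\<^bsub>W\<^esub>) x) = compose Q2 g (rdiff Q 1)"
    if "g \<in> rhom R (rterm Q 1) W" for g
    using rhom_closed[OF that d] by (auto simp: compose_def)
  then show ?thesis
    by (auto simp: ext_bimod_def ext_class_def a_r_coset_def' coboundaries ext_cochains_def rhom_group_def Q_def[symmetric])
qed

lemma ext_add:
  assumes f: "f \<in> rhom R (rterm Q 2) W" and g: "g \<in> rhom R (rterm Q 2) W"
  shows "cls f \<oplus>\<^bsub>ext_bimod R 2 V W\<^esub> cls g = cls (\<lambda>x\<in>Q2. f x \<oplus>\<^bsub>W\<^esub> g x)"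
proof -
  interpret W: right_module R W by (rule W)
  note fg = plus_rhom[OF f g pres_term[OF Q] W]
  have eq: "cls f \<oplus>\<^bsub>ext_bimod R 2 V W\<^esub> cls g = {\<lambda>x\<in>Q2. f' x \<oplus>\<^bsub>W\<^esub> g' x | f' g'. f' \<in> cls f \<and> g' \<in> cls g}"
    by (auto simp: ext_bimod_def set_add_def' ext_cochains_def rhom_group_def Q_def[symmetric])
  show ?thesis unfolding eq
  proof (intro equalityI subsetI)
    fix k assume "k \<in> {\<lambda>x\<in>Q2. f' x \<oplus>\<^bsub>W\<^esub> g' x | f' g'. f' \<in> cls f \<and> g' \<in> cls g}"
    then obtain f' g' where k: "k = (\<lambda>x\<in>Q2. f' x \<oplus>\<^bsub>W\<^esub> g' x)" "f' \<in> cls f" "g' \<in> cls g" by blast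
    then have f': "f' \<in> rhom R (rterm Q 2) W" "cohom R Q W f' f" and g': "g' \<in> rhom R (rterm Q 2) W" "cohom R Q W g' g"
      using mem_cls[OF f] mem_cls[OF g] by blast+
    show "k \<in> cls (\<lambda>x\<in>Q2. f x \<oplus>\<^bsub>W\<^esub> g x)"
      unfolding k(1) mem_cls[OF fg]
      using cohom_plus[OF W Q f'(1) g'(1) f g f'(2) g'(2)] plus_rhom[OF f'(1) g'(1) pres_term[OF Q] W] by (rule conjI[rotated])
  next
    fix k assume "k \<in> cls (\<lambda>x\<in>Q2. f x \<oplus>\<^bsub>W\<^esub> g x)"
    then have k: "k \<in> rhom R (rterm Q 2) W" "cohom R Q W k (\<lambda>x\<in>Q2. f x \<oplus>\<^bsub>W\<^esub> g x)"
      using mem_cls[OF fg] by blast+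
    have gc: "g \<in> cls g" using mem_cls[OF g] g cohom_refl[OF W Q g] by blast
    \<comment> \<open>For the inclusion of the coset of the sum in the sum of cosets,
      \<open>k\<close> is split as \<open>(k - g) + g\<close>, keeping \<open>g\<close> itself as
      the second representative.\<close>
    let ?f = "\<lambda>x\<in>Q2. k x \<ominus>\<^bsub>W\<^esub> g x"
    have fh: "?f \<in> rhom R (rterm Q 2) W" by (rule diff_rhom[OF k(1) g pres_term[OF Q] W])
    obtain a where a: "a \<in> rhom R (rterm Q 1) W"
      "\<And>x. x \<in> Q2 \<Longrightarrow> k x = a (rdiff Q 1 x) \<oplus>\<^bsub>W\<^esub> (\<lambda>x\<in>Q2. f x \<oplus>\<^bsub>W\<^esub> g x) x"
      using k(2) by (auto simp: cohom_def)
    have d: "x \<in> Q2 \<Longrightarrow> rdiff Q 1 x \<in> carrier (rterm Q 1)" for x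
      using rhom_closed[OF pres_diff[OF Q, of 1], of x] by (simp add: numeral_2_eq_2)
    have "?f x = a (rdiff Q 1 x) \<oplus>\<^bsub>W\<^esub> f x" if x: "x \<in> Q2" for x
      unfolding restrict_apply'[OF x] a(2)[OF x]
      using rhom_closed[OF a(1) d[OF x]] rhom_closed[OF f x] rhom_closed[OF g x]
      by (simp add: a_minus_def W.M.a_assoc W.M.r_neg)
    then have "?f \<in> cls f" using mem_cls[OF f] fh a(1) by (auto simp: cohom_def)
    moreover have "k = (\<lambda>x\<in>Q2. ?f x \<oplus>\<^bsub>W\<^esub> g x)"
      by (rule rhom_eqI[OF k(1) plus_rhom[OF fh g pres_term[OF Q] W]])
        (simp add: a_minus_def W.M.a_assoc W.M.l_neg rhom_closed[OF k(1)] rhom_closed[OF g])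
    ultimately show "k \<in> {\<lambda>x\<in>Q2. f' x \<oplus>\<^bsub>W\<^esub> g' x | f' g'. f' \<in> cls f \<and> g' \<in> cls g}" using gc by blast
  qed
qed

text \<open>All representatives of a class have cohomologous composites, so the union in
  \<open>ext_push\<close> runs over equal cosets. The action \<open>lact W a\<close> enters through
  its restriction to the carrier, since homomorphisms are normalised.\<close>

lemma ext_lact:
  assumes h: "(\<lambda>w\<in>carrier W. lact W a w) \<in> rhom R W W" and f: "f \<in> rhom R (rterm Q 2) W"
  shows "lact (ext_bimod R 2 V W) a (cls f) = cls (\<lambda>x\<in>Q2. lact W a (f x))"
proof -
  let ?h = "\<lambda>w\<in>carrier W. lact W a w"
  have c: "compose Q2 (lact W a) f' = compose Q2 ?h f'" if "f' \<in> rhom R (rterm Q 2) W" for f'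
    using rhom_closed[OF that] by (auto simp: compose_def)
  have hf: "compose Q2 ?h f' \<in> rhom R (rterm Q 2) W" if "f' \<in> rhom R (rterm Q 2) W" for f'
    by (rule compose_rhom[OF that h pres_term[OF Q]])
  have "cls (compose Q2 (lact W a) f') = cls (compose Q2 (lact W a) f)" if "f' \<in> cls f" for f'
    using that mem_cls[OF f] c[OF f] c[of f'] hf[OF f] hf[of f']
      cls_eq_iff[of "compose Q2 ?h f'" "compose Q2 ?h f"] cohom_compose_left[OF Q h f, of f'] by simp
  moreover have "f \<in> cls f" using mem_cls[OF f] f cohom_refl[OF W Q f] by blast
  ultimately have "(\<Union>f'\<in>cls f. cls (compose Q2 (lact W a) f')) = cls (compose Q2 (lact W a) f)"
    by blast
  then show ?thesis
    by (simp add: ext_bimod_def ext_push_def Q_def[symmetric] compose_def)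
qed

text \<open>The union in \<open>ext_pull\<close> runs over representatives and over lifts. Changing
  the first is \<open>cohom_compose_chain_map\<close>, changing the second is the homotopy argument
  \<open>cohom_chain_maps\<close>.\<close>

lemma ext_ract:
  assumes f: "cocycle R Q W f" and \<phi>: "chain_map R Q Q (lact V a) \<phi>"
  shows "ract (ext_bimod R 2 V W) (cls f) a = cls (compose Q2 f (\<phi> 2))"
proof -
  note fh = cocycle_rhom[OF f]
  have "cls (compose Q2 f' (\<psi> 2)) = cls (compose Q2 f (\<phi> 2))"
    if f': "f' \<in> cls f" and \<psi>: "chain_map R Q Q (lact V a) \<psi>" for f' \<psi>
  proof -
    have f'h: "f' \<in> rhom R (rterm Q 2) W" "cohom R Q W f' f" using f' mem_cls[OF fh] by blast+
    have r: "compose Q2 g (\<theta> 2) \<in> rhom R (rterm Q 2) W"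
      if "g \<in> rhom R (rterm Q 2) W" "chain_map R Q Q (lact V a) \<theta>" for g \<theta>
      by (rule compose_rhom[OF chain_map_rhom[OF that(2)] that(1) pres_term[OF Q]])
    have "cohom R Q W (compose Q2 f' (\<psi> 2)) (compose Q2 f (\<psi> 2))"
      by (rule cohom_compose_chain_map[OF Q \<psi> f'h(2)])
    moreover have "cohom R Q W (compose Q2 f (\<psi> 2)) (compose Q2 f (\<phi> 2))"
      by (rule cohom_chain_maps[OF Q Q \<psi> \<phi> f W])
    ultimately have "cohom R Q W (compose Q2 f' (\<psi> 2)) (compose Q2 f (\<phi> 2))"
      by (rule cohom_trans[OF W Q r[OF fh \<phi>]])
    then show ?thesis using cls_eq_iff[OF r[OF f'h(1) \<psi>] r[OF fh \<phi>]] by blast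
  qed
  moreover have "f \<in> cls f" using mem_cls[OF fh] fh cohom_refl[OF W Q fh] by blast
  ultimately have "(\<Union>f'\<in>cls f. \<Union>\<psi>\<in>{\<psi>. chain_map R Q Q (lact V a) \<psi>}. cls (compose Q2 f' (\<psi> 2))) = cls (compose Q2 f (\<phi> 2))"
    using \<phi> by blast
  then show ?thesis
    by (simp add: ext_bimod_def ext_pull_def Q_def[symmetric] chain_lift_eq_chain_map)
qed

end

section \<open>The dual bimodule\<close>

lemma dual_simps [simp]:
  "\<zero>\<^bsub>dual_bimod K A\<^esub> = (\<lambda>x \<in> carrier A. \<zero>\<^bsub>K\<^esub>)"
  "\<phi> \<oplus>\<^bsub>dual_bimod K A\<^esub> \<psi> = (\<lambda>x \<in> carrier A. \<phi> x \<oplus>\<^bsub>K\<^esub> \<psi> x)"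
  "ract (dual_bimod K A) \<phi> a = (\<lambda>x \<in> carrier A. \<phi> (a \<otimes>\<^bsub>A\<^esub> x))"
  "lact (dual_bimod K A) a \<phi> = (\<lambda>x \<in> carrier A. \<phi> (x \<otimes>\<^bsub>A\<^esub> a))"
  by (simp_all add: dual_bimod_def)

lemma dualI:
  assumes "\<And>x. x \<in> carrier A \<Longrightarrow> F x \<in> carrier K"
    and "\<And>x y. x \<in> carrier A \<Longrightarrow> y \<in> carrier A \<Longrightarrow> F (x \<oplus>\<^bsub>A\<^esub> y) = F x \<oplus>\<^bsub>K\<^esub> F y"
    and "\<And>c x. c \<in> carrier K \<Longrightarrow> x \<in> carrier A \<Longrightarrow> F (c \<odot>\<^bsub>A\<^esub> x) = c \<otimes>\<^bsub>K\<^esub> F x"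
    and "k_algebra K A"
  shows "(\<lambda>x\<in>carrier A. F x) \<in> carrier (dual_bimod K A)"
proof -
  interpret k_algebra K A by fact
  show ?thesis using assms(1-3) by (auto simp: dual_bimod_def smult_closed)
qed

lemma dual_closed: "\<phi> \<in> carrier (dual_bimod K A) \<Longrightarrow> x \<in> carrier A \<Longrightarrow> \<phi> x \<in> carrier K"
  by (auto simp: dual_bimod_def)

lemma dual_add:
  "\<phi> \<in> carrier (dual_bimod K A) \<Longrightarrow> x \<in> carrier A \<Longrightarrow> y \<in> carrier A \<Longrightarrow> \<phi> (x \<oplus>\<^bsub>A\<^esub> y) = \<phi> x \<oplus>\<^bsub>K\<^esub> \<phi> y"
  by (auto simp: dual_bimod_def)

lemma dual_smult:
  "\<phi> \<in> carrier (dual_bimod K A) \<Longrightarrow> c \<in> carrier K \<Longrightarrow> x \<in> carrier A \<Longrightarrow> \<phi> (c \<odot>\<^bsub>A\<^esub> x) = c \<otimes>\<^bsub>K\<^esub> \<phi> x"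
  by (auto simp: dual_bimod_def)

lemma dual_restrict: "\<phi> \<in> carrier (dual_bimod K A) \<Longrightarrow> (\<lambda>x\<in>carrier A. \<phi> x) = \<phi>"
  by (auto simp: dual_bimod_def PiE_def extensional_restrict)

lemma dual_zero:
  assumes "\<phi> \<in> carrier (dual_bimod K A)" and "k_algebra K A"
  shows "\<phi> \<zero>\<^bsub>A\<^esub> = \<zero>\<^bsub>K\<^esub>"
proof -
  interpret k_algebra K A by fact
  have "\<phi> (\<zero>\<^bsub>K\<^esub> \<odot>\<^bsub>A\<^esub> \<zero>\<^bsub>A\<^esub>) = \<zero>\<^bsub>K\<^esub> \<otimes>\<^bsub>K\<^esub> \<phi> \<zero>\<^bsub>A\<^esub>"
    by (rule dual_smult[OF assms(1)]) simp_all
  moreover have "\<zero>\<^bsub>K\<^esub> \<odot>\<^bsub>A\<^esub> \<zero>\<^bsub>A\<^esub> = \<zero>\<^bsub>A\<^esub>" by (rule smult_l_null) simp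
  ultimately show ?thesis using dual_closed[OF assms(1), of "\<zero>\<^bsub>A\<^esub>"] by simp
qed

context k_algebra
begin

lemma dual_plus_closed:
  assumes "\<phi> \<in> carrier (dual_bimod K A)" "\<psi> \<in> carrier (dual_bimod K A)"
  shows "(\<lambda>x\<in>carrier A. \<phi> x \<oplus>\<^bsub>K\<^esub> \<psi> x) \<in> carrier (dual_bimod K A)"
  using assms
  by (intro dualI k_algebra_axioms) (simp_all add: dual_closed dual_add dual_smult K.a_ac K.r_distr)

lemma dual_ract_closed:
  assumes "\<phi> \<in> carrier (dual_bimod K A)" "a \<in> carrier A"
  shows "(\<lambda>x\<in>carrier A. \<phi> (a \<otimes>\<^bsub>A\<^esub> x)) \<in> carrier (dual_bimod K A)"
  using assms
  by (intro dualI k_algebra_axioms) (simp_all add: dual_closed dual_add dual_smult A.r_distr smult_mult_right)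

lemma dual_lact_closed:
  assumes "\<phi> \<in> carrier (dual_bimod K A)" "a \<in> carrier A"
  shows "(\<lambda>x\<in>carrier A. \<phi> (x \<otimes>\<^bsub>A\<^esub> a)) \<in> carrier (dual_bimod K A)"
  using assms
  by (intro dualI k_algebra_axioms) (simp_all add: dual_closed dual_add dual_smult A.l_distr smult_mult_left)

lemma right_module_dual: "right_module A (dual_bimod K A)"
proof (rule right_moduleI[OF ring_A])
  show "abelian_group (dual_bimod K A)"
  proof (rule abelian_groupI)
    fix \<phi> assume \<phi>: "\<phi> \<in> carrier (dual_bimod K A)"
    show "\<zero>\<^bsub>dual_bimod K A\<^esub> \<oplus>\<^bsub>dual_bimod K A\<^esub> \<phi> = \<phi>"
      using dual_restrict[OF \<phi>] by (simp add: dual_closed[OF \<phi>] cong: restrict_cong)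
    have "(\<lambda>x\<in>carrier A. \<ominus>\<^bsub>K\<^esub> \<phi> x) \<in> carrier (dual_bimod K A)"
      using \<phi> by (intro dualI k_algebra_axioms)
        (simp_all add: dual_closed dual_add dual_smult K.minus_add K.r_minus)
    moreover have "(\<lambda>x\<in>carrier A. \<ominus>\<^bsub>K\<^esub> \<phi> x) \<oplus>\<^bsub>dual_bimod K A\<^esub> \<phi> = \<zero>\<^bsub>dual_bimod K A\<^esub>"
      using \<phi> by (auto simp: dual_closed K.l_neg)
    ultimately show "\<exists>\<psi>\<in>carrier (dual_bimod K A). \<psi> \<oplus>\<^bsub>dual_bimod K A\<^esub> \<phi> = \<zero>\<^bsub>dual_bimod K A\<^esub>"
      by blast
  next
    show "\<zero>\<^bsub>dual_bimod K A\<^esub> \<in> carrier (dual_bimod K A)"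
      unfolding dual_simps by (intro dualI k_algebra_axioms) simp_all
  qed (auto simp: dual_plus_closed dual_closed K.a_ac intro!: restrict_ext)
qed (auto simp: dual_ract_closed dual_closed dual_add A.m_assoc A.l_distr dual_restrict
      intro!: restrict_ext cong: restrict_cong)

lemma lact_dual_rhom:
  assumes "a \<in> carrier A"
  shows "(\<lambda>\<phi>\<in>carrier (dual_bimod K A). lact (dual_bimod K A) a \<phi>) \<in> rhom A (dual_bimod K A) (dual_bimod K A)"
  by (rule rhomI[OF _ _ _ right_module_dual])
    (use assms in \<open>auto simp: dual_lact_closed A.m_assoc intro!: restrict_ext\<close>)

lemma lact_regular_rhom:
  assumes "a \<in> carrier A"
  shows "(\<lambda>x\<in>carrier (regular_bimod A). lact (regular_bimod A) a x) \<in> rhom A (regular_bimod A) (regular_bimod A)"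
  by (rule rhomI[OF _ _ _ right_module_regular[OF ring_A]])
    (use assms in \<open>simp_all add: A.r_distr A.m_assoc\<close>)

lemma finite_dim_identity_frank:
  assumes "fin_gen K (scalars A (regular_bimod A))"
  shows "dbproj K (submod (scalars A (regular_bimod A)) (carrier A))"
proof -
  let ?V = "scalars A (regular_bimod A)"
  have V: "right_module K ?V" by (rule right_module_scalars[OF right_module_regular[OF ring_A]])
  obtain S where S: "finite S" "S \<subseteq> carrier A" "carrier A \<subseteq> rhull K ?V S"
    using assms by (auto simp: fin_gen_iff[OF V])
  then have "rhull K ?V S = carrier A"
    using rhull_closed[OF _ V, of _ S] by auto
  then show ?thesis
    using subspace_identity_frank[OF field_K V S(1)] S(2) by simp
qed

text \<open>Right linear functionals over the field are elements of the dual, because the field is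
  commutative and scalars are central in \<open>A\<close>.\<close>

lemma functional_dual:
  assumes w: "w \<in> rhom K (submod (scalars A (regular_bimod A)) (carrier A)) (regular_bimod K)"
  shows "w \<in> carrier (dual_bimod K A)"
proof -
  have "(\<lambda>x\<in>carrier A. w x) \<in> carrier (dual_bimod K A)"
  proof (rule dualI[OF _ _ _ k_algebra_axioms])
    fix x assume x: "x \<in> carrier A"
    then show "w x \<in> carrier K" using rhom_closed[OF w] by simp
    show "w (c \<odot>\<^bsub>A\<^esub> x) = c \<otimes>\<^bsub>K\<^esub> w x" if "c \<in> carrier K" for c
      using rhom_ract[OF w, of x c] rhom_closed[OF w, of x] x that by (simp add: mult_scalar K.m_comm)
  next
    fix x y assume "x \<in> carrier A" "y \<in> carrier A"
    then show "w (x \<oplus>\<^bsub>A\<^esub> y) = w x \<oplus>\<^bsub>K\<^esub> w y" using rhom_add[OF w, of x y] by simp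
  qed
  then show ?thesis using rhom_restrict[OF w] by simp
qed

text \<open>If the identity of \<open>A\<close> is the sum of the maps \<open>n w\<close>, then
  every \<phi> is the sum of the functionals \<open>w\<close> acted on by the scalars
  \<open>\<phi> n\<close>. So the functionals of a dual basis generate the dual, even over the
  field.\<close>

lemma fin_gen_dual:
  assumes fd: "fin_gen K (scalars A (regular_bimod A))"
  shows "fin_gen A (dual_bimod K A)"
proof -
  let ?U = "submod (scalars A (regular_bimod A)) (carrier A)" and ?D = "dual_bimod K A"
  have U: "dbproj K ?U" by (rule finite_dim_identity_frank[OF fd])
  note U' = dbproj_right_module[OF U]
  note D = right_module_dual
  have "\<exists>S. finite S \<and> S \<subseteq> carrier ?D \<and> (\<forall>\<phi>\<in>carrier ?D. (\<lambda>x\<in>carrier A. \<phi> (f x)) \<in> rhull A ?D S)"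
    if "f \<in> frank K ?U ?U" for f
    using that
  proof induction
    case zero
    have "(\<lambda>x\<in>carrier A. \<phi> ((\<lambda>x\<in>carrier ?U. \<zero>\<^bsub>?U\<^esub>) x)) \<in> rhull A ?D {}" if "\<phi> \<in> carrier ?D" for \<phi>
      using rhull.zero[of ?D A "{}"] dual_zero[OF that k_algebra_axioms] by (simp cong: restrict_cong)
    then show ?case by (intro exI[of _ "{}"] conjI ballI finite.emptyI empty_subsetI)
  next
    case (add n w f)
    then obtain S where S: "finite S" "S \<subseteq> carrier ?D"
      "\<And>\<phi>. \<phi> \<in> carrier ?D \<Longrightarrow> (\<lambda>x\<in>carrier A. \<phi> (f x)) \<in> rhull A ?D S" by blast
    have w: "w \<in> carrier ?D" by (rule functional_dual[OF add(2)])
    have n: "n \<in> carrier A" using add(1) by simp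
    have fc: "f x \<in> carrier A" if "x \<in> carrier A" for x
      using rhom_closed[OF frank_rhom[OF add(3) U' U'], of x] that by simp
    have "(\<lambda>x\<in>carrier A. \<phi> ((\<lambda>x\<in>carrier ?U. ract ?U n (w x) \<oplus>\<^bsub>?U\<^esub> f x) x)) \<in> rhull A ?D (insert w S)"
      if \<phi>: "\<phi> \<in> carrier ?D" for \<phi>
    proof -
      have pt: "\<phi> (n \<otimes>\<^bsub>A\<^esub> (w x \<odot>\<^bsub>A\<^esub> \<one>\<^bsub>A\<^esub>) \<oplus>\<^bsub>A\<^esub> f x) = w ((\<phi> n \<odot>\<^bsub>A\<^esub> \<one>\<^bsub>A\<^esub>) \<otimes>\<^bsub>A\<^esub> x) \<oplus>\<^bsub>K\<^esub> \<phi> (f x)"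
        if x: "x \<in> carrier A" for x
      proof -
        note c = dual_closed[OF w x] dual_closed[OF \<phi> n]
        show ?thesis
          unfolding mult_scalar[OF c(1) n] scalar_mult[OF c(2) x] dual_add[OF \<phi> smult_closed[OF c(1) n] fc[OF x]]
            dual_smult[OF \<phi> c(1) n] dual_smult[OF w c(2) x] K.m_comm[OF c] by (rule refl)
      qed
      have "(\<lambda>x\<in>carrier A. \<phi> ((\<lambda>x\<in>carrier ?U. ract ?U n (w x) \<oplus>\<^bsub>?U\<^esub> f x) x)) =
          ract ?D w (\<phi> n \<odot>\<^bsub>A\<^esub> \<one>\<^bsub>A\<^esub>) \<oplus>\<^bsub>?D\<^esub> (\<lambda>x\<in>carrier A. \<phi> (f x))"
        unfolding dual_simps by (intro restrict_ext) (simp add: pt)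
      moreover have "(\<lambda>x\<in>carrier A. \<phi> (f x)) \<in> rhull A ?D (insert w S)"
        by (rule rhull_mono[OF S(3)[OF \<phi>]]) auto
      then have "ract ?D w (\<phi> n \<odot>\<^bsub>A\<^esub> \<one>\<^bsub>A\<^esub>) \<oplus>\<^bsub>?D\<^esub> (\<lambda>x\<in>carrier A. \<phi> (f x)) \<in> rhull A ?D (insert w S)"
        by (rule rhull.add[OF insertI1 scalar_closed[OF dual_closed[OF \<phi> n]]])
      ultimately show ?thesis by (simp only:)
    qed
    moreover have "finite (insert w S)" "insert w S \<subseteq> carrier ?D" using S(1,2) w by simp_all
    ultimately show ?case by (intro exI[of _ "insert w S"] conjI ballI)
  qed
  from this[of "\<lambda>x\<in>carrier ?U. x"] U
  obtain S where S: "finite S" "S \<subseteq> carrier ?D"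
    "\<And>\<phi>. \<phi> \<in> carrier ?D \<Longrightarrow> (\<lambda>x\<in>carrier A. \<phi> ((\<lambda>x\<in>carrier ?U. x) x)) \<in> rhull A ?D S"
    by (auto simp: dbproj_def)
  have "carrier ?D \<subseteq> rhull A ?D S"
  proof
    fix \<phi> assume \<phi>: "\<phi> \<in> carrier ?D"
    have "(\<lambda>x\<in>carrier A. \<phi> ((\<lambda>x\<in>carrier ?U. x) x)) = \<phi>"
      using dual_restrict[OF \<phi>] by (simp cong: restrict_cong)
    then show "\<phi> \<in> rhull A ?D S" using S(3)[OF \<phi>] by (simp only:)
  qed
  then show ?thesis using S by (subst fin_gen_iff[OF D]) blast
qed

end

text \<open>Finite dimensionality is assumed as finite generation over the field, the form in which
  it is proved for the one-point extension and consumed by the lemmas on spans.\<close>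

locale fd_algebra = k_algebra K A for K :: "('k, 'r) ring_scheme" (structure) and A :: "('k, 'a, 's) module_scheme" (structure) +
  assumes fin_gen_scalars: "fin_gen K (scalars A (regular_bimod A))"
begin

abbreviation "DA \<equiv> dual_bimod K A"
abbreviation "res \<equiv> chosen_res A (dual_bimod K A)"
abbreviation "E \<equiv> ext2_bimod K A"

lemma pres_res: "pres A DA res"
proof -
  have "proj_resolution A DA res"
    unfolding chosen_res_def
    using proj_resolution_exists[OF k_algebra_axioms fin_gen_scalars right_module_dual fin_gen_dual[OF fin_gen_scalars]]
    by (rule someI_ex)
  then show ?thesis
    using proj_resolution_iff_pres[OF right_module_dual] by blast
qed

sublocale ext2 A "dual_bimod K A" "regular_bimod A" "chosen_res A (dual_bimod K A)"
  by (rule ext2.intro) (rule refl pres_res right_module_regular[OF ring_A])+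

text \<open>The comparison theorem needs a normalised homomorphism, the definition of the right
  action uses the bare \<open>lact\<close>; the two agree on values of the augmentation, the only
  place where a chain map consults them.\<close>

lemma lact_chain_map_exists:
  assumes "a \<in> carrier A"
  shows "\<exists>\<phi>. chain_map A res res (lact DA a) \<phi>"
proof -
  obtain \<phi> where "chain_map A res res (\<lambda>\<phi>\<in>carrier DA. lact DA a \<phi>) \<phi>"
    using chain_map_exists[OF pres_res pres_res lact_dual_rhom[OF assms]] by blast
  then have "chain_map A res res (lact DA a) \<phi>"
    using rhom_closed[OF pres_aug[OF pres_res]] by (simp add: chain_map_def)
  then show ?thesis by blast
qed

lemma ext_lact':
  assumes "a \<in> carrier A" "cocycle A res (regular_bimod A) f"
  shows "lact E a (cls f) = cls (\<lambda>x\<in>Q2. a \<otimes>\<^bsub>A\<^esub> f x)"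
  using ext_lact[OF lact_regular_rhom[OF assms(1)] cocycle_rhom[OF assms(2)]] by (simp add: ext2_bimod_def)

lemma cocycle_lact:
  assumes "a \<in> carrier A" "cocycle A res (regular_bimod A) f"
  shows "cocycle A res (regular_bimod A) (\<lambda>x\<in>Q2. a \<otimes>\<^bsub>A\<^esub> f x)"
proof -
  have "(\<lambda>x\<in>Q2. a \<otimes>\<^bsub>A\<^esub> f x) = compose Q2 (\<lambda>x\<in>carrier (regular_bimod A). lact (regular_bimod A) a x) f"
    using rhom_closed[OF cocycle_rhom[OF assms(2)]] by (auto simp: compose_def)
  then show ?thesis
    using cocycle_compose_left[OF W W pres_res assms(2) lact_regular_rhom[OF assms(1)]] by simp
qed

lemma ext_ract':
  assumes "cocycle A res (regular_bimod A) f" "chain_map A res res (lact DA a) \<phi>"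
  shows "ract E (cls f) a = cls (compose Q2 f (\<phi> 2))"
  using ext_ract[OF assms] by (simp add: ext2_bimod_def)

lemma ext_add':
  assumes "cocycle A res (regular_bimod A) f" "cocycle A res (regular_bimod A) g"
  shows "cls f \<oplus>\<^bsub>E\<^esub> cls g = cls (\<lambda>x\<in>Q2. f x \<oplus>\<^bsub>A\<^esub> g x)"
  using ext_add[OF cocycle_rhom[OF assms(1)] cocycle_rhom[OF assms(2)]] by (simp add: ext2_bimod_def)

lemma ext_zero': "\<zero>\<^bsub>E\<^esub> = cls (\<lambda>x\<in>Q2. \<zero>\<^bsub>A\<^esub>)"
  using ext_zero by (simp add: ext2_bimod_def)

lemma ext_carrier': "carrier E = cls ` {f. cocycle A res (regular_bimod A) f}"
  using ext_carrier by (simp add: ext2_bimod_def)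

text \<open>Scalars are central in \<open>A\<close>, so right multiplication by a scalar on every term lifts the left
  action of that scalar on \<open>DA\<close>.\<close>

lemma scalar_chain_map:
  assumes t: "t \<in> carrier K"
  shows "chain_map A res res (lact DA (t \<odot>\<^bsub>A\<^esub> \<one>\<^bsub>A\<^esub>))
    (\<lambda>i. \<lambda>q\<in>carrier (rterm res i). ract (rterm res i) q (t \<odot>\<^bsub>A\<^esub> \<one>\<^bsub>A\<^esub>))"
  unfolding chain_map_def
proof (intro conjI allI ballI)
  note s = scalar_closed[OF t]
  fix i
  interpret Qi: right_module A "rterm res i" by (rule pres_term[OF pres_res])
  show "(\<lambda>q\<in>carrier (rterm res i). ract (rterm res i) q (t \<odot>\<^bsub>A\<^esub> \<one>\<^bsub>A\<^esub>)) \<in> rhom A (rterm res i) (rterm res i)"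
    using s by (intro rhomI Qi.right_module_axioms)
      (simp_all add: Qi.ract_closed Qi.ract_add_left Qi.ract_assoc[symmetric] scalar_central[OF t])
  fix q assume q: "q \<in> carrier (rterm res (Suc i))"
  then show "rdiff res i ((\<lambda>q\<in>carrier (rterm res (Suc i)). ract (rterm res (Suc i)) q (t \<odot>\<^bsub>A\<^esub> \<one>\<^bsub>A\<^esub>)) q) =
      (\<lambda>q\<in>carrier (rterm res i). ract (rterm res i) q (t \<odot>\<^bsub>A\<^esub> \<one>\<^bsub>A\<^esub>)) (rdiff res i q)"
    using rhom_closed[OF pres_diff[OF pres_res] q] rhom_ract[OF pres_diff[OF pres_res] q s] by simp
next
  fix q assume q: "q \<in> carrier (rterm res 0)"
  show "raug res ((\<lambda>q\<in>carrier (rterm res 0). ract (rterm res 0) q (t \<odot>\<^bsub>A\<^esub> \<one>\<^bsub>A\<^esub>)) q) =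
      lact DA (t \<odot>\<^bsub>A\<^esub> \<one>\<^bsub>A\<^esub>) (raug res q)"
    using q rhom_ract[OF pres_aug[OF pres_res] q scalar_closed[OF t]]
    by (simp add: scalar_central[OF t] cong: restrict_cong)
qed

text \<open>Needed because in a one-point extension the corner scalar acts on the module from the
  right, while on cocycles it appears as multiplication of the values.\<close>

lemma ext_ract_scalar:
  assumes t: "t \<in> carrier K" and f: "cocycle A res (regular_bimod A) f"
  shows "ract E (cls f) (t \<odot>\<^bsub>A\<^esub> \<one>\<^bsub>A\<^esub>) = cls (\<lambda>x\<in>Q2. f x \<otimes>\<^bsub>A\<^esub> (t \<odot>\<^bsub>A\<^esub> \<one>\<^bsub>A\<^esub>))"
proof -
  have "compose Q2 f (\<lambda>q\<in>Q2. ract (rterm res 2) q (t \<odot>\<^bsub>A\<^esub> \<one>\<^bsub>A\<^esub>)) = (\<lambda>x\<in>Q2. f x \<otimes>\<^bsub>A\<^esub> (t \<odot>\<^bsub>A\<^esub> \<one>\<^bsub>A\<^esub>))"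
    using rhom_ract[OF cocycle_rhom[OF f] _ scalar_closed[OF t]] by (auto simp: compose_def)
  then show ?thesis
    using ext_ract'[OF f scalar_chain_map[OF t]] by simp
qed

lemma ext_ract_zero:
  assumes "a \<in> carrier A"
  shows "ract E \<zero>\<^bsub>E\<^esub> a = \<zero>\<^bsub>E\<^esub>"
proof -
  obtain \<phi> where \<phi>: "chain_map A res res (lact DA a) \<phi>" using lact_chain_map_exists[OF assms] by blast
  have z: "cocycle A res (regular_bimod A) (\<lambda>x\<in>Q2. \<zero>\<^bsub>A\<^esub>)"
    using cocycle_zero[OF W pres_res] by simp
  have "compose Q2 (\<lambda>x\<in>Q2. \<zero>\<^bsub>A\<^esub>) (\<phi> 2) = (\<lambda>x\<in>Q2. \<zero>\<^bsub>A\<^esub>)"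
    using rhom_closed[OF chain_map_rhom[OF \<phi>]] by (auto simp: compose_def)
  then show ?thesis using ext_ract'[OF z \<phi>] by (simp add: ext_zero')
qed

end

lemma rhom_rhull:
  assumes h: "h \<in> rhom R M N" and "x \<in> rhull R M S" and M: "right_module R M" and N: "right_module R N"
    and S: "S \<subseteq> carrier M" and "h ` S \<subseteq> T"
  shows "h x \<in> rhull R N T"
proof -
  interpret M: right_module R M by fact
  show ?thesis using assms(2)
  proof induction
    case zero
    then show ?case
      using rhom_zero[OF h right_module_abelian_group[OF M] right_module_abelian_group[OF N]]
      by (simp add: rhull.zero)
  next
    case (add s a x)
    have s: "s \<in> carrier M" using add(1) S by blast
    have "ract N (h s) a \<oplus>\<^bsub>N\<^esub> h x \<in> rhull R N T"
      using add assms(6) by (intro rhull.add) auto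
    then show ?case
      using rhom_add[OF h M.ract_closed[OF s add(2)] rhull_closed[OF add(3) M S]] rhom_ract[OF h s add(2)] by simp
  qed
qed

section \<open>The one-point extension\<close>

locale one_point = C: fd_algebra K C
  for K :: "('k, 'r) ring_scheme" and C :: "('k, 'a, 's) module_scheme" +
  fixes P :: "('a, 'm, 'z) rmodule_scheme"
  assumes dbproj_P: "dbproj C P"
begin

sublocale P: right_module C P
  by (rule dbproj_right_module[OF dbproj_P])

abbreviation "B \<equiv> one_point_ext K C P"

lemma B_carrier: "carrier B = carrier C \<times> carrier P \<times> carrier K"
  by (simp add: one_point_ext_def)

lemma B_mem [simp]: "(c, p, \<mu>) \<in> carrier B \<longleftrightarrow> c \<in> carrier C \<and> p \<in> carrier P \<and> \<mu> \<in> carrier K"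
  by (simp add: one_point_ext_def)

lemma B_cases:
  assumes "x \<in> carrier B"
  obtains c p \<mu> where "x = (c, p, \<mu>)" "c \<in> carrier C" "p \<in> carrier P" "\<mu> \<in> carrier K"
  using assms by (auto simp: B_carrier)

lemma B_simps [simp]:
  "(c, p, \<mu>) \<otimes>\<^bsub>B\<^esub> (c', p', \<mu>') =
    (c \<otimes>\<^bsub>C\<^esub> c', ract P p c' \<oplus>\<^bsub>P\<^esub> ract P p' (\<mu> \<odot>\<^bsub>C\<^esub> \<one>\<^bsub>C\<^esub>), \<mu> \<otimes>\<^bsub>K\<^esub> \<mu>')"
  "(c, p, \<mu>) \<oplus>\<^bsub>B\<^esub> (c', p', \<mu>') = (c \<oplus>\<^bsub>C\<^esub> c', p \<oplus>\<^bsub>P\<^esub> p', \<mu> \<oplus>\<^bsub>K\<^esub> \<mu>')"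
  "\<zero>\<^bsub>B\<^esub> = (\<zero>\<^bsub>C\<^esub>, \<zero>\<^bsub>P\<^esub>, \<zero>\<^bsub>K\<^esub>)" "\<one>\<^bsub>B\<^esub> = (\<one>\<^bsub>C\<^esub>, \<zero>\<^bsub>P\<^esub>, \<one>\<^bsub>K\<^esub>)"
  "t \<odot>\<^bsub>B\<^esub> (c, p, \<mu>) = (t \<odot>\<^bsub>C\<^esub> c, ract P p (t \<odot>\<^bsub>C\<^esub> \<one>\<^bsub>C\<^esub>), t \<otimes>\<^bsub>K\<^esub> \<mu>)"
  by (simp_all add: one_point_ext_def)

lemma P_scalar:
  assumes "p \<in> carrier P" "t \<in> carrier K" "u \<in> carrier K"
  shows "ract P p ((t \<oplus>\<^bsub>K\<^esub> u) \<odot>\<^bsub>C\<^esub> \<one>\<^bsub>C\<^esub>) = ract P p (t \<odot>\<^bsub>C\<^esub> \<one>\<^bsub>C\<^esub>) \<oplus>\<^bsub>P\<^esub> ract P p (u \<odot>\<^bsub>C\<^esub> \<one>\<^bsub>C\<^esub>)"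
    "ract P p ((t \<otimes>\<^bsub>K\<^esub> u) \<odot>\<^bsub>C\<^esub> \<one>\<^bsub>C\<^esub>) = ract P (ract P p (t \<odot>\<^bsub>C\<^esub> \<one>\<^bsub>C\<^esub>)) (u \<odot>\<^bsub>C\<^esub> \<one>\<^bsub>C\<^esub>)"
  using ring_hom_mult[OF C.scalar_hom assms(2,3)] ring_hom_add[OF C.scalar_hom assms(2,3)]
    P.ract_add_right[OF assms(1) C.scalar_closed[OF assms(2)] C.scalar_closed[OF assms(3)]]
    P.ract_assoc[OF assms(1) C.scalar_closed[OF assms(2)] C.scalar_closed[OF assms(3)]]
  by (simp_all only:)

text \<open>Scalars are central in \<open>C\<close>, so on \<open>P\<close> they commute with the
  action of \<open>C\<close>. Associativity of the matrix product rests on this.\<close>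

lemma P_scalar_commute:
  assumes "p \<in> carrier P" "t \<in> carrier K" "c \<in> carrier C"
  shows "ract P (ract P p (t \<odot>\<^bsub>C\<^esub> \<one>\<^bsub>C\<^esub>)) c = ract P (ract P p c) (t \<odot>\<^bsub>C\<^esub> \<one>\<^bsub>C\<^esub>)"
  using assms by (simp add: P.ract_assoc[symmetric] C.scalar_central)

lemma P_scalar_commute2:
  assumes "p \<in> carrier P" "t \<in> carrier K" "u \<in> carrier K"
  shows "ract P (ract P p (t \<odot>\<^bsub>C\<^esub> \<one>\<^bsub>C\<^esub>)) (u \<odot>\<^bsub>C\<^esub> \<one>\<^bsub>C\<^esub>) = ract P (ract P p (u \<odot>\<^bsub>C\<^esub> \<one>\<^bsub>C\<^esub>)) (t \<odot>\<^bsub>C\<^esub> \<one>\<^bsub>C\<^esub>)"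
  by (rule P_scalar_commute[OF assms(1,2) C.scalar_closed[OF assms(3)]])

lemma P_smult:
  assumes "p \<in> carrier P" "t \<in> carrier K" "c \<in> carrier C"
  shows "ract P p (t \<odot>\<^bsub>C\<^esub> c) = ract P (ract P p c) (t \<odot>\<^bsub>C\<^esub> \<one>\<^bsub>C\<^esub>)"
  using assms P.ract_assoc[of p c "t \<odot>\<^bsub>C\<^esub> \<one>\<^bsub>C\<^esub>"] by (simp add: C.mult_scalar)

lemma scalar_zero_one: "\<zero>\<^bsub>K\<^esub> \<odot>\<^bsub>C\<^esub> \<one>\<^bsub>C\<^esub> = \<zero>\<^bsub>C\<^esub>" "\<one>\<^bsub>K\<^esub> \<odot>\<^bsub>C\<^esub> \<one>\<^bsub>C\<^esub> = \<one>\<^bsub>C\<^esub>"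
  by (simp_all add: C.smult_l_null C.smult_one)

lemma abelian_group_B: "abelian_group B"
proof (rule abelian_groupI)
  fix x assume "x \<in> carrier B"
  then obtain c p \<mu> where x: "x = (c, p, \<mu>)" "c \<in> carrier C" "p \<in> carrier P" "\<mu> \<in> carrier K"
    by (rule B_cases)
  then show "\<exists>y\<in>carrier B. y \<oplus>\<^bsub>B\<^esub> x = \<zero>\<^bsub>B\<^esub>"
    by (intro bexI[of _ "(\<ominus>\<^bsub>C\<^esub> c, \<ominus>\<^bsub>P\<^esub> p, \<ominus>\<^bsub>K\<^esub> \<mu>)"])
      (simp_all add: C.M.l_neg P.M.l_neg C.K.l_neg)
qed (auto simp: P.M.a_ac C.M.a_ac C.K.a_ac elim!: B_cases)

lemma ring_B: "ring B"
proof (rule ringI[OF abelian_group_B])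
  show "monoid B"
  proof (rule monoidI)
    fix x y z assume "x \<in> carrier B" "y \<in> carrier B" "z \<in> carrier B"
    then obtain c p \<mu> c' p' \<mu>' c'' p'' \<mu>'' where
      "x = (c, p, \<mu>)" "c \<in> carrier C" "p \<in> carrier P" "\<mu> \<in> carrier K"
      "y = (c', p', \<mu>')" "c' \<in> carrier C" "p' \<in> carrier P" "\<mu>' \<in> carrier K"
      "z = (c'', p'', \<mu>'')" "c'' \<in> carrier C" "p'' \<in> carrier P" "\<mu>'' \<in> carrier K"
      by (metis B_cases)
    then show "x \<otimes>\<^bsub>B\<^esub> y \<otimes>\<^bsub>B\<^esub> z = x \<otimes>\<^bsub>B\<^esub> (y \<otimes>\<^bsub>B\<^esub> z)"
      by (simp add: P.ract_closed C.A.m_assoc C.K.m_assoc P.ract_add_left P.ract_assoc[of p c' c'']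
        P.M.a_assoc P_scalar P_scalar_commute[of p' \<mu> c''] P_scalar_commute2[of p'' \<mu> \<mu>'])
  qed (auto simp: P.ract_closed P.ract_zero_left P.ract_one scalar_zero_one elim!: B_cases)
qed (auto simp: P.ract_closed P.ract_add_left P.ract_add_right P_scalar P.M.a_ac C.A.l_distr C.A.r_distr
    C.K.l_distr C.K.r_distr elim!: B_cases)

lemma k_algebra_B: "k_algebra K B"
proof -
  have "module K B"
  proof (rule moduleI[OF C.K.is_cring abelian_group_B])
    fix t u x assume tu: "t \<in> carrier K" "u \<in> carrier K" and "x \<in> carrier B"
    then obtain c p \<mu> where x: "x = (c, p, \<mu>)" "c \<in> carrier C" "p \<in> carrier P" "\<mu> \<in> carrier K"
      by (metis B_cases)
    show "(t \<oplus>\<^bsub>K\<^esub> u) \<odot>\<^bsub>B\<^esub> x = t \<odot>\<^bsub>B\<^esub> x \<oplus>\<^bsub>B\<^esub> u \<odot>\<^bsub>B\<^esub> x"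
      using P_scalar(1)[OF x(3) tu] C.smult_l_distr[OF tu x(2)] C.K.l_distr[OF tu x(4)] by (simp add: x(1))
    show "(t \<otimes>\<^bsub>K\<^esub> u) \<odot>\<^bsub>B\<^esub> x = t \<odot>\<^bsub>B\<^esub> (u \<odot>\<^bsub>B\<^esub> x)"
      using P_scalar(2)[OF x(3) tu] P_scalar_commute2[OF x(3) tu] C.smult_assoc1[OF tu x(2)] C.K.m_assoc[OF tu x(4)]
      by (simp add: x(1))
  qed (auto simp: P.ract_closed C.smult_closed C.smult_r_distr P.ract_add_left C.K.r_distr P.ract_one scalar_zero_one
      C.smult_one elim!: B_cases)
  moreover have "(t \<odot>\<^bsub>B\<^esub> x) \<otimes>\<^bsub>B\<^esub> y = t \<odot>\<^bsub>B\<^esub> (x \<otimes>\<^bsub>B\<^esub> y) \<and> x \<otimes>\<^bsub>B\<^esub> (t \<odot>\<^bsub>B\<^esub> y) = t \<odot>\<^bsub>B\<^esub> (x \<otimes>\<^bsub>B\<^esub> y)"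
    if t: "t \<in> carrier K" and xy: "x \<in> carrier B" "y \<in> carrier B" for t x y
  proof -
    obtain c p \<mu> c' p' \<mu>' where "x = (c, p, \<mu>)" "c \<in> carrier C" "p \<in> carrier P" "\<mu> \<in> carrier K"
      "y = (c', p', \<mu>')" "c' \<in> carrier C" "p' \<in> carrier P" "\<mu>' \<in> carrier K"
      using xy by (metis B_cases)
    with t show ?thesis
      by (simp add: P.ract_closed C.smult_mult_left C.smult_mult_right C.K.m_ac P.ract_add_left P_scalar
        P_scalar_commute[of p t c'] P_smult[of p t c'] P_scalar_commute2[of p' t \<mu>])
  qed
  ultimately show ?thesis
    unfolding k_algebra_def k_algebra_axioms_def using C.field_K ring_B by simp
qed

sublocale B0: k_algebra K B
  by (rule k_algebra_B)

lemma B_scalar: "t \<in> carrier K \<Longrightarrow> t \<odot>\<^bsub>B\<^esub> \<one>\<^bsub>B\<^esub> = (t \<odot>\<^bsub>C\<^esub> \<one>\<^bsub>C\<^esub>, \<zero>\<^bsub>P\<^esub>, t)"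
  by (simp add: P.ract_zero_left)

lemma fin_gen_B: "fin_gen K (scalars B (regular_bimod B))"
proof -
  let ?UC = "scalars C (regular_bimod C)" and ?UP = "scalars C P" and ?UB = "scalars B (regular_bimod B)"
  note m = C.right_module_scalars[OF right_module_regular[OF C.ring_A]] C.right_module_scalars[OF P.right_module_axioms]
    B0.right_module_scalars[OF right_module_regular[OF ring_B]]
  obtain S where S: "finite S" "S \<subseteq> carrier ?UC" "carrier ?UC \<subseteq> rhull K ?UC S"
    using C.fin_gen_scalars by (auto simp: fin_gen_iff[OF m(1)])
  obtain S' where S': "finite S'" "S' \<subseteq> carrier ?UP" "carrier ?UP \<subseteq> rhull K ?UP S'"
    using C.finite_dim_module_rhull[OF C.fin_gen_scalars P.right_module_axioms dbproj_fin_gen[OF dbproj_P]] by auto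
  let ?f = "\<lambda>c\<in>carrier ?UC. (c, \<zero>\<^bsub>P\<^esub>, \<zero>\<^bsub>K\<^esub>)" and ?g = "\<lambda>p\<in>carrier ?UP. (\<zero>\<^bsub>C\<^esub>, p, \<zero>\<^bsub>K\<^esub>)"
  have f: "?f \<in> rhom K ?UC ?UB"
    by (rule rhomI[OF _ _ _ m(1)]) (simp_all add: P.ract_zero_left)
  have g: "?g \<in> rhom K ?UP ?UB"
    by (rule rhomI[OF _ _ _ m(2)])
      (simp_all add: P.ract_zero_left P.ract_zero_right P.ract_closed scalar_zero_one)
  \<comment> \<open>Images of spanning sets of \<open>C\<close> and \<open>P\<close> in their matrix
    entries, and the unit of the corner.\<close>
  let ?T = "?f ` S \<union> ?g ` S' \<union> {(\<zero>\<^bsub>C\<^esub>, \<zero>\<^bsub>P\<^esub>, \<one>\<^bsub>K\<^esub>)}"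
  have T: "?T \<subseteq> carrier ?UB" using S(2) S'(2) rhom_closed[OF f] rhom_closed[OF g] by auto
  have "x \<in> rhull K ?UB ?T" if xB: "x \<in> carrier B" for x
  proof -
    obtain c p \<mu> where x: "x = (c, p, \<mu>)" "c \<in> carrier C" "p \<in> carrier P" "\<mu> \<in> carrier K"
      using xB by (rule B_cases)
    have "?f c \<in> rhull K ?UB ?T"
      using S(3) x(2) by (intro rhom_rhull[OF f _ m(1,3) S(2)]) auto
    moreover have "?g p \<in> rhull K ?UB ?T"
      using S'(3) x(3) by (intro rhom_rhull[OF g _ m(2,3) S'(2)]) auto
    moreover have "ract ?UB (\<zero>\<^bsub>C\<^esub>, \<zero>\<^bsub>P\<^esub>, \<one>\<^bsub>K\<^esub>) \<mu> \<in> rhull K ?UB ?T"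
      by (rule rhull_ract[OF rhull_inc[OF _ m(3) T] x(4) m(3) T]) simp
    ultimately have "?f c \<oplus>\<^bsub>?UB\<^esub> (?g p \<oplus>\<^bsub>?UB\<^esub> ract ?UB (\<zero>\<^bsub>C\<^esub>, \<zero>\<^bsub>P\<^esub>, \<one>\<^bsub>K\<^esub>) \<mu>) \<in> rhull K ?UB ?T"
      by (intro rhull_plus[OF _ _ m(3) T])
    then show ?thesis using x by (simp add: P.ract_zero_left)
  qed
  then show ?thesis
    using T S(1) S'(1) by (subst fin_gen_iff[OF m(3)]) (intro exI[of _ ?T], auto)
qed

sublocale B: fd_algebra K B
  by (rule fd_algebra.intro[OF k_algebra_B]) (rule fd_algebra_axioms.intro[OF fin_gen_B])

text \<open>The matrices are triangular, so diagonal entries multiply independently. Through the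
  first entry \<open>C\<close>-modules become \<open>B\<close>-modules; the last one makes the field
  the simple module at the new vertex.\<close>

lemma fst_hom: "fst \<in> ring_hom B C"
  by (rule ring_hom_memI) (auto elim!: B_cases)

lemma snd_snd_hom: "(\<lambda>b. snd (snd b)) \<in> ring_hom B K"
  by (rule ring_hom_memI) (auto elim!: B_cases)

abbreviation infl :: "('a, 'v, 'w) rmodule_scheme \<Rightarrow> ('a \<times> 'm \<times> 'k, 'v) rmodule" where
  "infl M \<equiv> restrict_scalars fst M"

lemma right_module_infl: "right_module C M \<Longrightarrow> right_module B (infl M)"
  by (rule right_module_restrict_scalars[OF fst_hom ring_B])

lemma rhom_infl: "f \<in> rhom C M N \<Longrightarrow> f \<in> rhom B (infl M) (infl N)"
  by (rule rhom_restrict_scalars[OF fst_hom])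

text \<open>The map from \<open>c\<close> to \<open>(c, 0, 0)\<close> is right
  \<open>B\<close>-linear, since \<open>(c, 0, 0)\<close> annihilates the second row of any matrix
  on its right. It turns functionals with values in \<open>C\<close> into functionals with values in
  \<open>B\<close>; this is the projectivity of \<open>C\<close> over \<open>B\<close> at the level
  of dual bases.\<close>

lemma frank_infl:
  assumes "f \<in> frank C M N" and M: "right_module C M"
  shows "f \<in> frank B (infl M) (infl N)"
  using assms(1)
proof induction
  case zero
  show ?case using frank.zero[where M="infl M" and N="infl N" and R=B] by (simp only: restrict_scalars_simps)
next
  case (add n \<xi> f)
  let ?\<xi> = "\<lambda>x\<in>carrier (infl M). (\<xi> x, \<zero>\<^bsub>P\<^esub>, \<zero>\<^bsub>K\<^esub>)"
  have c: "\<xi> x \<in> carrier C" if "x \<in> carrier M" for x using rhom_closed[OF add(2) that] by simp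
  have \<xi>: "?\<xi> \<in> rhom B (infl M) (regular_bimod B)"
    by (rule rhomI[OF _ _ _ right_module_infl[OF M]])
      (auto simp: c rhom_add[OF add(2)] rhom_ract[OF add(2)] P.ract_zero_left P.ract_zero_right P.ract_closed
        scalar_zero_one elim!: B_cases)
  have "n \<in> carrier (infl N)" using add(1) by simp
  from frank.add[OF this \<xi> add(4)]
  have "(\<lambda>x\<in>carrier (infl M). ract (infl N) n (?\<xi> x) \<oplus>\<^bsub>infl N\<^esub> f x) \<in> frank B (infl M) (infl N)" .
  moreover have "(\<lambda>x\<in>carrier (infl M). ract (infl N) n (?\<xi> x) \<oplus>\<^bsub>infl N\<^esub> f x) =
      (\<lambda>x\<in>carrier M. ract N n (\<xi> x) \<oplus>\<^bsub>N\<^esub> f x)"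
    by (auto intro!: restrict_ext)
  ultimately show ?case by (simp only:)
qed

lemma dbproj_infl: "dbproj C M \<Longrightarrow> dbproj B (infl M)"
  unfolding dbproj_def restrict_scalars_simps using frank_infl right_module_infl by blast

definition infl_res :: "('a, 'v, 'x) resolution \<Rightarrow> ('a \<times> 'm \<times> 'k, 'v, 'x) resolution" where
  "infl_res Q = \<lparr>rterm = (\<lambda>i. infl (rterm Q i)), rdiff = rdiff Q, raug = raug Q\<rparr>"

lemma infl_res_simps [simp]:
  "rterm (infl_res Q) i = infl (rterm Q i)" "rdiff (infl_res Q) = rdiff Q" "raug (infl_res Q) = raug Q"
  by (simp_all add: infl_res_def)

lemma pres_infl:
  assumes Q: "pres C V Q"
  shows "pres B (infl V) (infl_res Q)"
  using right_module_infl[OF pres_target[OF Q]] dbproj_infl[OF pres_dbproj[OF Q]] rhom_infl[OF pres_diff[OF Q]]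
    rhom_infl[OF pres_aug[OF Q]] pres_surj[OF Q] pres_exact[OF Q] pres_exact0[OF Q]
  by (simp add: pres_def)

end

section \<open>Rows at the new vertex and the preimage of \<open>DC\<close> in a projective
  module\<close>

context one_point
begin

abbreviation "DC \<equiv> dual_bimod K C"
abbreviation "DB \<equiv> dual_bimod K B"

definition row :: "'m \<Rightarrow> 'k \<Rightarrow> 'a \<times> 'm \<times> 'k" where
  "row p \<mu> = (\<zero>\<^bsub>C\<^esub>, p, \<mu>)"

lemma row_closed [simp]: "p \<in> carrier P \<Longrightarrow> \<mu> \<in> carrier K \<Longrightarrow> row p \<mu> \<in> carrier B"
  by (simp add: row_def)

text \<open>From the left, a matrix acts on the new row through its corner entry only. Dually,
  \<open>B\<close> acts on the functionals on the row by that scalar, which is why \<open>DB\<close>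
  modulo \<open>DC\<close> is a sum of copies of one simple module.\<close>

lemma mult_row:
  assumes "c \<in> carrier C" "m \<in> carrier P" "\<nu> \<in> carrier K" "p \<in> carrier P" "\<mu> \<in> carrier K"
  shows "(c, m, \<nu>) \<otimes>\<^bsub>B\<^esub> row p \<mu> = \<nu> \<odot>\<^bsub>B\<^esub> row p \<mu>"
    "\<nu> \<odot>\<^bsub>B\<^esub> row p \<mu> = row (ract P p (\<nu> \<odot>\<^bsub>C\<^esub> \<one>\<^bsub>C\<^esub>)) (\<nu> \<otimes>\<^bsub>K\<^esub> \<mu>)"
  using assms by (simp_all add: row_def P.ract_zero_right P.ract_closed C.smult_r_null)

lemma row_mult:
  assumes "p \<in> carrier P" "\<nu> \<in> carrier K" "c \<in> carrier C" "m \<in> carrier P" "\<mu> \<in> carrier K"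
  shows "row p \<nu> \<otimes>\<^bsub>B\<^esub> (c, m, \<mu>) = row (ract P p c \<oplus>\<^bsub>P\<^esub> ract P m (\<nu> \<odot>\<^bsub>C\<^esub> \<one>\<^bsub>C\<^esub>)) (\<nu> \<otimes>\<^bsub>K\<^esub> \<mu>)"
  using assms by (simp add: row_def)

text \<open>The preimage of \<open>DC\<close> under \<open>aug\<close>: as a submodule of
  \<open>DB\<close>, \<open>DC\<close> consists of the functionals that vanish on the rows.\<close>

definition annih :: "(('a \<times> 'm \<times> 'k), 't, 'u) rmodule_scheme \<Rightarrow> ('t \<Rightarrow> 'a \<times> 'm \<times> 'k \<Rightarrow> 'k) \<Rightarrow> 't set" where
  "annih T aug = {t \<in> carrier T. \<forall>p\<in>carrier P. \<forall>\<mu>\<in>carrier K. aug t (row p \<mu>) = \<zero>\<^bsub>K\<^esub>}"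

lemma aug_ract:
  assumes "aug \<in> rhom B T DB" "t \<in> carrier T" "b \<in> carrier B" "y \<in> carrier B"
  shows "aug (ract T t b) y = aug t (b \<otimes>\<^bsub>B\<^esub> y)"
  using assms rhom_ract[OF assms(1,2,3)] by simp

lemma aug_add:
  assumes "aug \<in> rhom B T DB" "t \<in> carrier T" "t' \<in> carrier T" "y \<in> carrier B"
  shows "aug (t \<oplus>\<^bsub>T\<^esub> t') y = aug t y \<oplus>\<^bsub>K\<^esub> aug t' y"
  using assms rhom_add[OF assms(1,2,3)] by simp

lemma annih_submod:
  assumes T: "right_module B T" and aug: "aug \<in> rhom B T DB"
  shows "is_submod B T (annih T aug)"
proof -
  interpret T: right_module B T by fact
  note ag = T.M.abelian_group_axioms right_module_abelian_group[OF B0.right_module_dual]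
  show ?thesis
    unfolding is_submod_def
  proof (intro conjI ballI)
    show "\<zero>\<^bsub>T\<^esub> \<in> annih T aug"
      using rhom_zero[OF aug ag] by (simp add: annih_def del: B_simps)
  next
    fix x y assume "x \<in> annih T aug" "y \<in> annih T aug"
    then show "x \<oplus>\<^bsub>T\<^esub> y \<in> annih T aug"
      by (simp add: annih_def aug_add[OF aug])
  next
    fix x b assume x: "x \<in> annih T aug" and b: "b \<in> carrier B"
    obtain c m \<nu> where b': "b = (c, m, \<nu>)" "c \<in> carrier C" "m \<in> carrier P" "\<nu> \<in> carrier K"
      using b by (rule B_cases)
    have xT: "x \<in> carrier T" using x by (simp add: annih_def)
    have "aug (ract T x b) (row p \<mu>) = \<zero>\<^bsub>K\<^esub>" if "p \<in> carrier P" "\<mu> \<in> carrier K" for p \<mu>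
      using x that aug_ract[OF aug xT b row_closed[OF that]] mult_row[OF b'(2-4) that] b'
      by (simp add: annih_def P.ract_closed del: B_simps)
    then show "ract T x b \<in> annih T aug"
      using xT b by (simp add: annih_def T.ract_closed)
  qed (auto simp: annih_def)
qed

abbreviation "BK \<equiv> submod (scalars B (regular_bimod B)) (carrier B)"
abbreviation "e0 \<equiv> row \<zero>\<^bsub>P\<^esub> \<one>\<^bsub>K\<^esub>"

lemma e0_mult: "c \<in> carrier C \<Longrightarrow> p \<in> carrier P \<Longrightarrow> \<mu> \<in> carrier K \<Longrightarrow> e0 \<otimes>\<^bsub>B\<^esub> (c, p, \<mu>) = row p \<mu>"
  by (simp add: row_mult P.ract_zero_left scalar_zero_one P.ract_one)

text \<open>By \<open>mult_row\<close>, evaluation at \<open>e0 \<otimes> n\<close> is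
  \<open>B\<close>-linear with values in the simple module at the new vertex. The rows form the
  projective module \<open>e0 B\<close>, which maps onto that simple module by the last entry, and
  projectivity of \<open>T\<close> lifts the evaluation. The entry \<open>p\<close> of the lift
  remains undetermined.\<close>

lemma row_lift:
  assumes T: "dbproj B T" and aug: "aug \<in> rhom B T DB" and n: "n \<in> carrier B"
  shows "\<exists>\<xi> \<in> rhom B T (regular_bimod B). \<forall>t\<in>carrier T. \<exists>p\<in>carrier P. \<xi> t = row p (aug t (e0 \<otimes>\<^bsub>B\<^esub> n))"
proof -
  note T' = dbproj_right_module[OF T]
  interpret T: right_module B T by (rule T')
  let ?J = "{row p \<mu> | p \<mu>. p \<in> carrier P \<and> \<mu> \<in> carrier K}"
  have J: "is_submod B (regular_bimod B) ?J"
    unfolding is_submod_def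
  proof (intro conjI ballI)
    show "?J \<subseteq> carrier (regular_bimod B)" by auto
    show "\<zero>\<^bsub>regular_bimod B\<^esub> \<in> ?J"
      by (simp only: regular_simps B_simps mem_Collect_eq, intro exI[of _ "\<zero>\<^bsub>P\<^esub>"] exI[of _ "\<zero>\<^bsub>K\<^esub>"]) (simp add: row_def)
  next
    fix x y assume "x \<in> ?J" "y \<in> ?J"
    then obtain p \<mu> p' \<mu>' where "x = row p \<mu>" "p \<in> carrier P" "\<mu> \<in> carrier K"
      "y = row p' \<mu>'" "p' \<in> carrier P" "\<mu>' \<in> carrier K" by blast
    then show "x \<oplus>\<^bsub>regular_bimod B\<^esub> y \<in> ?J"
      by (simp only: regular_simps mem_Collect_eq, intro exI[of _ "p \<oplus>\<^bsub>P\<^esub> p'"] exI[of _ "\<mu> \<oplus>\<^bsub>K\<^esub> \<mu>'"]) (simp add: row_def)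
  next
    fix x b assume "x \<in> ?J" and "b \<in> carrier B"
    then obtain p \<mu> c m \<nu> where xb: "x = row p \<mu>" "p \<in> carrier P" "\<mu> \<in> carrier K"
      "b = (c, m, \<nu>)" "c \<in> carrier C" "m \<in> carrier P" "\<nu> \<in> carrier K" by (auto simp: B_carrier)
    then have "x \<otimes>\<^bsub>B\<^esub> b = row (ract P p c \<oplus>\<^bsub>P\<^esub> ract P m (\<mu> \<odot>\<^bsub>C\<^esub> \<one>\<^bsub>C\<^esub>)) (\<mu> \<otimes>\<^bsub>K\<^esub> \<nu>)"
      by (simp add: row_mult del: B_simps)
    moreover have "ract P p c \<oplus>\<^bsub>P\<^esub> ract P m (\<mu> \<odot>\<^bsub>C\<^esub> \<one>\<^bsub>C\<^esub>) \<in> carrier P" "\<mu> \<otimes>\<^bsub>K\<^esub> \<nu> \<in> carrier K"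
      using xb by (simp_all add: P.ract_closed)
    ultimately show "ract (regular_bimod B) x b \<in> ?J" unfolding regular_simps by blast
  qed
  note regB = right_module_regular[OF ring_B]
  \<comment> \<open>\<open>?M\<close> is the module of rows, \<open>?N\<close> the simple module:
    the field with \<open>B\<close> acting through the corner entry.\<close>
  let ?M = "submod (regular_bimod B) ?J" and ?N = "restrict_scalars (\<lambda>b. snd (snd b)) (regular_bimod K)"
  have M: "right_module B ?M" by (rule right_module_submod[OF regB J])
  have N: "right_module B ?N"
    by (rule right_module_restrict_scalars[OF snd_snd_hom ring_B right_module_regular[OF C.ring_K]])
  have g: "(\<lambda>x\<in>carrier ?M. snd (snd x)) \<in> rhom B ?M ?N"
    by (rule rhomI[OF _ _ _ M]) (auto simp: row_def elim!: B_cases)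
  have e0n: "e0 \<otimes>\<^bsub>B\<^esub> n \<in> carrier B" using n by (simp add: del: B_simps)
  obtain c0 p0 \<mu>0 where n': "n = (c0, p0, \<mu>0)" "c0 \<in> carrier C" "p0 \<in> carrier P" "\<mu>0 \<in> carrier K"
    using n by (rule B_cases)
  have e0n': "e0 \<otimes>\<^bsub>B\<^esub> n = row p0 \<mu>0" using n' e0_mult by (simp del: B_simps)
  have augD: "aug t \<in> carrier DB" if "t \<in> carrier T" for t by (rule rhom_closed[OF aug that])
  have h: "(\<lambda>t\<in>carrier T. aug t (e0 \<otimes>\<^bsub>B\<^esub> n)) \<in> rhom B T ?N"
  proof (rule rhomI[OF _ _ _ T'])
    fix t b assume t: "t \<in> carrier T" and b: "b \<in> carrier B"
    obtain c m \<nu> where b': "b = (c, m, \<nu>)" "c \<in> carrier C" "m \<in> carrier P" "\<nu> \<in> carrier K"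
      using b by (rule B_cases)
    have "aug (ract T t b) (row p0 \<mu>0) = aug t (\<nu> \<odot>\<^bsub>B\<^esub> row p0 \<mu>0)"
      using aug_ract[OF aug t b row_closed[OF n'(3,4)]] mult_row(1)[OF b'(2-4) n'(3,4)] b'(1) by simp
    also have "\<dots> = aug t (row p0 \<mu>0) \<otimes>\<^bsub>K\<^esub> \<nu>"
      using dual_smult[OF augD[OF t] b'(4) row_closed[OF n'(3,4)]] dual_closed[OF augD[OF t] row_closed[OF n'(3,4)]] b'(4)
      by (simp add: C.K.m_comm del: B_simps)
    finally show "aug (ract T t b) (e0 \<otimes>\<^bsub>B\<^esub> n) = ract ?N (aug t (e0 \<otimes>\<^bsub>B\<^esub> n)) b"
      by (simp add: e0n' b'(1) del: B_simps)
  qed (use e0n in \<open>simp_all add: dual_closed[OF augD] aug_add[OF aug] del: B_simps\<close>)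
  have im: "(\<lambda>t\<in>carrier T. aug t (e0 \<otimes>\<^bsub>B\<^esub> n)) ` carrier T \<subseteq> (\<lambda>x\<in>carrier ?M. snd (snd x)) ` carrier ?M"
  proof (rule image_subsetI)
    fix t assume t: "t \<in> carrier T"
    have \<mu>: "aug t (e0 \<otimes>\<^bsub>B\<^esub> n) \<in> carrier K" by (rule dual_closed[OF augD[OF t] e0n])
    have "row \<zero>\<^bsub>P\<^esub> (aug t (e0 \<otimes>\<^bsub>B\<^esub> n)) \<in> carrier ?M"
      using \<mu> P.M.zero_closed unfolding submod_simps by blast
    then show "(\<lambda>t\<in>carrier T. aug t (e0 \<otimes>\<^bsub>B\<^esub> n)) t \<in> (\<lambda>x\<in>carrier ?M. snd (snd x)) ` carrier ?M"
      unfolding restrict_apply'[OF t]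
      by (intro image_eqI[of _ _ "row \<zero>\<^bsub>P\<^esub> (aug t (e0 \<otimes>\<^bsub>B\<^esub> n))"]) (simp_all add: row_def del: B_simps)
  qed
  obtain l where l: "l \<in> rhom B T ?M" "\<And>t. t \<in> carrier T \<Longrightarrow>
      (\<lambda>x\<in>carrier ?M. snd (snd x)) (l t) = (\<lambda>t\<in>carrier T. aug t (e0 \<otimes>\<^bsub>B\<^esub> n)) t"
    using dbproj_lift[OF T g h im M N] by blast
  have "l \<in> rhom B T (regular_bimod B)"
    using rhom_from_submod_extend[OF l(1)] J by (simp add: is_submod_def)
  moreover have "\<exists>p\<in>carrier P. l t = row p (aug t (e0 \<otimes>\<^bsub>B\<^esub> n))" if t: "t \<in> carrier T" for t
  proof -
    have lt: "l t \<in> carrier ?M" by (rule rhom_closed[OF l(1) t])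
    then obtain p \<mu> where p: "l t = row p \<mu>" "p \<in> carrier P" by auto
    have "snd (snd (l t)) = aug t (e0 \<otimes>\<^bsub>B\<^esub> n)"
      using l(2)[OF t] unfolding restrict_apply'[OF t] restrict_apply'[OF lt] .
    then show ?thesis using p by (auto simp: row_def)
  qed
  ultimately show ?thesis by blast
qed

text \<open>The dual basis \<open>f = \<Sum> n\<^sub>i w\<^sub>i\<close> of \<open>B\<close> over \<open>K\<close> yields an endomorphism \<open>\<rho> = \<Sum> t\<^sub>i \<xi>\<^sub>i\<close> of \<open>T\<close>, where
  \<open>t\<^sub>i\<close> is mapped to \<open>w\<^sub>i\<close> and \<open>\<xi>\<^sub>i\<close> lifts \<open>t \<mapsto> aug t (e\<^sub>0 n\<^sub>i)\<close> through the projective cover of the simple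
  module at the new vertex. On the kernel of \<open>t \<mapsto> aug t\<close> restricted to the new row, \<open>\<xi>\<^sub>i\<close> takes values
  in the projective module \<open>P\<close>.\<close>

lemma annih_correction:
  assumes T: "dbproj B T" and aug: "aug \<in> rhom B T DB" and surj: "aug ` carrier T = carrier DB"
    and "f \<in> frank K BK BK"
  shows "\<exists>\<rho> \<in> rhom B T T.
      (\<forall>t\<in>carrier T. \<forall>p\<in>carrier P. \<forall>\<mu>\<in>carrier K. aug (\<rho> t) (row p \<mu>) = aug t (e0 \<otimes>\<^bsub>B\<^esub> f (row p \<mu>))) \<and>
      restrict \<rho> (annih T aug) \<in> frank B (submod T (annih T aug)) (submod T (annih T aug))"
  using assms(4)
proof induction
  case zero
  note T' = dbproj_right_module[OF T]
  let ?X = "submod T (annih T aug)"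
  have sub: "annih T aug \<subseteq> carrier T" by (auto simp: annih_def)
  let ?z = "\<lambda>t\<in>carrier T. \<zero>\<^bsub>T\<^esub>"
  have "restrict ?z (annih T aug) = (\<lambda>x\<in>carrier ?X. \<zero>\<^bsub>?X\<^esub>)"
    unfolding submod_simps using sub by (intro restrict_ext) auto
  then have "restrict ?z (annih T aug) \<in> frank B ?X ?X"
    using frank.zero[where M="?X" and N="?X" and R=B] by (simp only:)
  moreover have "aug (?z t) (row p \<mu>) = aug t (e0 \<otimes>\<^bsub>B\<^esub> (\<lambda>x\<in>carrier BK. \<zero>\<^bsub>BK\<^esub>) (row p \<mu>))"
    if "t \<in> carrier T" "p \<in> carrier P" "\<mu> \<in> carrier K" for t p \<mu>
  proof -
    have "e0 \<otimes>\<^bsub>B\<^esub> \<zero>\<^bsub>B\<^esub> = \<zero>\<^bsub>B\<^esub>" by (simp del: B_simps)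
    moreover have "aug t \<zero>\<^bsub>B\<^esub> = \<zero>\<^bsub>K\<^esub>" by (rule dual_zero[OF rhom_closed[OF aug that(1)] k_algebra_B])
    moreover have "aug \<zero>\<^bsub>T\<^esub> = \<zero>\<^bsub>DB\<^esub>"
      by (rule rhom_zero[OF aug right_module_abelian_group[OF T'] right_module_abelian_group[OF B0.right_module_dual]])
    ultimately show ?thesis using that by (simp del: B_simps)
  qed
  ultimately show ?case using zero_rhom[OF T' T'] by blast
next
  case (add n w f)
  note T' = dbproj_right_module[OF T]
  interpret T: right_module B T by (rule T')
  let ?N = "annih T aug"
  let ?X = "submod T ?N"
  have sub: "?N \<subseteq> carrier T" by (auto simp: annih_def)
  note X0 = annih_submod[OF T' aug]
  note X = right_module_submod[OF T' X0]
  obtain \<rho> where \<rho>: "\<rho> \<in> rhom B T T"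
    "\<And>t p \<mu>. t \<in> carrier T \<Longrightarrow> p \<in> carrier P \<Longrightarrow> \<mu> \<in> carrier K \<Longrightarrow>
      aug (\<rho> t) (row p \<mu>) = aug t (e0 \<otimes>\<^bsub>B\<^esub> f (row p \<mu>))"
    "restrict \<rho> ?N \<in> frank B ?X ?X"
    using add.IH by blast
  have n: "n \<in> carrier B" using add(1) by simp
  have w: "w \<in> carrier DB" by (rule B0.functional_dual[OF add(2)])
  obtain \<xi> where \<xi>: "\<xi> \<in> rhom B T (regular_bimod B)"
    "\<And>t. t \<in> carrier T \<Longrightarrow> \<exists>p\<in>carrier P. \<xi> t = row p (aug t (e0 \<otimes>\<^bsub>B\<^esub> n))"
    using row_lift[OF T aug n] by blast
  have "w \<in> aug ` carrier T" using surj w by simp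
  then obtain tw where tw: "tw \<in> carrier T" "aug tw = w" by auto
  have BKm: "right_module K BK" by (rule dbproj_right_module[OF B0.finite_dim_identity_frank[OF fin_gen_B]])
  have fc: "f y \<in> carrier B" if "y \<in> carrier B" for y
    using rhom_closed[OF frank_rhom[OF add(3) BKm BKm], of y] that by simp
  have e0: "e0 \<in> carrier B" by simp
  let ?s = "\<lambda>t\<in>carrier T. ract T tw (\<xi> t)"
  have s: "?s \<in> rhom B T T" by (rule scaled_functional_rhom[OF \<xi>(1) T' T' tw(1)])
  let ?\<rho> = "\<lambda>t\<in>carrier T. ?s t \<oplus>\<^bsub>T\<^esub> \<rho> t"
  have \<rho>': "?\<rho> \<in> rhom B T T" by (rule plus_rhom[OF s \<rho>(1) T' T'])
  have eq: "aug (?\<rho> t) (row p \<mu>) = aug t (e0 \<otimes>\<^bsub>B\<^esub> (\<lambda>x\<in>carrier BK. ract BK n (w x) \<oplus>\<^bsub>BK\<^esub> f x) (row p \<mu>))"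
    if t: "t \<in> carrier T" and p: "p \<in> carrier P" and \<mu>: "\<mu> \<in> carrier K" for t p \<mu>
  proof -
    let ?y = "row p \<mu>"
    have y: "?y \<in> carrier B" using p \<mu> by simp
    have wy: "w ?y \<in> carrier K" by (rule dual_closed[OF w y])
    note D = rhom_closed[OF aug t]
    obtain p' where p': "p' \<in> carrier P" "\<xi> t = row p' (aug t (e0 \<otimes>\<^bsub>B\<^esub> n))" using \<xi>(2)[OF t] by blast
    have en: "e0 \<otimes>\<^bsub>B\<^esub> n \<in> carrier B" using e0 n by (rule B0.A.m_closed)
    have \<nu>: "aug t (e0 \<otimes>\<^bsub>B\<^esub> n) \<in> carrier K" by (rule dual_closed[OF D en])
    have \<xi>c: "\<xi> t \<in> carrier B" using rhom_closed[OF \<xi>(1) t] by simp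
    have "aug (ract T tw (\<xi> t)) ?y = w (\<xi> t \<otimes>\<^bsub>B\<^esub> ?y)" using aug_ract[OF aug tw(1) \<xi>c y] tw(2) by simp
    \<comment> \<open>The product with a row sees only the corner of \<open>\<xi> t\<close>, so the
      entry left open by \<open>row_lift\<close> does not enter.\<close>
    also have "\<xi> t \<otimes>\<^bsub>B\<^esub> ?y = aug t (e0 \<otimes>\<^bsub>B\<^esub> n) \<odot>\<^bsub>B\<^esub> ?y"
      using mult_row(1)[OF C.M.zero_closed p'(1) \<nu> p \<mu>] p'(2) by (simp only: row_def[of p'])
    also have "w \<dots> = aug t (e0 \<otimes>\<^bsub>B\<^esub> n) \<otimes>\<^bsub>K\<^esub> w ?y" by (rule dual_smult[OF w \<nu> y])
    also have "\<dots> = w ?y \<otimes>\<^bsub>K\<^esub> aug t (e0 \<otimes>\<^bsub>B\<^esub> n)" by (rule C.K.m_comm[OF \<nu> wy])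
    also have "\<dots> = aug t (w ?y \<odot>\<^bsub>B\<^esub> (e0 \<otimes>\<^bsub>B\<^esub> n))" by (rule dual_smult[OF D wy en, symmetric])
    also have "w ?y \<odot>\<^bsub>B\<^esub> (e0 \<otimes>\<^bsub>B\<^esub> n) = e0 \<otimes>\<^bsub>B\<^esub> (n \<otimes>\<^bsub>B\<^esub> (w ?y \<odot>\<^bsub>B\<^esub> \<one>\<^bsub>B\<^esub>))"
      by (simp only: B0.mult_scalar[OF wy n] B0.smult_mult_right[OF wy e0 n])
    finally have 1: "aug (ract T tw (\<xi> t)) ?y = aug t (e0 \<otimes>\<^bsub>B\<^esub> (n \<otimes>\<^bsub>B\<^esub> (w ?y \<odot>\<^bsub>B\<^esub> \<one>\<^bsub>B\<^esub>)))" .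
    have nw: "n \<otimes>\<^bsub>B\<^esub> (w ?y \<odot>\<^bsub>B\<^esub> \<one>\<^bsub>B\<^esub>) \<in> carrier B" by (rule B0.A.m_closed[OF n B0.scalar_closed[OF wy]])
    have "aug (?\<rho> t) ?y = aug t (e0 \<otimes>\<^bsub>B\<^esub> (n \<otimes>\<^bsub>B\<^esub> (w ?y \<odot>\<^bsub>B\<^esub> \<one>\<^bsub>B\<^esub>))) \<oplus>\<^bsub>K\<^esub> aug t (e0 \<otimes>\<^bsub>B\<^esub> f ?y)"
      unfolding restrict_apply'[OF t] aug_add[OF aug T.ract_closed[OF tw(1) \<xi>c] rhom_closed[OF \<rho>(1) t] y]
        1 \<rho>(2)[OF t p \<mu>] by (rule refl)
    also have "\<dots> = aug t (e0 \<otimes>\<^bsub>B\<^esub> (n \<otimes>\<^bsub>B\<^esub> (w ?y \<odot>\<^bsub>B\<^esub> \<one>\<^bsub>B\<^esub>) \<oplus>\<^bsub>B\<^esub> f ?y))"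
      using dual_add[OF D B0.A.m_closed[OF e0 nw] B0.A.m_closed[OF e0 fc[OF y]]] B0.A.r_distr[OF nw fc[OF y] e0] by simp
    finally show ?thesis using y by (simp del: B_simps)
  qed
  \<comment> \<open>The element \<open>tw\<close> need not lie in \<open>annih\<close>, so
    \<open>?s\<close> is not visibly a finite rank map of \<open>annih\<close> into itself. But
    there \<open>\<xi>\<close> has values \<open>(0, p, 0)\<close>, and \<open>tw\<close> times such
    a row does lie in \<open>annih\<close>. The restriction of \<open>?s\<close> thus factors as
    \<open>?k\<close> after \<open>?\<xi>\<close> through the projective module
    \<open>infl P\<close>.\<close>
  let ?k = "\<lambda>p\<in>carrier (infl P). ract T tw (row p \<zero>\<^bsub>K\<^esub>)"
  have k: "?k \<in> rhom B (infl P) ?X"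
  proof (rule rhomI[OF _ _ _ right_module_infl[OF P.right_module_axioms]])
    fix p assume "p \<in> carrier (infl P)"
    then have p: "p \<in> carrier P" by simp
    have "aug (ract T tw (row p \<zero>\<^bsub>K\<^esub>)) (row p' \<mu>) = \<zero>\<^bsub>K\<^esub>" if "p' \<in> carrier P" "\<mu> \<in> carrier K" for p' \<mu>
    proof -
      have "row p \<zero>\<^bsub>K\<^esub> \<otimes>\<^bsub>B\<^esub> row p' \<mu> = \<zero>\<^bsub>B\<^esub>"
        using p that by (simp add: row_def P.ract_zero_right scalar_zero_one)
      then show ?thesis
        using aug_ract[OF aug tw(1), of "row p \<zero>\<^bsub>K\<^esub>" "row p' \<mu>"] p that dual_zero[OF rhom_closed[OF aug tw(1)] k_algebra_B]
        by (simp del: B_simps)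
    qed
    then show "ract T tw (row p \<zero>\<^bsub>K\<^esub>) \<in> carrier ?X"
      using p tw(1) by (simp add: annih_def T.ract_closed)
    fix p'' assume "p'' \<in> carrier (infl P)"
    then have p'': "p'' \<in> carrier P" by simp
    have "row (p \<oplus>\<^bsub>P\<^esub> p'') \<zero>\<^bsub>K\<^esub> = row p \<zero>\<^bsub>K\<^esub> \<oplus>\<^bsub>B\<^esub> row p'' \<zero>\<^bsub>K\<^esub>" by (simp add: row_def)
    then show "ract T tw (row (p \<oplus>\<^bsub>infl P\<^esub> p'') \<zero>\<^bsub>K\<^esub>) = ract T tw (row p \<zero>\<^bsub>K\<^esub>) \<oplus>\<^bsub>?X\<^esub> ract T tw (row p'' \<zero>\<^bsub>K\<^esub>)"
      using p p'' tw(1) by (simp add: T.ract_add_right del: B_simps)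
  next
    fix p b assume "p \<in> carrier (infl P)" and b: "b \<in> carrier B"
    then have p: "p \<in> carrier P" by simp
    obtain c m \<nu> where b': "b = (c, m, \<nu>)" "c \<in> carrier C" "m \<in> carrier P" "\<nu> \<in> carrier K"
      using b by (rule B_cases)
    have "row (ract P p c) \<zero>\<^bsub>K\<^esub> = row p \<zero>\<^bsub>K\<^esub> \<otimes>\<^bsub>B\<^esub> b"
      using p b' by (simp add: row_mult scalar_zero_one P.ract_zero_right P.ract_closed del: B_simps)
    then show "ract T tw (row (ract (infl P) p b) \<zero>\<^bsub>K\<^esub>) = ract ?X (ract T tw (row p \<zero>\<^bsub>K\<^esub>)) b"
      using p b b' tw(1) T.ract_assoc[of tw "row p \<zero>\<^bsub>K\<^esub>" b] by (simp del: B_simps B_mem)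
  qed
  have \<xi>0: "\<exists>p\<in>carrier P. \<xi> t = row p \<zero>\<^bsub>K\<^esub>" if t: "t \<in> ?N" for t
  proof -
    obtain c0 p0 \<mu>0 where n': "n = (c0, p0, \<mu>0)" "c0 \<in> carrier C" "p0 \<in> carrier P" "\<mu>0 \<in> carrier K"
      using n by (rule B_cases)
    have "aug t (e0 \<otimes>\<^bsub>B\<^esub> n) = \<zero>\<^bsub>K\<^esub>"
      using t e0_mult[OF n'(2-4)] n' by (simp add: annih_def del: B_simps)
    then show ?thesis using \<xi>(2)[of t] t sub by auto
  qed
  let ?\<xi> = "\<lambda>t\<in>carrier ?X. fst (snd (\<xi> t))"
  have \<xi>': "?\<xi> \<in> rhom B ?X (infl P)"
  proof (rule rhomI[OF _ _ _ X])
    fix t assume "t \<in> carrier ?X"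
    then have t: "t \<in> ?N" "t \<in> carrier T" using sub by auto
    obtain p where p: "p \<in> carrier P" "\<xi> t = row p \<zero>\<^bsub>K\<^esub>" using \<xi>0[OF t(1)] by blast
    show "fst (snd (\<xi> t)) \<in> carrier (infl P)" using p by (simp add: row_def)
    show "fst (snd (\<xi> (ract ?X t b))) = ract (infl P) (fst (snd (\<xi> t))) b" if b: "b \<in> carrier B" for b
    proof -
      obtain c m \<nu> where b': "b = (c, m, \<nu>)" "c \<in> carrier C" "m \<in> carrier P" "\<nu> \<in> carrier K"
        using b by (rule B_cases)
      show ?thesis
        using rhom_ract[OF \<xi>(1) t(2) b] p b' by (simp add: row_def scalar_zero_one P.ract_zero_right P.ract_closed)
    qed
    fix t' assume "t' \<in> carrier ?X"
    then have t': "t' \<in> ?N" "t' \<in> carrier T" using sub by auto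
    obtain p' where p': "p' \<in> carrier P" "\<xi> t' = row p' \<zero>\<^bsub>K\<^esub>" using \<xi>0[OF t'(1)] by blast
    show "fst (snd (\<xi> (t \<oplus>\<^bsub>?X\<^esub> t'))) = fst (snd (\<xi> t)) \<oplus>\<^bsub>infl P\<^esub> fst (snd (\<xi> t'))"
      using rhom_add[OF \<xi>(1) t(2) t'(2)] p p' by (simp add: row_def)
  qed
  have LP: "dbproj B (infl P)" by (rule dbproj_infl[OF dbproj_P])
  note LP' = dbproj_right_module[OF LP]
  have "compose (carrier ?X) (compose (carrier (infl P)) ?k (\<lambda>x\<in>carrier (infl P). x)) ?\<xi> \<in> frank B ?X ?X"
    by (rule frank_compose_right[OF frank_compose_left[OF _ k LP' LP' X] \<xi>' X]) (use LP in \<open>simp only: dbproj_def\<close>)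
  from frank_plus[OF this \<rho>(3) X X]
  have "(\<lambda>x\<in>carrier ?X. compose (carrier ?X) (compose (carrier (infl P)) ?k (\<lambda>x\<in>carrier (infl P). x)) ?\<xi> x
      \<oplus>\<^bsub>?X\<^esub> restrict \<rho> ?N x) \<in> frank B ?X ?X" .
  moreover have "(\<lambda>x\<in>carrier ?X. compose (carrier ?X) (compose (carrier (infl P)) ?k (\<lambda>x\<in>carrier (infl P). x)) ?\<xi> x
      \<oplus>\<^bsub>?X\<^esub> restrict \<rho> ?N x) = restrict ?\<rho> ?N"
    unfolding submod_simps
  proof (rule restrict_ext)
    fix t assume t: "t \<in> ?N"
    then have t': "t \<in> carrier T" using sub by auto
    obtain p where p: "p \<in> carrier P" "\<xi> t = row p \<zero>\<^bsub>K\<^esub>" using \<xi>0[OF t] by blast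
    have "fst (snd (\<xi> t)) = p" using p by (simp add: row_def)
    then show "compose ?N (compose (carrier (infl P)) ?k (\<lambda>x\<in>carrier (infl P). x)) (\<lambda>t\<in>?N. fst (snd (\<xi> t))) t
      \<oplus>\<^bsub>T\<^esub> restrict \<rho> ?N t = ?\<rho> t"
      using t t' p by (simp add: compose_def)
  qed
  ultimately have "restrict ?\<rho> ?N \<in> frank B ?X ?X" by (simp only:)
  then show ?case using \<rho>' eq by blast
qed

text \<open>For \<open>f\<close> the identity, \<open>\<rho> t\<close> and \<open>t\<close> have
  augmentations that agree on rows, so \<open>r = id - \<rho>\<close> maps all of \<open>T\<close>
  into \<open>annih\<close>. The identity of \<open>annih\<close> is the restriction of
  \<open>r\<close>, which factors through \<open>T\<close>, plus the restriction of
  \<open>\<rho>\<close>, which has finite rank by \<open>annih_correction\<close>.\<close>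

lemma dbproj_annih:
  assumes T: "dbproj B T" and aug: "aug \<in> rhom B T DB" and surj: "aug ` carrier T = carrier DB"
  shows "dbproj B (submod T (annih T aug))"
proof -
  note T' = dbproj_right_module[OF T]
  interpret T: right_module B T by (rule T')
  let ?N = "annih T aug"
  let ?X = "submod T ?N"
  have sub: "?N \<subseteq> carrier T" by (auto simp: annih_def)
  note X0 = annih_submod[OF T' aug]
  note X = right_module_submod[OF T' X0]
  have BK: "dbproj K BK" by (rule B0.finite_dim_identity_frank[OF fin_gen_B])
  have "(\<lambda>x\<in>carrier BK. x) \<in> frank K BK BK" using BK unfolding dbproj_def by blast
  from annih_correction[OF T aug surj this]
  obtain \<rho> where \<rho>: "\<rho> \<in> rhom B T T"
    "\<And>t p \<mu>. t \<in> carrier T \<Longrightarrow> p \<in> carrier P \<Longrightarrow> \<mu> \<in> carrier K \<Longrightarrow>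
      aug (\<rho> t) (row p \<mu>) = aug t (e0 \<otimes>\<^bsub>B\<^esub> (\<lambda>x\<in>carrier BK. x) (row p \<mu>))"
    "restrict \<rho> ?N \<in> frank B ?X ?X"
    by blast
  define r where "r = (\<lambda>t\<in>carrier T. (\<lambda>t\<in>carrier T. t) t \<ominus>\<^bsub>T\<^esub> \<rho> t)"
  have rT: "r \<in> rhom B T T" unfolding r_def by (rule diff_rhom[OF id_rhom[OF T'] \<rho>(1) T' T'])
  have "r t \<in> ?N" if t: "t \<in> carrier T" for t
  proof -
    have "aug (r t) (row p \<mu>) = \<zero>\<^bsub>K\<^esub>" if p: "p \<in> carrier P" and \<mu>: "\<mu> \<in> carrier K" for p \<mu>
    proof -
      have y: "row p \<mu> \<in> carrier B" using p \<mu> by simp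
      have "e0 \<otimes>\<^bsub>B\<^esub> row p \<mu> = row p \<mu>" using e0_mult[OF C.M.zero_closed p \<mu>] by (simp only: row_def[of p])
      then have "aug (\<rho> t) (row p \<mu>) = aug t (row p \<mu>)" using \<rho>(2)[OF t p \<mu>] y by (simp del: B_simps)
      moreover have "aug t (row p \<mu>) = aug (r t) (row p \<mu>) \<oplus>\<^bsub>K\<^esub> aug (\<rho> t) (row p \<mu>)"
      proof -
        have "r t \<oplus>\<^bsub>T\<^esub> \<rho> t = t"
          using t rhom_closed[OF \<rho>(1) t] by (simp add: r_def a_minus_def T.M.a_assoc T.M.l_neg)
        then show ?thesis using aug_add[OF aug rhom_closed[OF rT t] rhom_closed[OF \<rho>(1) t] y] by simp
      qed
      ultimately show ?thesis
        using dual_closed[OF rhom_closed[OF aug t] y] dual_closed[OF rhom_closed[OF aug rhom_closed[OF rT t]] y]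
        by (metis C.K.add.r_cancel_one')
    qed
    then show ?thesis using rhom_closed[OF rT t] by (simp add: annih_def)
  qed
  then have r: "r \<in> rhom B T ?X" by (intro corestrict_rhom[OF rT]) blast
  have "compose (carrier ?X) (compose (carrier T) r (\<lambda>x\<in>carrier T. x)) (\<lambda>x\<in>?N. x) \<in> frank B ?X ?X"
    by (rule frank_compose_right[OF frank_compose_left[OF _ r T' T' X] incl_rhom[OF T' X0] X])
      (use T in \<open>simp only: dbproj_def\<close>)
  from frank_plus[OF this \<rho>(3) X X]
  have "(\<lambda>x\<in>carrier ?X. compose (carrier ?X) (compose (carrier T) r (\<lambda>x\<in>carrier T. x)) (\<lambda>x\<in>?N. x) x
      \<oplus>\<^bsub>?X\<^esub> restrict \<rho> ?N x) \<in> frank B ?X ?X" .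
  moreover have "(\<lambda>x\<in>carrier ?X. compose (carrier ?X) (compose (carrier T) r (\<lambda>x\<in>carrier T. x)) (\<lambda>x\<in>?N. x) x
      \<oplus>\<^bsub>?X\<^esub> restrict \<rho> ?N x) = (\<lambda>x\<in>carrier ?X. x)"
    unfolding submod_simps
  proof (rule restrict_ext)
    fix t assume t: "t \<in> ?N"
    then have t': "t \<in> carrier T" using sub by auto
    show "compose ?N (compose (carrier T) r (\<lambda>x\<in>carrier T. x)) (\<lambda>x\<in>?N. x) t \<oplus>\<^bsub>T\<^esub> restrict \<rho> ?N t = t"
      using t t' rhom_closed[OF \<rho>(1) t'] by (simp add: compose_def r_def a_minus_def T.M.a_assoc T.M.l_neg)
  qed
  ultimately have "(\<lambda>x\<in>carrier ?X. x) \<in> frank B ?X ?X" by (simp only:)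
  then show ?thesis using X unfolding dbproj_def by blast
qed

end

section \<open>Truncation of a resolution of \<open>DB\<close> to a resolution of
  \<open>DC\<close>\<close>

context one_point
begin

text \<open>The augmentation keeps the values of a functional on \<open>(c, 0, 0)\<close>. On
  \<open>annih\<close> this forgets nothing, since there the functionals vanish on the rows.\<close>

definition trunc :: "(('a \<times> 'm \<times> 'k), 't, 'a \<times> 'm \<times> 'k \<Rightarrow> 'k) resolution \<Rightarrow> (('a \<times> 'm \<times> 'k), 't, 'a \<Rightarrow> 'k) resolution"
  where
  "trunc T = \<lparr>rterm = (rterm T)(0 := submod (rterm T 0) (annih (rterm T 0) (raug T))), rdiff = rdiff T,
     raug = (\<lambda>t\<in>annih (rterm T 0) (raug T). \<lambda>c\<in>carrier C. raug T t (c, \<zero>\<^bsub>P\<^esub>, \<zero>\<^bsub>K\<^esub>))\<rparr>"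

lemma trunc_simps [simp]:
  "rterm (trunc T) 0 = submod (rterm T 0) (annih (rterm T 0) (raug T))"
  "i \<noteq> 0 \<Longrightarrow> rterm (trunc T) i = rterm T i" "rdiff (trunc T) = rdiff T"
  "raug (trunc T) = (\<lambda>t\<in>annih (rterm T 0) (raug T). \<lambda>c\<in>carrier C. raug T t (c, \<zero>\<^bsub>P\<^esub>, \<zero>\<^bsub>K\<^esub>))"
  by (simp_all add: trunc_def)

text \<open>The embedding of \<open>DC\<close> into \<open>DB\<close> dual to the surjection
  \<open>fst\<close>.\<close>

definition \<iota> :: "('a \<Rightarrow> 'k) \<Rightarrow> 'a \<times> 'm \<times> 'k \<Rightarrow> 'k" where
  "\<iota> \<theta> = (\<lambda>x\<in>carrier B. \<theta> (fst x))"

lemma \<iota>_closed: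
  assumes "\<theta> \<in> carrier DC"
  shows "\<iota> \<theta> \<in> carrier DB"
  unfolding \<iota>_def
  by (rule dualI[OF _ _ _ k_algebra_B])
    (use assms in \<open>auto simp: dual_closed dual_add dual_smult elim!: B_cases\<close>)

lemma row_decomp:
  assumes "\<phi> \<in> carrier DB" "c \<in> carrier C" "p \<in> carrier P" "\<mu> \<in> carrier K"
  shows "\<phi> (c, p, \<mu>) = \<phi> (c, \<zero>\<^bsub>P\<^esub>, \<zero>\<^bsub>K\<^esub>) \<oplus>\<^bsub>K\<^esub> \<phi> (row p \<mu>)"
  using dual_add[OF assms(1), of "(c, \<zero>\<^bsub>P\<^esub>, \<zero>\<^bsub>K\<^esub>)" "row p \<mu>"] assms by (simp add: row_def)

lemma annih_raug:
  assumes T: "pres B DB T" and t: "t \<in> annih (rterm T 0) (raug T)"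
  shows "raug T t = \<iota> (raug (trunc T) t)"
proof -
  have D: "raug T t \<in> carrier DB" using t rhom_closed[OF pres_aug[OF T]] by (simp add: annih_def)
  have "raug T t x = raug (trunc T) t (fst x)" if x: "x \<in> carrier B" for x
  proof -
    obtain c p \<mu> where x': "x = (c, p, \<mu>)" "c \<in> carrier C" "p \<in> carrier P" "\<mu> \<in> carrier K"
      using x by (rule B_cases)
    show ?thesis
      using row_decomp[OF D x'(2-4)] x x' t dual_closed[OF D, of "(c, \<zero>\<^bsub>P\<^esub>, \<zero>\<^bsub>K\<^esub>)"] by (simp add: annih_def)
  qed
  then have "(\<lambda>x\<in>carrier B. raug T t x) = \<iota> (raug (trunc T) t)" unfolding \<iota>_def by (rule restrict_ext)
  then show ?thesis using dual_restrict[OF D] by (simp only:)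
qed

lemma trunc_raug_rhom:
  assumes T: "pres B DB T"
  shows "raug (trunc T) \<in> rhom B (rterm (trunc T) 0) (infl DC)"
  unfolding trunc_simps
proof -
  note T0 = pres_term[OF T, of 0] and aug = pres_aug[OF T]
  interpret T0: right_module B "rterm T 0" by (rule T0)
  let ?N = "annih (rterm T 0) (raug T)"
  note X = right_module_submod[OF T0 annih_submod[OF T0 aug]]
  have D: "raug T t \<in> carrier DB" if "t \<in> ?N" for t
    using that rhom_closed[OF aug] by (simp add: annih_def)
  have sub: "t \<in> ?N \<Longrightarrow> t \<in> carrier (rterm T 0)" for t by (simp add: annih_def)
  have "(\<lambda>t\<in>carrier (submod (rterm T 0) ?N). \<lambda>c\<in>carrier C. raug T t (c, \<zero>\<^bsub>P\<^esub>, \<zero>\<^bsub>K\<^esub>)) \<in> rhom B (submod (rterm T 0) ?N) (infl DC)"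
  proof (rule rhomI[OF _ _ _ X])
    fix t assume "t \<in> carrier (submod (rterm T 0) ?N)"
    then have t: "t \<in> ?N" by simp
    note Dt = D[OF t]
    have "(\<lambda>c\<in>carrier C. raug T t (c, \<zero>\<^bsub>P\<^esub>, \<zero>\<^bsub>K\<^esub>)) \<in> carrier DC"
    proof (rule dualI[OF _ _ _ C.k_algebra_axioms])
      fix c c' assume "c \<in> carrier C" "c' \<in> carrier C"
      then show "raug T t (c \<oplus>\<^bsub>C\<^esub> c', \<zero>\<^bsub>P\<^esub>, \<zero>\<^bsub>K\<^esub>) = raug T t (c, \<zero>\<^bsub>P\<^esub>, \<zero>\<^bsub>K\<^esub>) \<oplus>\<^bsub>K\<^esub> raug T t (c', \<zero>\<^bsub>P\<^esub>, \<zero>\<^bsub>K\<^esub>)"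
        using dual_add[OF Dt, of "(c, \<zero>\<^bsub>P\<^esub>, \<zero>\<^bsub>K\<^esub>)" "(c', \<zero>\<^bsub>P\<^esub>, \<zero>\<^bsub>K\<^esub>)"] by simp
    next
      fix s c assume "s \<in> carrier K" "c \<in> carrier C"
      then show "raug T t (s \<odot>\<^bsub>C\<^esub> c, \<zero>\<^bsub>P\<^esub>, \<zero>\<^bsub>K\<^esub>) = s \<otimes>\<^bsub>K\<^esub> raug T t (c, \<zero>\<^bsub>P\<^esub>, \<zero>\<^bsub>K\<^esub>)"
        using dual_smult[OF Dt, of s "(c, \<zero>\<^bsub>P\<^esub>, \<zero>\<^bsub>K\<^esub>)"] by (simp add: P.ract_zero_left)
    qed (simp add: dual_closed[OF Dt])
    then show "(\<lambda>c\<in>carrier C. raug T t (c, \<zero>\<^bsub>P\<^esub>, \<zero>\<^bsub>K\<^esub>)) \<in> carrier (infl DC)" by simp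
    show "(\<lambda>c\<in>carrier C. raug T (ract (submod (rterm T 0) ?N) t b) (c, \<zero>\<^bsub>P\<^esub>, \<zero>\<^bsub>K\<^esub>)) =
        ract (infl DC) (\<lambda>c\<in>carrier C. raug T t (c, \<zero>\<^bsub>P\<^esub>, \<zero>\<^bsub>K\<^esub>)) b" if b: "b \<in> carrier B" for b
    proof -
      obtain c' m \<nu> where b': "b = (c', m, \<nu>)" "c' \<in> carrier C" "m \<in> carrier P" "\<nu> \<in> carrier K"
        using b by (rule B_cases)
      have "raug T (ract (rterm T 0) t b) (c, \<zero>\<^bsub>P\<^esub>, \<zero>\<^bsub>K\<^esub>) = raug T t (c' \<otimes>\<^bsub>C\<^esub> c, \<zero>\<^bsub>P\<^esub>, \<zero>\<^bsub>K\<^esub>)" if c: "c \<in> carrier C" for c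
      proof -
        \<comment> \<open>The product of \<open>b\<close> with \<open>(c, 0, 0)\<close> has the
          extra entry \<open>ract P m c\<close>; it lies in a row, where the functional
          vanishes.\<close>
        have "raug T (ract (rterm T 0) t b) (c, \<zero>\<^bsub>P\<^esub>, \<zero>\<^bsub>K\<^esub>) = raug T t (c' \<otimes>\<^bsub>C\<^esub> c, ract P m c, \<zero>\<^bsub>K\<^esub>)"
          using aug_ract[OF aug sub[OF t] b, of "(c, \<zero>\<^bsub>P\<^esub>, \<zero>\<^bsub>K\<^esub>)"] b' c by (simp add: P.ract_zero_left P.ract_closed)
        then show ?thesis
          using row_decomp[OF Dt, of "c' \<otimes>\<^bsub>C\<^esub> c" "ract P m c" "\<zero>\<^bsub>K\<^esub>"] b' c t
            dual_closed[OF Dt, of "(c' \<otimes>\<^bsub>C\<^esub> c, \<zero>\<^bsub>P\<^esub>, \<zero>\<^bsub>K\<^esub>)"]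
          by (simp add: annih_def P.ract_closed)
      qed
      then show ?thesis using b' by (auto intro!: restrict_ext)
    qed
    fix t' assume "t' \<in> carrier (submod (rterm T 0) ?N)"
    then have t': "t' \<in> ?N" by simp
    show "(\<lambda>c\<in>carrier C. raug T (t \<oplus>\<^bsub>submod (rterm T 0) ?N\<^esub> t') (c, \<zero>\<^bsub>P\<^esub>, \<zero>\<^bsub>K\<^esub>)) =
        (\<lambda>c\<in>carrier C. raug T t (c, \<zero>\<^bsub>P\<^esub>, \<zero>\<^bsub>K\<^esub>)) \<oplus>\<^bsub>infl DC\<^esub> (\<lambda>c\<in>carrier C. raug T t' (c, \<zero>\<^bsub>P\<^esub>, \<zero>\<^bsub>K\<^esub>))"
      unfolding restrict_scalars_simps dual_simps submod_simps
      by (rule restrict_ext) (simp add: aug_add[OF aug sub[OF t] sub[OF t']])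
  qed
  then show "(\<lambda>t\<in>?N. \<lambda>c\<in>carrier C. raug T t (c, \<zero>\<^bsub>P\<^esub>, \<zero>\<^bsub>K\<^esub>)) \<in> rhom B (submod (rterm T 0) ?N) (infl DC)"
    by (simp only: submod_simps)
qed

text \<open>Replacing \<open>T\<^sub>0\<close> by the preimage of the submodule \<open>DC\<close> of \<open>DB\<close> turns a projective resolution of
  \<open>DB\<close> into one of \<open>DC\<close>, without any change in the degrees that determine \<open>Ext\<^sup>2\<close>.\<close>

lemma pres_trunc:
  assumes T: "pres B DB T"
  shows "pres B (infl DC) (trunc T)"
  unfolding pres_def
proof (intro conjI allI)
  note T0 = pres_term[OF T, of 0] and aug = pres_aug[OF T]
  interpret T0: right_module B "rterm T 0" by (rule T0)
  let ?N = "annih (rterm T 0) (raug T)"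
  show DC: "right_module B (infl DC)" by (rule right_module_infl[OF C.right_module_dual])
  show db: "dbproj B (rterm (trunc T) i)" for i
    using dbproj_annih[OF pres_dbproj[OF T] aug pres_surj[OF T]] pres_dbproj[OF T] by (cases "i = 0") simp_all
  \<comment> \<open>The kernel of the augmentation, hence the image of the first differential, lies
    in \<open>annih\<close>; replacing the term in degree 0 therefore keeps both the differential
    and exactness.\<close>
  have z: "raug T t = \<zero>\<^bsub>DB\<^esub> \<Longrightarrow> t \<in> carrier (rterm T 0) \<Longrightarrow> t \<in> ?N" for t
    by (simp add: annih_def)
  have im: "rdiff T 0 ` carrier (rterm T 1) = {t \<in> carrier (rterm T 0). raug T t = \<zero>\<^bsub>DB\<^esub>}"
    using pres_exact0[OF T] by simp
  show "rdiff (trunc T) i \<in> rhom B (rterm (trunc T) (Suc i)) (rterm (trunc T) i)" for i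
  proof (cases "i = 0")
    case True
    have "rdiff T 0 \<in> rhom B (rterm T 1) (submod (rterm T 0) ?N)"
      by (rule corestrict_rhom) (use pres_diff[OF T, of 0] z im in auto)
    then show ?thesis using True by simp
  qed (simp add: pres_diff[OF T])
  show "raug (trunc T) \<in> rhom B (rterm (trunc T) 0) (infl DC)" by (rule trunc_raug_rhom[OF T])
  show "raug (trunc T) ` carrier (rterm (trunc T) 0) = carrier (infl DC)"
  proof
    show "raug (trunc T) ` carrier (rterm (trunc T) 0) \<subseteq> carrier (infl DC)"
      by (rule image_subsetI) (rule rhom_closed[OF trunc_raug_rhom[OF T]])
    show "carrier (infl DC) \<subseteq> raug (trunc T) ` carrier (rterm (trunc T) 0)"
    proof
      fix \<theta> assume "\<theta> \<in> carrier (infl DC)"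
      then have \<theta>: "\<theta> \<in> carrier DC" by simp
      have "\<iota> \<theta> \<in> raug T ` carrier (rterm T 0)" using \<iota>_closed[OF \<theta>] pres_surj[OF T] by simp
      then obtain t where t: "t \<in> carrier (rterm T 0)" "raug T t = \<iota> \<theta>" by auto
      have tN: "t \<in> ?N"
        using t dual_zero[OF \<theta> C.k_algebra_axioms] by (simp add: annih_def \<iota>_def row_def)
      have "raug (trunc T) t = \<theta>"
        using tN t(2) dual_restrict[OF \<theta>] by (simp add: \<iota>_def cong: restrict_cong)
      then show "\<theta> \<in> raug (trunc T) ` carrier (rterm (trunc T) 0)" using tN by force
    qed
  qed
  show "rdiff (trunc T) 0 ` carrier (rterm (trunc T) 1) =
      {t \<in> carrier (rterm (trunc T) 0). raug (trunc T) t = \<zero>\<^bsub>infl DC\<^esub>}"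
  proof -
    have "raug T t = \<zero>\<^bsub>DB\<^esub> \<longleftrightarrow> raug (trunc T) t = \<zero>\<^bsub>DC\<^esub>" if t: "t \<in> ?N" for t
    proof
      assume "raug T t = \<zero>\<^bsub>DB\<^esub>"
      then show "raug (trunc T) t = \<zero>\<^bsub>DC\<^esub>" using t by (auto intro!: restrict_ext)
    next
      assume "raug (trunc T) t = \<zero>\<^bsub>DC\<^esub>"
      then have "raug T t = \<iota> \<zero>\<^bsub>DC\<^esub>" using annih_raug[OF T t] by simp
      also have "\<dots> = \<zero>\<^bsub>DB\<^esub>" unfolding \<iota>_def dual_simps by (rule restrict_ext) (auto elim!: B_cases)
      finally show "raug T t = \<zero>\<^bsub>DB\<^esub>" .
    qed
    moreover have "?N \<subseteq> carrier (rterm T 0)" by (auto simp: annih_def)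
    ultimately have "{t \<in> ?N. raug (trunc T) t = \<zero>\<^bsub>DC\<^esub>} = {t \<in> carrier (rterm T 0). raug T t = \<zero>\<^bsub>DB\<^esub>}"
      using z by blast
    then show ?thesis using im by simp
  qed
  show "rdiff (trunc T) (Suc i) ` carrier (rterm (trunc T) (Suc (Suc i))) =
      {x \<in> carrier (rterm (trunc T) (Suc i)). rdiff (trunc T) i x = \<zero>\<^bsub>rterm (trunc T) i\<^esub>}" for i
    using pres_exact[OF T, of i] by (cases "i = 0") simp_all
qed

text \<open>The right action of \<open>B\<close> on \<open>Ext\<close> uses lifts to the full
  resolution \<open>T\<close> of endomorphisms of \<open>DB\<close>. Read as a chain map into
  \<open>T\<close> over \<iota>, a comparison with the truncation can be composed with such
  lifts.\<close>

lemma chain_map_untrunc: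
  assumes T: "pres B DB T" and Q: "pres B V Q" and \<beta>: "chain_map B Q (trunc T) h \<beta>"
  shows "chain_map B Q T (\<lambda>\<theta>. \<iota> (h \<theta>)) \<beta>"
  unfolding chain_map_def
proof (intro conjI allI ballI)
  have sub: "annih (rterm T 0) (raug T) \<subseteq> carrier (rterm T 0)" by (auto simp: annih_def)
  show "\<beta> i \<in> rhom B (rterm Q i) (rterm T i)" for i
    using chain_map_rhom[OF \<beta>, of i] rhom_from_submod_extend[OF _ sub] by (cases "i = 0") auto
  fix q assume q: "q \<in> carrier (rterm Q 0)"
  have "\<beta> 0 q \<in> annih (rterm T 0) (raug T)" using rhom_closed[OF chain_map_rhom[OF \<beta>] q] by simp
  from annih_raug[OF T this] show "raug T (\<beta> 0 q) = \<iota> (h (raug Q q))"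
    unfolding chain_map_aug[OF \<beta> q] .
next
  fix i q assume q: "q \<in> carrier (rterm Q (Suc i))"
  then show "rdiff T i (\<beta> (Suc i) q) = \<beta> i (rdiff Q i q)" using chain_map_diff[OF \<beta> q] by simp
qed

end

section \<open>Projective modules generated by idempotents\<close>

lemma right_module_idem:
  assumes "ring R" "e \<in> carrier R"
  shows "right_module R (idem_module R e)"
proof -
  interpret ring R by fact
  have sub: "is_submod R (regular_bimod R) {e \<otimes>\<^bsub>R\<^esub> x | x. x \<in> carrier R}"
    unfolding is_submod_def
  proof (intro conjI ballI)
    show "\<zero>\<^bsub>regular_bimod R\<^esub> \<in> {e \<otimes>\<^bsub>R\<^esub> x | x. x \<in> carrier R}"
      using assms(2) by (auto intro!: exI[of _ "\<zero>\<^bsub>R\<^esub>"])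
  next
    fix x y assume "x \<in> {e \<otimes>\<^bsub>R\<^esub> x | x. x \<in> carrier R}" "y \<in> {e \<otimes>\<^bsub>R\<^esub> x | x. x \<in> carrier R}"
    then obtain u v where "x = e \<otimes>\<^bsub>R\<^esub> u" "y = e \<otimes>\<^bsub>R\<^esub> v" "u \<in> carrier R" "v \<in> carrier R" by blast
    then show "x \<oplus>\<^bsub>regular_bimod R\<^esub> y \<in> {e \<otimes>\<^bsub>R\<^esub> x | x. x \<in> carrier R}"
      using assms(2) by (auto intro!: exI[of _ "u \<oplus>\<^bsub>R\<^esub> v"] simp: r_distr)
  next
    fix x b assume "x \<in> {e \<otimes>\<^bsub>R\<^esub> x | x. x \<in> carrier R}" and b: "b \<in> carrier R"
    then obtain u where "x = e \<otimes>\<^bsub>R\<^esub> u" "u \<in> carrier R" by blast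
    then show "ract (regular_bimod R) x b \<in> {e \<otimes>\<^bsub>R\<^esub> x | x. x \<in> carrier R}"
      using assms(2) b by (auto intro!: exI[of _ "u \<otimes>\<^bsub>R\<^esub> b"] simp: m_assoc)
  qed (use assms(2) in auto)
  have "idem_module R e = submod (regular_bimod R) {e \<otimes>\<^bsub>R\<^esub> x | x. x \<in> carrier R}"
    by (simp add: idem_module_def submod_def regular_bimod_def)
  then show ?thesis
    using right_module_submod[OF right_module_regular[OF assms(1)] sub] by simp
qed

lemma idem_module_simps [simp]:
  "\<zero>\<^bsub>idem_module R e\<^esub> = \<zero>\<^bsub>R\<^esub>" "x \<oplus>\<^bsub>idem_module R e\<^esub> y = x \<oplus>\<^bsub>R\<^esub> y" "ract (idem_module R e) x a = x \<otimes>\<^bsub>R\<^esub> a"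
  by (simp_all add: idem_module_def)

lemma idem_module_mem:
  assumes "ring R" "e \<in> carrier R" "e \<otimes>\<^bsub>R\<^esub> e = e"
  shows "x \<in> carrier (idem_module R e) \<longleftrightarrow> x \<in> carrier R \<and> e \<otimes>\<^bsub>R\<^esub> x = x"
proof -
  interpret ring R by fact
  have "e \<otimes>\<^bsub>R\<^esub> (e \<otimes>\<^bsub>R\<^esub> y) = e \<otimes>\<^bsub>R\<^esub> y" if "y \<in> carrier R" for y
    using assms that by (simp add: m_assoc[symmetric])
  then show ?thesis using assms(2) by (force simp: idem_module_def)
qed

text \<open>The dual basis is the single element \<open>e\<close> with the inclusion into the ring
  as functional.\<close>

lemma dbproj_idem:
  assumes R: "ring R" and e: "e \<in> carrier R" "e \<otimes>\<^bsub>R\<^esub> e = e"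
  shows "dbproj R (idem_module R e)"
proof -
  interpret ring R by fact
  let ?M = "idem_module R e"
  note M = right_module_idem[OF R e(1)] and mem = idem_module_mem[OF R e]
  have "(\<lambda>x\<in>carrier ?M. x) \<in> rhom R ?M (regular_bimod R)"
    by (rule rhomI[OF _ _ _ M]) (auto simp: mem)
  moreover have "e \<in> carrier ?M" using e by (simp add: mem)
  ultimately have "(\<lambda>x\<in>carrier ?M. ract ?M e ((\<lambda>x\<in>carrier ?M. x) x)) \<in> frank R ?M ?M"
    by (intro frank_scaled M)
  moreover have "(\<lambda>x\<in>carrier ?M. ract ?M e ((\<lambda>x\<in>carrier ?M. x) x)) = (\<lambda>x\<in>carrier ?M. x)"
    by (intro restrict_ext) (simp add: mem)
  ultimately show ?thesis using M unfolding dbproj_def by (simp only:)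
qed

section \<open>Arithmetic of the bimodule \<open>E\<close>, computed on cocycles\<close>

context fd_algebra
begin

lemma E_cases:
  assumes "\<xi> \<in> carrier E"
  obtains f where "cocycle A res (regular_bimod A) f" "\<xi> = cls f"
  using assms by (auto simp: ext_carrier')

lemma cls_E: "cocycle A res (regular_bimod A) f \<Longrightarrow> cls f \<in> carrier E"
  by (simp add: ext_carrier')

lemma cocycle_plus': "cocycle A res (regular_bimod A) f \<Longrightarrow> cocycle A res (regular_bimod A) g \<Longrightarrow>
    cocycle A res (regular_bimod A) (\<lambda>x\<in>Q2. f x \<oplus>\<^bsub>A\<^esub> g x)"
  using cocycle_plus[OF W pres_res] by simp

lemma cocycle_zero': "cocycle A res (regular_bimod A) (\<lambda>x\<in>Q2. \<zero>\<^bsub>A\<^esub>)"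
  using cocycle_zero[OF W pres_res] by simp

lemma cocycle_closed: "cocycle A res (regular_bimod A) f \<Longrightarrow> x \<in> Q2 \<Longrightarrow> f x \<in> carrier A"
  using rhom_closed[OF cocycle_rhom, of A res "regular_bimod A" f x] by simp

lemma E_add_zero:
  assumes "\<xi> \<in> carrier E"
  shows "\<xi> \<oplus>\<^bsub>E\<^esub> \<zero>\<^bsub>E\<^esub> = \<xi>" "\<zero>\<^bsub>E\<^esub> \<oplus>\<^bsub>E\<^esub> \<xi> = \<xi>"
proof -
  obtain f where f: "cocycle A res (regular_bimod A) f" "\<xi> = cls f" using assms by (rule E_cases)
  have "(\<lambda>x\<in>Q2. f x \<oplus>\<^bsub>A\<^esub> (\<lambda>x\<in>Q2. \<zero>\<^bsub>A\<^esub>) x) = (\<lambda>x\<in>Q2. f x)" "(\<lambda>x\<in>Q2. (\<lambda>x\<in>Q2. \<zero>\<^bsub>A\<^esub>) x \<oplus>\<^bsub>A\<^esub> f x) = (\<lambda>x\<in>Q2. f x)"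
    by (auto intro!: restrict_ext simp: cocycle_closed[OF f(1)])
  then show "\<xi> \<oplus>\<^bsub>E\<^esub> \<zero>\<^bsub>E\<^esub> = \<xi>" "\<zero>\<^bsub>E\<^esub> \<oplus>\<^bsub>E\<^esub> \<xi> = \<xi>"
    unfolding f(2) ext_zero' ext_add'[OF f(1) cocycle_zero'] ext_add'[OF cocycle_zero' f(1)]
    using rhom_restrict[OF cocycle_rhom[OF f(1)]] by (simp_all only:)
qed

lemma E_add_commute: "\<xi> \<in> carrier E \<Longrightarrow> \<eta> \<in> carrier E \<Longrightarrow> \<xi> \<oplus>\<^bsub>E\<^esub> \<eta> = \<eta> \<oplus>\<^bsub>E\<^esub> \<xi>"
proof (elim E_cases)
  fix f g assume f: "cocycle A res (regular_bimod A) f" "\<xi> = cls f" and g: "cocycle A res (regular_bimod A) g" "\<eta> = cls g"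
  have "(\<lambda>x\<in>Q2. f x \<oplus>\<^bsub>A\<^esub> g x) = (\<lambda>x\<in>Q2. g x \<oplus>\<^bsub>A\<^esub> f x)"
    by (rule restrict_ext) (rule M.a_comm[OF cocycle_closed[OF f(1)] cocycle_closed[OF g(1)]])
  then show "\<xi> \<oplus>\<^bsub>E\<^esub> \<eta> = \<eta> \<oplus>\<^bsub>E\<^esub> \<xi>" using f g by (simp add: ext_add')
qed

lemma E_add_assoc:
  "\<xi> \<in> carrier E \<Longrightarrow> \<eta> \<in> carrier E \<Longrightarrow> \<zeta> \<in> carrier E \<Longrightarrow> \<xi> \<oplus>\<^bsub>E\<^esub> \<eta> \<oplus>\<^bsub>E\<^esub> \<zeta> = \<xi> \<oplus>\<^bsub>E\<^esub> (\<eta> \<oplus>\<^bsub>E\<^esub> \<zeta>)"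
proof (elim E_cases)
  fix f g h assume f: "cocycle A res (regular_bimod A) f" "\<xi> = cls f" and g: "cocycle A res (regular_bimod A) g" "\<eta> = cls g"
    and h: "cocycle A res (regular_bimod A) h" "\<zeta> = cls h"
  have "(\<lambda>x\<in>Q2. (\<lambda>x\<in>Q2. f x \<oplus>\<^bsub>A\<^esub> g x) x \<oplus>\<^bsub>A\<^esub> h x) = (\<lambda>x\<in>Q2. f x \<oplus>\<^bsub>A\<^esub> (\<lambda>x\<in>Q2. g x \<oplus>\<^bsub>A\<^esub> h x) x)"
    by (rule restrict_ext) (simp add: M.a_assoc cocycle_closed[OF f(1)] cocycle_closed[OF g(1)] cocycle_closed[OF h(1)])
  then show "\<xi> \<oplus>\<^bsub>E\<^esub> \<eta> \<oplus>\<^bsub>E\<^esub> \<zeta> = \<xi> \<oplus>\<^bsub>E\<^esub> (\<eta> \<oplus>\<^bsub>E\<^esub> \<zeta>)"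
    unfolding f(2) g(2) h(2) ext_add'[OF f(1) g(1)] ext_add'[OF g(1) h(1)]
      ext_add'[OF cocycle_plus'[OF f(1) g(1)] h(1)] ext_add'[OF f(1) cocycle_plus'[OF g(1) h(1)]] by (simp only:)
qed

lemma E_lact_closed: "a \<in> carrier A \<Longrightarrow> \<xi> \<in> carrier E \<Longrightarrow> lact E a \<xi> \<in> carrier E"
  by (elim E_cases) (simp add: ext_lact' cls_E cocycle_lact)

lemma E_ract_closed: "a \<in> carrier A \<Longrightarrow> \<xi> \<in> carrier E \<Longrightarrow> ract E \<xi> a \<in> carrier E"
proof (elim E_cases)
  fix f assume a: "a \<in> carrier A" and f: "cocycle A res (regular_bimod A) f" "\<xi> = cls f"
  obtain \<phi> where \<phi>: "chain_map A res res (lact DA a) \<phi>" using lact_chain_map_exists[OF a] by blast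
  show ?thesis
    unfolding f(2) ext_ract'[OF f(1) \<phi>] by (rule cls_E[OF cocycle_compose_chain_map[OF pres_res f(1) \<phi>]])
qed

lemma E_lact_mult:
  assumes "a \<in> carrier A" "b \<in> carrier A" "\<xi> \<in> carrier E"
  shows "lact E a (lact E b \<xi>) = lact E (a \<otimes>\<^bsub>A\<^esub> b) \<xi>"
proof -
  obtain f where f: "cocycle A res (regular_bimod A) f" "\<xi> = cls f" using assms(3) by (rule E_cases)
  have "(\<lambda>x\<in>Q2. a \<otimes>\<^bsub>A\<^esub> (\<lambda>x\<in>Q2. b \<otimes>\<^bsub>A\<^esub> f x) x) = (\<lambda>x\<in>Q2. a \<otimes>\<^bsub>A\<^esub> b \<otimes>\<^bsub>A\<^esub> f x)"
    by (rule restrict_ext) (simp add: assms A.m_assoc cocycle_closed[OF f(1)])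
  then show ?thesis
    unfolding f(2) ext_lact'[OF assms(2) f(1)] ext_lact'[OF assms(1) cocycle_lact[OF assms(2) f(1)]]
      ext_lact'[OF A.m_closed[OF assms(1,2)] f(1)] by (simp only:)
qed

lemma E_lact_zero:
  assumes "a \<in> carrier A"
  shows "lact E a \<zero>\<^bsub>E\<^esub> = \<zero>\<^bsub>E\<^esub>"
proof -
  have "(\<lambda>x\<in>Q2. a \<otimes>\<^bsub>A\<^esub> (\<lambda>x\<in>Q2. \<zero>\<^bsub>A\<^esub>) x) = (\<lambda>x\<in>Q2. \<zero>\<^bsub>A\<^esub>)"
    by (rule restrict_ext) (simp add: assms)
  then show ?thesis
    unfolding ext_zero' ext_lact'[OF assms cocycle_zero'] by (simp only:)
qed

end

section \<open>Comparison of the two Ext bimodules\<close>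

text \<open>There is one index for each copy of an indecomposable projective, so multiplicities
  become repetitions in the family \<epsilon>.\<close>

locale idem_ext = C: fd_algebra K C
  for K :: "('k, 'r) ring_scheme" and C :: "('k, 'a, 's) module_scheme" +
  fixes I :: "'i set" and \<epsilon> :: "'i \<Rightarrow> 'a"
  assumes finite_I: "finite I"
    and \<epsilon>_closed: "i \<in> I \<Longrightarrow> \<epsilon> i \<in> carrier C"
    and \<epsilon>_idem: "i \<in> I \<Longrightarrow> \<epsilon> i \<otimes>\<^bsub>C\<^esub> \<epsilon> i = \<epsilon> i"
begin

abbreviation "P \<equiv> direct_sum I (\<lambda>i. idem_module C (\<epsilon> i))"

sublocale one_point K C P
proof (rule one_point.intro[OF C.fd_algebra_axioms one_point_axioms.intro])
  show "dbproj C P"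
    by (intro dbproj_direct_sum C.ring_A finite_I dbproj_idem \<epsilon>_closed \<epsilon>_idem)
qed

text \<open>The row vectors \<open>(c, p)\<close> have one coordinate \<open>c \<in> C\<close>, indexed by \<open>None\<close>, and the coordinates
  \<open>p\<^sub>i \<in> \<epsilon>\<^sub>i C\<close>.\<close>

definition coord :: "'i option \<Rightarrow> 'a \<times> ('i \<Rightarrow> 'a) \<times> 'k \<Rightarrow> 'a" where
  "coord \<kappa> b = (case \<kappa> of None \<Rightarrow> fst b | Some i \<Rightarrow> fst (snd b) i)"

text \<open>Coordinate \<kappa> has values in the right ideal of \<open>eps \<kappa>\<close>. With
  the unit for \<open>None\<close>, the entry in \<open>C\<close> and the entries of
  \<open>P\<close> are treated alike.\<close>

definition eps :: "'i option \<Rightarrow> 'a" where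
  "eps \<kappa> = (case \<kappa> of None \<Rightarrow> \<one>\<^bsub>C\<^esub> | Some i \<Rightarrow> \<epsilon> i)"

abbreviation "ind \<equiv> insert None (Some ` I)"

lemma eps_closed: "\<kappa> \<in> ind \<Longrightarrow> eps \<kappa> \<in> carrier C"
  by (auto simp: eps_def \<epsilon>_closed)

lemma P_mem: "p \<in> carrier P \<Longrightarrow> i \<in> I \<Longrightarrow> p i \<in> carrier C \<and> \<epsilon> i \<otimes>\<^bsub>C\<^esub> p i = p i"
  using idem_module_mem[OF C.ring_A \<epsilon>_closed \<epsilon>_idem] by (auto dest: PiE_mem)

lemma coord_closed: "\<kappa> \<in> ind \<Longrightarrow> b \<in> carrier B \<Longrightarrow> coord \<kappa> b \<in> carrier C"
  by (auto simp: coord_def P_mem simp del: direct_sum_simps elim!: B_cases)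

lemma eps_coord: "\<kappa> \<in> ind \<Longrightarrow> b \<in> carrier B \<Longrightarrow> eps \<kappa> \<otimes>\<^bsub>C\<^esub> coord \<kappa> b = coord \<kappa> b"
  by (auto simp: coord_def eps_def P_mem simp del: direct_sum_simps(1) elim!: B_cases)

lemma coord_add: "\<kappa> \<in> ind \<Longrightarrow> b \<in> carrier B \<Longrightarrow> b' \<in> carrier B \<Longrightarrow>
    coord \<kappa> (b \<oplus>\<^bsub>B\<^esub> b') = coord \<kappa> b \<oplus>\<^bsub>C\<^esub> coord \<kappa> b'"
  by (auto simp: coord_def elim!: B_cases)

lemma coord_mult:
  "\<kappa> \<in> ind \<Longrightarrow> b \<in> carrier B \<Longrightarrow> c \<in> carrier C \<Longrightarrow>
    coord \<kappa> (b \<otimes>\<^bsub>B\<^esub> (c, \<zero>\<^bsub>P\<^esub>, \<zero>\<^bsub>K\<^esub>)) = coord \<kappa> b \<otimes>\<^bsub>C\<^esub> c"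
  using P_mem by (auto simp: coord_def simp del: direct_sum_simps(1) elim!: B_cases)

lemma coord_zero: "\<kappa> \<in> ind \<Longrightarrow> coord \<kappa> \<zero>\<^bsub>B\<^esub> = \<zero>\<^bsub>C\<^esub>"
  by (auto simp: coord_def)

lemma coord_eqI:
  assumes "b \<in> carrier B" "b' \<in> carrier B" "snd (snd b) = snd (snd b')"
    "\<And>\<kappa>. \<kappa> \<in> ind \<Longrightarrow> coord \<kappa> b = coord \<kappa> b'"
  shows "b = b'"
proof -
  obtain c p \<mu> where b: "b = (c, p, \<mu>)" "p \<in> carrier P" using assms(1) by (rule B_cases)
  obtain c' p' \<mu>' where b': "b' = (c', p', \<mu>')" "p' \<in> carrier P" using assms(2) by (rule B_cases)
  have "c = c'" using assms(4)[of None] b b' by (simp add: coord_def)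
  moreover have "p i = p' i" if "i \<in> I" for i using assms(4)[of "Some i"] b b' that by (simp add: coord_def)
  then have "p = p'" using b(2) b'(2) by (auto intro: PiE_ext)
  ultimately show ?thesis using b b' assms(3) by simp
qed

abbreviation "RC \<equiv> regular_bimod C"
abbreviation "RB \<equiv> regular_bimod B"
abbreviation "Q \<equiv> C.res"
abbreviation "T \<equiv> B.res"
abbreviation "LQ \<equiv> infl_res Q"
abbreviation "T' \<equiv> trunc T"

lemmas pres_LQ = pres_infl[OF C.pres_res]
lemmas pres_T' = pres_trunc[OF B.pres_res]
lemmas RB = right_module_regular[OF ring_B]
lemmas RC = right_module_regular[OF C.ring_A]

text \<open>On an inflated module \<open>(1, 0, 0)\<close> acts as the unit of \<open>C\<close>.
  Multiplying by it on the right erases the corner, so \<open>B\<close>-linear maps from inflated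
  modules to \<open>B\<close> have values in \<open>C \<oplus> P\<close>, which is
  \<open>infl_last_zero\<close>.\<close>

lemma infl_fixed:
  assumes F: "F \<in> rhom B (infl Y) RB" and Y: "right_module C Y" and q: "q \<in> carrier Y"
  shows "F q \<otimes>\<^bsub>B\<^esub> (\<one>\<^bsub>C\<^esub>, \<zero>\<^bsub>P\<^esub>, \<zero>\<^bsub>K\<^esub>) = F q"
  using rhom_ract[OF F, of q "(\<one>\<^bsub>C\<^esub>, \<zero>\<^bsub>P\<^esub>, \<zero>\<^bsub>K\<^esub>)"] q right_module.ract_one[OF Y q] P.M.zero_closed
  by (simp del: direct_sum_simps)

lemma infl_last_zero:
  assumes F: "F \<in> rhom B (infl Y) RB" and Y: "right_module C Y" and q: "q \<in> carrier Y"
  shows "snd (snd (F q)) = \<zero>\<^bsub>K\<^esub>"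
proof -
  have "F q \<in> carrier B" using rhom_closed[OF F] q by simp
  then obtain c p \<mu> where b: "F q = (c, p, \<mu>)" "\<mu> \<in> carrier K" by (rule B_cases)
  have "snd (snd (F q \<otimes>\<^bsub>B\<^esub> (\<one>\<^bsub>C\<^esub>, \<zero>\<^bsub>P\<^esub>, \<zero>\<^bsub>K\<^esub>))) = \<zero>\<^bsub>K\<^esub>"
    unfolding b(1) using b(2) by simp
  then show ?thesis by (simp only: infl_fixed[OF F Y q])
qed

text \<open>With \<open>assemble_rhom\<close> as converse, this identifies the
  \<open>B\<close>-linear maps from an inflated module to \<open>B\<close> with families of
  \<open>C\<close>-linear maps, the one at \<kappa> having values in the right ideal of
  \<open>eps \<kappa>\<close>.\<close>

lemma coord_rhom:
  assumes F: "F \<in> rhom B (infl Y) RB" and Y: "right_module C Y" and \<kappa>: "\<kappa> \<in> ind"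
  shows "(\<lambda>q\<in>carrier Y. coord \<kappa> (F q)) \<in> rhom C Y RC"
proof (rule rhomI[OF _ _ _ Y])
  have Fc: "F q \<in> carrier B" if "q \<in> carrier Y" for q using rhom_closed[OF F] that by simp
  fix q assume q: "q \<in> carrier Y"
  show "coord \<kappa> (F q) \<in> carrier RC" using coord_closed[OF \<kappa> Fc[OF q]] by simp
  show "coord \<kappa> (F (ract Y q c)) = ract RC (coord \<kappa> (F q)) c" if "c \<in> carrier C" for c
    using rhom_ract[OF F, of q "(c, \<zero>\<^bsub>P\<^esub>, \<zero>\<^bsub>K\<^esub>)"] q that coord_mult[OF \<kappa> Fc[OF q] that] P.M.zero_closed
    by (simp del: direct_sum_simps)
  show "coord \<kappa> (F (q \<oplus>\<^bsub>Y\<^esub> q')) = coord \<kappa> (F q) \<oplus>\<^bsub>RC\<^esub> coord \<kappa> (F q')" if "q' \<in> carrier Y" for q'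
    using rhom_add[OF F, of q q'] q that coord_add[OF \<kappa> Fc[OF q] Fc[OF that]] by simp
qed

definition assemble :: "'t set \<Rightarrow> ('i option \<Rightarrow> 't \<Rightarrow> 'a) \<Rightarrow> 't \<Rightarrow> 'a \<times> ('i \<Rightarrow> 'a) \<times> 'k" where
  "assemble Y g = (\<lambda>q\<in>Y. (g None q, \<lambda>i\<in>I. g (Some i) q, \<zero>\<^bsub>K\<^esub>))"

lemma coord_assemble: "\<kappa> \<in> ind \<Longrightarrow> q \<in> Y \<Longrightarrow> coord \<kappa> (assemble Y g q) = g \<kappa> q"
  by (auto simp: coord_def assemble_def)

lemma assemble_rhom:
  assumes Y: "right_module C Y" and g: "\<And>\<kappa>. \<kappa> \<in> ind \<Longrightarrow> g \<kappa> \<in> rhom C Y RC"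
    and \<epsilon>g: "\<And>i q. i \<in> I \<Longrightarrow> q \<in> carrier Y \<Longrightarrow> \<epsilon> i \<otimes>\<^bsub>C\<^esub> g (Some i) q = g (Some i) q"
  shows "assemble (carrier Y) g \<in> rhom B (infl Y) RB"
proof -
  have gc: "g \<kappa> q \<in> carrier C" if "\<kappa> \<in> ind" "q \<in> carrier Y" for \<kappa> q
    using rhom_closed[OF g[OF that(1)] that(2)] by simp
  have p: "(\<lambda>i\<in>I. g (Some i) q) \<in> carrier P" if "q \<in> carrier Y" for q
    using that gc \<epsilon>g by (auto simp: idem_module_mem[OF C.ring_A \<epsilon>_closed \<epsilon>_idem])
  have "(\<lambda>q\<in>carrier (infl Y). (g None q, \<lambda>i\<in>I. g (Some i) q, \<zero>\<^bsub>K\<^esub>)) \<in> rhom B (infl Y) RB"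
  proof (rule rhomI[OF _ _ _ right_module_infl[OF Y]])
    fix q assume "q \<in> carrier (infl Y)"
    then have q: "q \<in> carrier Y" by simp
    show "(g None q, \<lambda>i\<in>I. g (Some i) q, \<zero>\<^bsub>K\<^esub>) \<in> carrier RB"
      using gc[OF _ q] p[OF q] by (simp del: direct_sum_simps)
    show "(g None (ract (infl Y) q b), \<lambda>i\<in>I. g (Some i) (ract (infl Y) q b), \<zero>\<^bsub>K\<^esub>) =
        ract RB (g None q, \<lambda>i\<in>I. g (Some i) q, \<zero>\<^bsub>K\<^esub>) b" if "b \<in> carrier B" for b
    proof -
      obtain c m \<nu> where b: "b = (c, m, \<nu>)" "c \<in> carrier C" "m \<in> carrier P" "\<nu> \<in> carrier K"
        using \<open>b \<in> carrier B\<close> by (rule B_cases)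
      have gr: "g \<kappa> (ract Y q c) = g \<kappa> q \<otimes>\<^bsub>C\<^esub> c" if "\<kappa> \<in> ind" for \<kappa>
        using rhom_ract[OF g[OF that] q b(2)] by simp
      \<comment> \<open>The zero summand is the contribution of the row entry \<open>m\<close> of
        \<open>b\<close>, which is multiplied by the vanishing corner of the value.\<close>
      have "(\<lambda>i\<in>I. g (Some i) (ract Y q c)) = (\<lambda>i\<in>I. (g (Some i) q \<otimes>\<^bsub>C\<^esub> c) \<oplus>\<^bsub>C\<^esub> m i \<otimes>\<^bsub>C\<^esub> \<zero>\<^bsub>C\<^esub>)"
        using P_mem[OF b(3)] gc q b(2) by (auto intro!: restrict_ext simp: gr)
      also have "\<dots> = ract P (\<lambda>i\<in>I. g (Some i) q) c \<oplus>\<^bsub>P\<^esub> ract P m (\<zero>\<^bsub>K\<^esub> \<odot>\<^bsub>C\<^esub> \<one>\<^bsub>C\<^esub>)"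
        unfolding scalar_zero_one by (auto intro!: restrict_ext)
      finally show ?thesis
        using b gr[of None] by (simp del: direct_sum_simps)
    qed
    fix q' assume "q' \<in> carrier (infl Y)"
    then have q': "q' \<in> carrier Y" by simp
    have gr: "g \<kappa> (q \<oplus>\<^bsub>Y\<^esub> q') = g \<kappa> q \<oplus>\<^bsub>C\<^esub> g \<kappa> q'" if "\<kappa> \<in> ind" for \<kappa>
      using rhom_add[OF g[OF that] q q'] by simp
    show "(g None (q \<oplus>\<^bsub>infl Y\<^esub> q'), \<lambda>i\<in>I. g (Some i) (q \<oplus>\<^bsub>infl Y\<^esub> q'), \<zero>\<^bsub>K\<^esub>) =
        (g None q, \<lambda>i\<in>I. g (Some i) q, \<zero>\<^bsub>K\<^esub>) \<oplus>\<^bsub>RB\<^esub> (g None q', \<lambda>i\<in>I. g (Some i) q', \<zero>\<^bsub>K\<^esub>)"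
      using gr by (auto intro!: restrict_ext)
  qed
  then show ?thesis by (simp add: assemble_def)
qed

lemma dQ: "x \<in> C.Q2 \<Longrightarrow> rdiff Q 1 x \<in> carrier (rterm Q 1)"
  using rhom_closed[OF pres_diff[OF C.pres_res, of 1], of x] by (simp add: numeral_2_eq_2)

lemma dQ2: "x \<in> carrier (rterm Q 3) \<Longrightarrow> rdiff Q 2 x \<in> C.Q2"
  using rhom_closed[OF pres_diff[OF C.pres_res, of 2], of x] by (simp add: numeral_2_eq_2 numeral_3_eq_3)

lemma coord_cocycle:
  assumes "cocycle B LQ RB F" and \<kappa>: "\<kappa> \<in> ind"
  shows "cocycle C Q RC (\<lambda>q\<in>C.Q2. coord \<kappa> (F q))"
  using assms coord_rhom[OF _ pres_term[OF C.pres_res] \<kappa>, of F] dQ2 coord_zero[OF \<kappa>]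
  by (simp add: cocycle_def)

lemma coord_cohom:
  assumes "cohom B LQ RB F F'" and F': "F' \<in> rhom B (rterm LQ 2) RB" and \<kappa>: "\<kappa> \<in> ind"
  shows "cohom C Q RC (\<lambda>q\<in>C.Q2. coord \<kappa> (F q)) (\<lambda>q\<in>C.Q2. coord \<kappa> (F' q))"
proof -
  obtain G where G: "G \<in> rhom B (infl (rterm Q 1)) RB"
    "\<And>x. x \<in> C.Q2 \<Longrightarrow> F x = G (rdiff Q 1 x) \<oplus>\<^bsub>B\<^esub> F' x"
    using assms(1) by (auto simp: cohom_def)
  have "coord \<kappa> (F x) = coord \<kappa> (G (rdiff Q 1 x)) \<oplus>\<^bsub>C\<^esub> coord \<kappa> (F' x)" if x: "x \<in> C.Q2" for x
    using G(2)[OF x] coord_add[OF \<kappa>] rhom_closed[OF G(1), of "rdiff Q 1 x"] rhom_closed[OF F', of x] dQ[OF x] x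
    by simp
  then show ?thesis
    unfolding cohom_def using coord_rhom[OF G(1) pres_term[OF C.pres_res] \<kappa>] dQ
    by (intro bexI[of _ "\<lambda>q\<in>carrier (rterm Q 1). coord \<kappa> (G q)"]) simp_all
qed

abbreviation "idD \<equiv> \<lambda>\<theta>\<in>carrier DC. \<theta>"

lemma comparison_maps_exist:
  "\<exists>\<beta>. chain_map B LQ T' idD \<beta>" "\<exists>\<alpha>. chain_map B T' LQ idD \<alpha>"
proof -
  have "(\<lambda>\<theta>\<in>carrier (infl DC). \<theta>) \<in> rhom B (infl DC) (infl DC)"
    by (rule id_rhom[OF right_module_infl[OF C.right_module_dual]])
  then have "idD \<in> rhom B (infl DC) (infl DC)" by (simp only: restrict_scalars_simps)
  then show "\<exists>\<beta>. chain_map B LQ T' idD \<beta>" "\<exists>\<alpha>. chain_map B T' LQ idD \<alpha>"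
    using chain_map_exists[OF pres_LQ pres_T'] chain_map_exists[OF pres_T' pres_LQ] by blast+
qed

text \<open>\<beta> runs from the inflated resolution of \<open>DC\<close> to the truncated
  resolution, \<alpha> back. Both lie over the identity of \<open>DC\<close>, so either composite is
  homotopic to the identity.\<close>

definition \<beta> where "\<beta> = (SOME \<beta>. chain_map B LQ T' idD \<beta>)"
definition \<alpha> where "\<alpha> = (SOME \<alpha>. chain_map B T' LQ idD \<alpha>)"

lemma \<beta>: "chain_map B LQ T' idD \<beta>"
  unfolding \<beta>_def by (rule someI_ex[OF comparison_maps_exist(1)])

lemma \<alpha>: "chain_map B T' LQ idD \<alpha>"
  unfolding \<alpha>_def by (rule someI_ex[OF comparison_maps_exist(2)])

lemma \<beta>_closed: "q \<in> C.Q2 \<Longrightarrow> \<beta> 2 q \<in> B.Q2"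
  using rhom_closed[OF chain_map_rhom[OF \<beta>, of 2], of q] by simp

lemma \<alpha>_closed: "t \<in> B.Q2 \<Longrightarrow> \<alpha> 2 t \<in> C.Q2"
  using rhom_closed[OF chain_map_rhom[OF \<alpha>, of 2], of t] by simp

text \<open>Cocycles depend on degrees 2 and 3, and \<open>cohom\<close> on degrees 1 and 2;
  truncation changes degree 0.\<close>

lemma cocycle_trunc: "cocycle B T' RB f \<longleftrightarrow> cocycle B T RB f"
  by (simp add: cocycle_def)

lemma cohom_trunc: "cohom B T' RB f g \<longleftrightarrow> cohom B T RB f g"
  by (simp add: cohom_def)

abbreviation "pull f \<equiv> compose C.Q2 f (\<beta> 2)"

definition phi where "phi \<kappa> f = (\<lambda>q\<in>C.Q2. coord \<kappa> (f (\<beta> 2 q)))"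

lemma phi_pull: "phi \<kappa> f = (\<lambda>q\<in>C.Q2. coord \<kappa> (pull f q))"
  by (auto simp: phi_def compose_def)

lemma pull_cocycle: "cocycle B T RB f \<Longrightarrow> cocycle B LQ RB (pull f)"
  using cocycle_compose_chain_map[OF pres_LQ _ \<beta>, of RB f] by (simp add: cocycle_trunc)

lemma phi_cocycle: "cocycle B T RB f \<Longrightarrow> \<kappa> \<in> ind \<Longrightarrow> cocycle C Q RC (phi \<kappa> f)"
  unfolding phi_pull by (rule coord_cocycle[OF pull_cocycle])

lemma phi_cohom:
  assumes "cohom B T RB f f'" "cocycle B T RB f'" "\<kappa> \<in> ind"
  shows "cohom C Q RC (phi \<kappa> f) (phi \<kappa> f')"
  unfolding phi_pull
  by (rule coord_cohom[OF _ cocycle_rhom[OF pull_cocycle[OF assms(2)]] assms(3)])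
    (use cohom_compose_chain_map[OF pres_LQ \<beta>, of RB f f'] assms(1) in \<open>simp add: cohom_trunc\<close>)

text \<open>Coordinate \<kappa> of the comparison on classes. It goes through an arbitrary
  representative, and \<open>Phi_cls\<close> shows that any other gives the same class.\<close>

definition Phi where
  "Phi \<kappa> \<xi> = C.cls (phi \<kappa> (SOME f. cocycle B T RB f \<and> B.cls f = \<xi>))"

lemma Phi_cls:
  assumes f: "cocycle B T RB f" and \<kappa>: "\<kappa> \<in> ind"
  shows "Phi \<kappa> (B.cls f) = C.cls (phi \<kappa> f)"
proof -
  let ?g = "SOME g. cocycle B T RB g \<and> B.cls g = B.cls f"
  have g: "cocycle B T RB ?g \<and> B.cls ?g = B.cls f" by (rule someI[of _ f]) (simp add: f)
  then have "cohom B T RB ?g f" using B.cls_eq_iff[OF cocycle_rhom cocycle_rhom[OF f]] by blast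
  then have "cohom C Q RC (phi \<kappa> ?g) (phi \<kappa> f)" by (rule phi_cohom[OF _ f \<kappa>])
  then show ?thesis
    unfolding Phi_def using C.cls_eq_iff[OF cocycle_rhom[OF phi_cocycle] cocycle_rhom[OF phi_cocycle[OF f \<kappa>]]] g \<kappa> by blast
qed

text \<open>Cochains that bound the differences of the coordinates are assembled to a single cochain
  over \<open>B\<close>, so the pullbacks along \<beta> are cohomologous. Pulling back further along
  \<alpha> returns to \<open>f\<close> and \<open>f'\<close> up to coboundaries.\<close>

lemma Phi_inj:
  assumes f: "cocycle B T RB f" and f': "cocycle B T RB f'"
    and eq: "\<And>\<kappa>. \<kappa> \<in> ind \<Longrightarrow> Phi \<kappa> (B.cls f) = Phi \<kappa> (B.cls f')"
  shows "B.cls f = B.cls f'"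
proof -
  have "\<exists>g. g \<in> rhom C (rterm Q 1) RC \<and> (\<forall>x\<in>C.Q2. phi \<kappa> f x = g (rdiff Q 1 x) \<oplus>\<^bsub>C\<^esub> phi \<kappa> f' x)"
    if \<kappa>: "\<kappa> \<in> ind" for \<kappa>
  proof -
    have "cohom C Q RC (phi \<kappa> f) (phi \<kappa> f')"
      using eq[OF \<kappa>] C.cls_eq_iff[OF cocycle_rhom[OF phi_cocycle[OF f \<kappa>]] cocycle_rhom[OF phi_cocycle[OF f' \<kappa>]]]
      by (simp add: Phi_cls[OF f \<kappa>] Phi_cls[OF f' \<kappa>])
    then show ?thesis by (auto simp: cohom_def)
  qed
  then obtain g where g: "\<And>\<kappa>. \<kappa> \<in> ind \<Longrightarrow> g \<kappa> \<in> rhom C (rterm Q 1) RC"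
    "\<And>\<kappa> x. \<kappa> \<in> ind \<Longrightarrow> x \<in> C.Q2 \<Longrightarrow> phi \<kappa> f x = g \<kappa> (rdiff Q 1 x) \<oplus>\<^bsub>C\<^esub> phi \<kappa> f' x"
    by metis
  have gc: "g \<kappa> x \<in> carrier C" if "\<kappa> \<in> ind" "x \<in> carrier (rterm Q 1)" for \<kappa> x
    using rhom_closed[OF g(1)[OF that(1)] that(2)] by simp
  let ?Y = "rterm Q 1"
  \<comment> \<open>The chosen \<open>g \<kappa>\<close> need not have values in the right ideal of
    \<open>eps \<kappa>\<close>, as assembling requires. Multiplying by \<open>eps \<kappa>\<close>
    arranges this and keeps the equation, because the coordinates are fixed by
    \<open>eps \<kappa>\<close>.\<close>
  let ?h = "\<lambda>\<kappa>. \<lambda>x\<in>carrier ?Y. eps \<kappa> \<otimes>\<^bsub>C\<^esub> g \<kappa> x"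
  note Y = pres_term[OF C.pres_res, of 1]
  have h: "?h \<kappa> \<in> rhom C ?Y RC" if \<kappa>: "\<kappa> \<in> ind" for \<kappa>
    by (rule rhomI[OF _ _ _ Y])
      (use eps_closed[OF \<kappa>] gc[OF \<kappa>] rhom_add[OF g(1)[OF \<kappa>]] rhom_ract[OF g(1)[OF \<kappa>]] in
        \<open>simp_all add: C.A.r_distr C.A.m_assoc\<close>)
  let ?G = "assemble (carrier ?Y) ?h"
  have G: "?G \<in> rhom B (infl ?Y) RB"
  proof (rule assemble_rhom[OF Y h])
    fix i x assume i: "i \<in> I" and x: "x \<in> carrier ?Y"
    have "g (Some i) x \<in> carrier C" using gc[of "Some i" x] i x by simp
    then have "\<epsilon> i \<otimes>\<^bsub>C\<^esub> (\<epsilon> i \<otimes>\<^bsub>C\<^esub> g (Some i) x) = \<epsilon> i \<otimes>\<^bsub>C\<^esub> g (Some i) x"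
      using \<epsilon>_closed[OF i] C.A.m_assoc[of "\<epsilon> i" "\<epsilon> i" "g (Some i) x"] \<epsilon>_idem[OF i] by simp
    then show "\<epsilon> i \<otimes>\<^bsub>C\<^esub> ?h (Some i) x = ?h (Some i) x" using x by (simp add: eps_def)
  qed
  note F = cocycle_rhom[OF pull_cocycle[OF f]] and F' = cocycle_rhom[OF pull_cocycle[OF f']]
  note X2 = pres_term[OF C.pres_res, of 2]
  have Fi: "pull f \<in> rhom B (infl (rterm Q 2)) RB" "pull f' \<in> rhom B (infl (rterm Q 2)) RB" using F F' by simp_all
  have "pull f x = ?G (rdiff Q 1 x) \<oplus>\<^bsub>B\<^esub> pull f' x" if x: "x \<in> C.Q2" for x
  proof (rule coord_eqI)
    have c: "pull f x \<in> carrier B" "pull f' x \<in> carrier B" "?G (rdiff Q 1 x) \<in> carrier B"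
      using rhom_closed[OF Fi(1), of x] rhom_closed[OF Fi(2), of x] rhom_closed[OF G, of "rdiff Q 1 x"] x dQ[OF x]
      by (simp_all del: compose_eq)
    show "pull f x \<in> carrier B" "?G (rdiff Q 1 x) \<oplus>\<^bsub>B\<^esub> pull f' x \<in> carrier B"
      using c by (auto intro: B0.M.a_closed)
    have "snd (snd (b \<oplus>\<^bsub>B\<^esub> b')) = snd (snd b) \<oplus>\<^bsub>K\<^esub> snd (snd b')" if "b \<in> carrier B" "b' \<in> carrier B" for b b'
      using that by (auto elim!: B_cases)
    then show "snd (snd (pull f x)) = snd (snd (?G (rdiff Q 1 x) \<oplus>\<^bsub>B\<^esub> pull f' x))"
      using infl_last_zero[OF Fi(1) X2 x] infl_last_zero[OF Fi(2) X2 x] infl_last_zero[OF G Y dQ[OF x]] c by simp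
    fix \<kappa> assume \<kappa>: "\<kappa> \<in> ind"
    let ?a = "g \<kappa> (rdiff Q 1 x)"
    have a: "?a \<in> carrier C" by (rule gc[OF \<kappa> dQ[OF x]])
    have e: "eps \<kappa> \<in> carrier C" by (rule eps_closed[OF \<kappa>])
    have ph: "phi \<kappa> f x = coord \<kappa> (pull f x)" "phi \<kappa> f' x = coord \<kappa> (pull f' x)" using x by (simp_all add: phi_pull)
    have pc: "coord \<kappa> (pull f x) \<in> carrier C" "coord \<kappa> (pull f' x) \<in> carrier C"
      using coord_closed[OF \<kappa>] c by blast+
    have "coord \<kappa> (pull f x) = eps \<kappa> \<otimes>\<^bsub>C\<^esub> coord \<kappa> (pull f x)" using eps_coord[OF \<kappa> c(1)] by simp
    also have "\<dots> = eps \<kappa> \<otimes>\<^bsub>C\<^esub> (?a \<oplus>\<^bsub>C\<^esub> coord \<kappa> (pull f' x))" using g(2)[OF \<kappa> x] ph by simp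
    also have "\<dots> = eps \<kappa> \<otimes>\<^bsub>C\<^esub> ?a \<oplus>\<^bsub>C\<^esub> coord \<kappa> (pull f' x)"
      using C.A.r_distr[OF a pc(2) e] eps_coord[OF \<kappa> c(2)] by simp
    also have "eps \<kappa> \<otimes>\<^bsub>C\<^esub> ?a = coord \<kappa> (?G (rdiff Q 1 x))"
      unfolding coord_assemble[OF \<kappa> dQ[OF x]] restrict_apply'[OF dQ[OF x]] by (rule refl)
    finally show "coord \<kappa> (pull f x) = coord \<kappa> (?G (rdiff Q 1 x) \<oplus>\<^bsub>B\<^esub> pull f' x)"
      using coord_add[OF \<kappa> c(3,2)] by simp
  qed
  then have "cohom B LQ RB (pull f) (pull f')" unfolding cohom_def using G by (intro bexI[of _ ?G]) simp_all
  from cohom_compose_chain_map[OF pres_T' \<alpha> this]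
  have 1: "cohom B T' RB (compose B.Q2 (pull f) (\<alpha> 2)) (compose B.Q2 (pull f') (\<alpha> 2))" by simp
  \<comment> \<open>Pulling \<open>k\<close> back along \<beta> after \<alpha> amounts to pulling
    back along a chain map over the identity, which is homotopic to the identity chain map.\<close>
  have ab: "cohom B T' RB k (compose B.Q2 (pull k) (\<alpha> 2))" if k: "cocycle B T RB k" for k
  proof -
    have k': "cocycle B T' RB k" using k by (simp add: cocycle_trunc)
    have "chain_map B T' T' idD (\<lambda>i. compose (carrier (rterm T' i)) (\<beta> i) (\<alpha> i))"
      by (rule chain_map_compose[OF pres_T' \<alpha> \<beta>]) simp
    moreover have "chain_map B T' T' idD (\<lambda>i. \<lambda>q\<in>carrier (rterm T' i). q)"
      by (rule chain_map_id[OF pres_T']) simp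
    ultimately have "cohom B T' RB (compose B.Q2 k (\<lambda>q\<in>B.Q2. q)) (compose B.Q2 k (compose B.Q2 (\<beta> 2) (\<alpha> 2)))"
      using cohom_chain_maps[OF pres_T' pres_T' _ _ k' RB] by fastforce
    moreover have "compose B.Q2 k (\<lambda>q\<in>B.Q2. q) = k"
      using rhom_restrict[OF cocycle_rhom[OF k]] by (simp add: compose_def cong: restrict_cong)
    moreover have "compose B.Q2 k (compose B.Q2 (\<beta> 2) (\<alpha> 2)) = compose B.Q2 (pull k) (\<alpha> 2)"
      by (auto simp: compose_def \<alpha>_closed intro!: restrict_ext)
    ultimately show ?thesis by simp
  qed
  have r: "compose B.Q2 (pull k) (\<alpha> 2) \<in> rhom B (rterm T' 2) RB" if "cocycle B T RB k" for k
    using compose_rhom[OF chain_map_rhom[OF \<alpha>] cocycle_rhom[OF pull_cocycle[OF that]] pres_term[OF pres_T']] by simp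
  have f2: "f' \<in> rhom B (rterm T' 2) RB" using cocycle_rhom[OF f'] by simp
  have "cohom B T' RB f f'"
    by (rule cohom_trans[OF RB pres_T' f2 cohom_trans[OF RB pres_T' r[OF f'] ab[OF f] 1]
          cohom_sym[OF RB pres_T' r[OF f'] ab[OF f']]])
  then show ?thesis
    using B.cls_eq_iff[OF cocycle_rhom[OF f] cocycle_rhom[OF f']] by (simp add: cohom_trunc)
qed

text \<open>The assembled cocycle is transported along \<alpha>; its pullback along \<beta> is
  cohomologous to the original one, since \<alpha> after \<beta> is homotopic to the
  identity.\<close>

lemma Phi_surj:
  assumes g: "\<And>\<kappa>. \<kappa> \<in> ind \<Longrightarrow> cocycle C Q RC (g \<kappa>)"
    and \<epsilon>g: "\<And>i q. i \<in> I \<Longrightarrow> q \<in> C.Q2 \<Longrightarrow> \<epsilon> i \<otimes>\<^bsub>C\<^esub> g (Some i) q = g (Some i) q"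
  shows "\<exists>f. cocycle B T RB f \<and> (\<forall>\<kappa>\<in>ind. Phi \<kappa> (B.cls f) = C.cls (g \<kappa>))"
proof -
  let ?F = "assemble C.Q2 g"
  have F: "?F \<in> rhom B (infl (rterm Q 2)) RB"
    by (rule assemble_rhom[OF pres_term[OF C.pres_res] cocycle_rhom[OF g] \<epsilon>g])
  have "?F (rdiff Q 2 x) = \<zero>\<^bsub>B\<^esub>" if x: "x \<in> carrier (rterm Q 3)" for x
    using dQ2[OF x] g x by (auto simp: assemble_def cocycle_def intro!: restrict_ext)
  then have Fc: "cocycle B LQ RB ?F" using F by (simp add: cocycle_def del: B_simps)
  let ?f = "compose B.Q2 ?F (\<alpha> 2)"
  have f: "cocycle B T RB ?f"
    using cocycle_compose_chain_map[OF pres_T' Fc \<alpha>] by (simp add: cocycle_trunc)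
  have "chain_map B LQ LQ idD (\<lambda>i. compose (carrier (rterm LQ i)) (\<alpha> i) (\<beta> i))"
    by (rule chain_map_compose[OF pres_LQ \<beta> \<alpha>]) simp
  moreover have "chain_map B LQ LQ idD (\<lambda>i. \<lambda>q\<in>carrier (rterm LQ i). q)"
    by (rule chain_map_id[OF pres_LQ]) simp
  ultimately have "cohom B LQ RB (compose C.Q2 ?F (compose C.Q2 (\<alpha> 2) (\<beta> 2))) (compose C.Q2 ?F (\<lambda>q\<in>C.Q2. q))"
    using cohom_chain_maps[OF pres_LQ pres_LQ _ _ Fc RB] by fastforce
  moreover have "compose C.Q2 ?F (\<lambda>q\<in>C.Q2. q) = ?F"
    using rhom_restrict[OF F] by (simp add: compose_def cong: restrict_cong)
  moreover have "compose C.Q2 ?F (compose C.Q2 (\<alpha> 2) (\<beta> 2)) = pull ?f"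
    by (auto simp: compose_def \<beta>_closed intro!: restrict_ext)
  ultimately have coh: "cohom B LQ RB (pull ?f) ?F" by simp
  have "Phi \<kappa> (B.cls ?f) = C.cls (g \<kappa>)" if \<kappa>: "\<kappa> \<in> ind" for \<kappa>
  proof -
    have "(\<lambda>q\<in>C.Q2. coord \<kappa> (?F q)) = (\<lambda>q\<in>C.Q2. g \<kappa> q)" by (rule restrict_ext) (rule coord_assemble[OF \<kappa>])
    also have "\<dots> = g \<kappa>" by (rule rhom_restrict[OF cocycle_rhom[OF g[OF \<kappa>]]])
    finally have "cohom C Q RC (phi \<kappa> ?f) (g \<kappa>)"
      unfolding phi_pull using coord_cohom[OF coh _ \<kappa>] F by simp
    then show ?thesis
      unfolding Phi_cls[OF f \<kappa>] using C.cls_eq_iff[OF cocycle_rhom[OF phi_cocycle[OF f \<kappa>]] cocycle_rhom[OF g[OF \<kappa>]]] by blast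
  qed
  then show ?thesis using f by blast
qed

end

section \<open>Compatibility of the comparison with the bimodule structures\<close>

context idem_ext
begin

lemma Phi_closed:
  assumes "\<xi> \<in> carrier B.E" "\<kappa> \<in> ind"
  shows "Phi \<kappa> \<xi> \<in> carrier C.E" "lact C.E (eps \<kappa>) (Phi \<kappa> \<xi>) = Phi \<kappa> \<xi>"
proof -
  obtain f where f: "cocycle B T RB f" "\<xi> = B.cls f" using assms(1) by (rule B.E_cases)
  note ph = phi_cocycle[OF f(1) assms(2)]
  show "Phi \<kappa> \<xi> \<in> carrier C.E"
    unfolding f(2) Phi_cls[OF f(1) assms(2)] by (rule C.cls_E[OF ph])
  have "(\<lambda>x\<in>C.Q2. eps \<kappa> \<otimes>\<^bsub>C\<^esub> phi \<kappa> f x) = phi \<kappa> f"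
    unfolding phi_def
    by (rule restrict_ext) (simp add: eps_coord[OF assms(2) B.cocycle_closed[OF f(1) \<beta>_closed]])
  then show "lact C.E (eps \<kappa>) (Phi \<kappa> \<xi>) = Phi \<kappa> \<xi>"
    unfolding f(2) Phi_cls[OF f(1) assms(2)] C.ext_lact'[OF eps_closed[OF assms(2)] ph] by (simp only:)
qed

lemma Phi_add:
  assumes "\<xi> \<in> carrier B.E" "\<eta> \<in> carrier B.E" "\<kappa> \<in> ind"
  shows "Phi \<kappa> (\<xi> \<oplus>\<^bsub>B.E\<^esub> \<eta>) = Phi \<kappa> \<xi> \<oplus>\<^bsub>C.E\<^esub> Phi \<kappa> \<eta>"
proof -
  obtain f where f: "cocycle B T RB f" "\<xi> = B.cls f" using assms(1) by (rule B.E_cases)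
  obtain g where g: "cocycle B T RB g" "\<eta> = B.cls g" using assms(2) by (rule B.E_cases)
  have "phi \<kappa> (\<lambda>x\<in>B.Q2. f x \<oplus>\<^bsub>B\<^esub> g x) = (\<lambda>x\<in>C.Q2. phi \<kappa> f x \<oplus>\<^bsub>C\<^esub> phi \<kappa> g x)"
    unfolding phi_def
    by (rule restrict_ext) (simp add: \<beta>_closed coord_add[OF assms(3)] B.cocycle_closed[OF f(1)] B.cocycle_closed[OF g(1)])
  then show ?thesis
    unfolding f(2) g(2) B.ext_add'[OF f(1) g(1)] Phi_cls[OF f(1) assms(3)] Phi_cls[OF g(1) assms(3)]
      Phi_cls[OF B.cocycle_plus'[OF f(1) g(1)] assms(3)]
      C.ext_add'[OF phi_cocycle[OF f(1) assms(3)] phi_cocycle[OF g(1) assms(3)]] by (simp only:)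
qed

lemma Phi_zero:
  assumes "\<kappa> \<in> ind"
  shows "Phi \<kappa> \<zero>\<^bsub>B.E\<^esub> = \<zero>\<^bsub>C.E\<^esub>"
proof -
  have "phi \<kappa> (\<lambda>x\<in>B.Q2. \<zero>\<^bsub>B\<^esub>) = (\<lambda>x\<in>C.Q2. \<zero>\<^bsub>C\<^esub>)"
    unfolding phi_def by (rule restrict_ext) (simp add: \<beta>_closed coord_zero[OF assms] del: B_simps)
  then show ?thesis
    unfolding B.ext_zero' C.ext_zero' Phi_cls[OF B.cocycle_zero' assms] by (simp only:)
qed

lemma \<iota>_lact:
  assumes "\<theta> \<in> carrier DC" "b \<in> carrier B"
  shows "\<iota> (lact DC (fst b) \<theta>) = lact DB b (\<iota> \<theta>)"
proof -
  have "fst (x \<otimes>\<^bsub>B\<^esub> b) = fst x \<otimes>\<^bsub>C\<^esub> fst b" "fst x \<in> carrier C" if "x \<in> carrier B" for x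
    using that assms(2) by (auto elim!: B_cases)
  then show ?thesis
    using assms(2) by (auto simp: \<iota>_def intro!: restrict_ext)
qed

text \<open>For \<open>b \<in> B\<close> with \<open>C\<close>-component \<open>c\<close>, lifts of \<open>b\<close> to \<open>T\<close> and of \<open>c\<close> to \<open>Q\<close> become homotopic after
  composition with \<open>\<beta>\<close>, since \<open>\<iota>(c \<theta>) = b \<iota>(\<theta>)\<close>.\<close>

lemma Phi_ract:
  assumes "\<xi> \<in> carrier B.E" and b: "b \<in> carrier B" and \<kappa>: "\<kappa> \<in> ind"
  shows "Phi \<kappa> (ract B.E \<xi> b) = ract C.E (Phi \<kappa> \<xi>) (fst b)"
proof -
  obtain f where f: "cocycle B T RB f" "\<xi> = B.cls f" using assms(1) by (rule B.E_cases)
  have c: "fst b \<in> carrier C" using b by (auto elim!: B_cases)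
  obtain \<psi> where \<psi>: "chain_map B T T (lact DB b) \<psi>" using B.lact_chain_map_exists[OF b] by blast
  obtain \<phi> where \<phi>: "chain_map C Q Q (lact DC (fst b)) \<phi>" using C.lact_chain_map_exists[OF c] by blast
  \<comment> \<open>Inflation leaves the maps of a complex unchanged, so a lift over
    \<open>C\<close> is at the same time a lift over \<open>B\<close>.\<close>
  have \<phi>': "chain_map B LQ LQ (lact DC (fst b)) \<phi>"
    using \<phi> unfolding chain_map_def infl_res_simps restrict_scalars_simps by (blast intro: rhom_infl)
  note \<beta>' = chain_map_untrunc[OF B.pres_res pres_LQ \<beta>]
  let ?l = "\<lambda>\<theta>. lact DB b (\<iota> \<theta>)"
  have "chain_map B LQ T ?l (\<lambda>i. compose (carrier (rterm LQ i)) (\<psi> i) (\<beta> i))"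
    by (rule chain_map_compose[OF pres_LQ \<beta>' \<psi>]) simp
  moreover have "chain_map B LQ T ?l (\<lambda>i. compose (carrier (rterm LQ i)) (\<beta> i) (\<phi> i))"
  proof (rule chain_map_compose[OF pres_LQ \<phi>' \<beta>'])
    fix \<theta> assume "\<theta> \<in> carrier (infl DC)"
    then have \<theta>: "\<theta> \<in> carrier DC" by simp
    have "lact DC (fst b) \<theta> \<in> carrier DC" using C.dual_lact_closed[OF \<theta> c] by simp
    then show "\<iota> (idD (lact DC (fst b) \<theta>)) = ?l \<theta>" using \<iota>_lact[OF \<theta> b] by (simp only: restrict_apply')
  qed
  ultimately have "cohom B LQ RB (compose C.Q2 f (compose C.Q2 (\<psi> 2) (\<beta> 2))) (compose C.Q2 f (compose C.Q2 (\<beta> 2) (\<phi> 2)))"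
    using cohom_chain_maps[OF pres_LQ B.pres_res _ _ f(1) RB] by fastforce
  moreover have \<phi>c: "\<phi> 2 q \<in> C.Q2" if "q \<in> C.Q2" for q using rhom_closed[OF chain_map_rhom[OF \<phi>] that] .
  have "compose C.Q2 f (compose C.Q2 (\<psi> 2) (\<beta> 2)) = pull (compose B.Q2 f (\<psi> 2))"
    by (auto simp: compose_def \<beta>_closed intro!: restrict_ext)
  moreover have eq: "compose C.Q2 f (compose C.Q2 (\<beta> 2) (\<phi> 2)) = compose C.Q2 (pull f) (\<phi> 2)"
    by (auto simp: compose_def \<phi>c intro!: restrict_ext)
  ultimately have coh: "cohom B LQ RB (pull (compose B.Q2 f (\<psi> 2))) (compose C.Q2 (pull f) (\<phi> 2))" by simp
  have pf: "compose C.Q2 (pull f) (\<phi> 2) \<in> rhom B (rterm LQ 2) RB"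
    using compose_rhom[OF chain_map_rhom[OF \<phi>'] cocycle_rhom[OF pull_cocycle[OF f(1)]] pres_term[OF pres_LQ]] by simp
  have "cohom C Q RC (phi \<kappa> (compose B.Q2 f (\<psi> 2))) (\<lambda>q\<in>C.Q2. coord \<kappa> (compose C.Q2 (pull f) (\<phi> 2) q))"
    unfolding phi_pull by (rule coord_cohom[OF coh pf \<kappa>])
  moreover have "(\<lambda>q\<in>C.Q2. coord \<kappa> (compose C.Q2 (pull f) (\<phi> 2) q)) = compose C.Q2 (phi \<kappa> f) (\<phi> 2)"
    by (auto simp: compose_def phi_def \<phi>c intro!: restrict_ext)
  ultimately have "cohom C Q RC (phi \<kappa> (compose B.Q2 f (\<psi> 2))) (compose C.Q2 (phi \<kappa> f) (\<phi> 2))" by simp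
  moreover have fc: "cocycle B T RB (compose B.Q2 f (\<psi> 2))" by (rule cocycle_compose_chain_map[OF B.pres_res f(1) \<psi>])
  moreover note ph = phi_cocycle[OF f(1) \<kappa>]
  ultimately show ?thesis
    unfolding f(2) B.ext_ract'[OF f(1) \<psi>] Phi_cls[OF f(1) \<kappa>] Phi_cls[OF fc \<kappa>] C.ext_ract'[OF ph \<phi>]
    using C.cls_eq_iff[OF cocycle_rhom[OF phi_cocycle[OF fc \<kappa>]] cocycle_rhom[OF cocycle_compose_chain_map[OF C.pres_res ph \<phi>]]]
    by blast
qed

lemma pull_value:
  assumes f: "cocycle B T RB f" and q: "q \<in> C.Q2"
  obtains y where "f (\<beta> 2 q) = (phi None f q, y, \<zero>\<^bsub>K\<^esub>)" "y \<in> carrier P" "\<And>i. i \<in> I \<Longrightarrow> y i = phi (Some i) f q"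
proof -
  have "f (\<beta> 2 q) \<in> carrier B" by (rule B.cocycle_closed[OF f \<beta>_closed[OF q]])
  then obtain x y \<mu> where b: "f (\<beta> 2 q) = (x, y, \<mu>)" "y \<in> carrier P" by (rule B_cases)
  have "snd (snd (pull f q)) = \<zero>\<^bsub>K\<^esub>"
    using infl_last_zero[OF _ pres_term[OF C.pres_res] q, of "pull f"] cocycle_rhom[OF pull_cocycle[OF f]] by simp
  then have "\<mu> = \<zero>\<^bsub>K\<^esub>" using b q by (simp add: compose_def)
  then show thesis using that[of y] b q by (simp add: phi_def coord_def)
qed

text \<open>On a value \<open>(x, y, 0)\<close> of a pulled back cocycle, the matrix product with
  \<open>(c, p, \<mu>)\<close> is \<open>(c x, p x + y \<mu>, 0)\<close>. Its first entry gives this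
  lemma, its second one \<open>Phi_lact_Some\<close>.\<close>

lemma Phi_lact_None:
  assumes "\<xi> \<in> carrier B.E" and b: "(c, p, \<mu>) \<in> carrier B"
  shows "Phi None (lact B.E (c, p, \<mu>) \<xi>) = lact C.E c (Phi None \<xi>)"
proof -
  obtain f where f: "cocycle B T RB f" "\<xi> = B.cls f" using assms(1) by (rule B.E_cases)
  have c: "c \<in> carrier C" using b by simp
  have N: "None \<in> ind" by simp
  have "phi None (\<lambda>x\<in>B.Q2. (c, p, \<mu>) \<otimes>\<^bsub>B\<^esub> f x) = (\<lambda>x\<in>C.Q2. c \<otimes>\<^bsub>C\<^esub> phi None f x)"
    unfolding phi_def[of None "\<lambda>x\<in>B.Q2. (c, p, \<mu>) \<otimes>\<^bsub>B\<^esub> f x"]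
  proof (rule restrict_ext)
    fix q assume q: "q \<in> C.Q2"
    obtain y where "f (\<beta> 2 q) = (phi None f q, y, \<zero>\<^bsub>K\<^esub>)" using pull_value[OF f(1) q] by blast
    then show "coord None ((\<lambda>x\<in>B.Q2. (c, p, \<mu>) \<otimes>\<^bsub>B\<^esub> f x) (\<beta> 2 q)) = c \<otimes>\<^bsub>C\<^esub> phi None f q"
      using \<beta>_closed[OF q] by (simp add: coord_def)
  qed
  then show ?thesis
    unfolding f(2) B.ext_lact'[OF b f(1)] Phi_cls[OF f(1) N] Phi_cls[OF B.cocycle_lact[OF b f(1)] N]
      C.ext_lact'[OF c phi_cocycle[OF f(1) N]] by (simp only:)
qed

lemma Phi_lact_Some:
  assumes "\<xi> \<in> carrier B.E" and b: "(c, p, \<mu>) \<in> carrier B" and i: "i \<in> I"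
  shows "Phi (Some i) (lact B.E (c, p, \<mu>) \<xi>) =
    lact C.E (p i) (Phi None \<xi>) \<oplus>\<^bsub>C.E\<^esub> ract C.E (Phi (Some i) \<xi>) (\<mu> \<odot>\<^bsub>C\<^esub> \<one>\<^bsub>C\<^esub>)"
proof -
  obtain f where f: "cocycle B T RB f" "\<xi> = B.cls f" using assms(1) by (rule B.E_cases)
  have p: "p i \<in> carrier C" and \<mu>: "\<mu> \<in> carrier K" using b P_mem[of p i] i by (simp_all del: direct_sum_simps)
  have N: "None \<in> ind" and S: "Some i \<in> ind" using i by simp_all
  note phN = phi_cocycle[OF f(1) N] and phS = phi_cocycle[OF f(1) S]
  have s: "cocycle C Q RC (\<lambda>x\<in>C.Q2. phi (Some i) f x \<otimes>\<^bsub>C\<^esub> (\<mu> \<odot>\<^bsub>C\<^esub> \<one>\<^bsub>C\<^esub>))"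
  proof -
    have "(\<lambda>x\<in>C.Q2. phi (Some i) f x \<otimes>\<^bsub>C\<^esub> (\<mu> \<odot>\<^bsub>C\<^esub> \<one>\<^bsub>C\<^esub>)) = (\<lambda>x\<in>C.Q2. (\<mu> \<odot>\<^bsub>C\<^esub> \<one>\<^bsub>C\<^esub>) \<otimes>\<^bsub>C\<^esub> phi (Some i) f x)"
      by (rule restrict_ext) (simp only: C.scalar_central[OF \<mu> C.cocycle_closed[OF phS]])
    then show ?thesis using C.cocycle_lact[OF C.scalar_closed[OF \<mu>] phS] by (simp only:)
  qed
  have "phi (Some i) (\<lambda>x\<in>B.Q2. (c, p, \<mu>) \<otimes>\<^bsub>B\<^esub> f x) =
      (\<lambda>x\<in>C.Q2. (\<lambda>x\<in>C.Q2. p i \<otimes>\<^bsub>C\<^esub> phi None f x) x \<oplus>\<^bsub>C\<^esub>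
        (\<lambda>x\<in>C.Q2. phi (Some i) f x \<otimes>\<^bsub>C\<^esub> (\<mu> \<odot>\<^bsub>C\<^esub> \<one>\<^bsub>C\<^esub>)) x)"
    unfolding phi_def[of "Some i" "\<lambda>x\<in>B.Q2. (c, p, \<mu>) \<otimes>\<^bsub>B\<^esub> f x"]
  proof (rule restrict_ext)
    fix q assume q: "q \<in> C.Q2"
    obtain y where "f (\<beta> 2 q) = (phi None f q, y, \<zero>\<^bsub>K\<^esub>)" "y i = phi (Some i) f q" using pull_value[OF f(1) q] i by metis
    then show "coord (Some i) ((\<lambda>x\<in>B.Q2. (c, p, \<mu>) \<otimes>\<^bsub>B\<^esub> f x) (\<beta> 2 q)) =
        (\<lambda>x\<in>C.Q2. p i \<otimes>\<^bsub>C\<^esub> phi None f x) q \<oplus>\<^bsub>C\<^esub> (\<lambda>x\<in>C.Q2. phi (Some i) f x \<otimes>\<^bsub>C\<^esub> (\<mu> \<odot>\<^bsub>C\<^esub> \<one>\<^bsub>C\<^esub>)) q"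
      using \<beta>_closed[OF q] q i by (simp add: coord_def)
  qed
  then show ?thesis
    unfolding f(2) B.ext_lact'[OF b f(1)] Phi_cls[OF f(1) N] Phi_cls[OF f(1) S] Phi_cls[OF B.cocycle_lact[OF b f(1)] S]
      C.ext_lact'[OF p phN] C.ext_ract_scalar[OF \<mu> phS] C.ext_add'[OF C.cocycle_lact[OF p phN] s] by (simp only:)
qed

lemma Phi_injective:
  assumes "\<xi> \<in> carrier B.E" "\<eta> \<in> carrier B.E" "\<And>\<kappa>. \<kappa> \<in> ind \<Longrightarrow> Phi \<kappa> \<xi> = Phi \<kappa> \<eta>"
  shows "\<xi> = \<eta>"
proof -
  obtain f where f: "cocycle B T RB f" "\<xi> = B.cls f" using assms(1) by (rule B.E_cases)
  obtain g where g: "cocycle B T RB g" "\<eta> = B.cls g" using assms(2) by (rule B.E_cases)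
  show ?thesis unfolding f(2) g(2) by (rule Phi_inj[OF f(1) g(1)]) (use assms(3) f g in simp)
qed

text \<open>A class fixed by \<open>eps \<kappa>\<close> has a representative with values fixed by
  \<open>eps \<kappa>\<close>: multiply any representative by \<open>eps \<kappa>\<close>. Such
  representatives can be assembled by \<open>Phi_surj\<close>.\<close>

lemma Phi_surjective:
  assumes "\<And>\<kappa>. \<kappa> \<in> ind \<Longrightarrow> x \<kappa> \<in> carrier C.E" "\<And>\<kappa>. \<kappa> \<in> ind \<Longrightarrow> lact C.E (eps \<kappa>) (x \<kappa>) = x \<kappa>"
  shows "\<exists>\<xi>\<in>carrier B.E. \<forall>\<kappa>\<in>ind. Phi \<kappa> \<xi> = x \<kappa>"
proof -
  have "\<exists>g. cocycle C Q RC g \<and> x \<kappa> = C.cls g" if "\<kappa> \<in> ind" for \<kappa>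
    using assms(1)[OF that] C.E_cases by metis
  then obtain g where g: "\<And>\<kappa>. \<kappa> \<in> ind \<Longrightarrow> cocycle C Q RC (g \<kappa>)" "\<And>\<kappa>. \<kappa> \<in> ind \<Longrightarrow> x \<kappa> = C.cls (g \<kappa>)"
    by metis
  let ?h = "\<lambda>\<kappa>. \<lambda>q\<in>C.Q2. eps \<kappa> \<otimes>\<^bsub>C\<^esub> g \<kappa> q"
  have h: "cocycle C Q RC (?h \<kappa>)" if "\<kappa> \<in> ind" for \<kappa>
    by (rule C.cocycle_lact[OF eps_closed[OF that] g(1)[OF that]])
  have "\<epsilon> i \<otimes>\<^bsub>C\<^esub> ?h (Some i) q = ?h (Some i) q" if i: "i \<in> I" and q: "q \<in> C.Q2" for i q
    using q i C.A.m_assoc[OF \<epsilon>_closed[OF i] \<epsilon>_closed[OF i] C.cocycle_closed[OF g(1) q], of "Some i"] \<epsilon>_idem[OF i]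
    by (simp add: eps_def)
  from Phi_surj[OF h this]
  obtain f where f: "cocycle B T RB f" "\<forall>\<kappa>\<in>ind. Phi \<kappa> (B.cls f) = C.cls (?h \<kappa>)" by blast
  have "C.cls (?h \<kappa>) = x \<kappa>" if \<kappa>: "\<kappa> \<in> ind" for \<kappa>
    using assms(2)[OF \<kappa>] C.ext_lact'[OF eps_closed[OF \<kappa>] g(1)[OF \<kappa>]] g(2)[OF \<kappa>] by simp
  then show ?thesis using f B.cls_E[OF f(1)] by (intro bexI[of _ "B.cls f"]) simp_all
qed

section \<open>The isomorphism of algebras\<close>

abbreviation "RelC \<equiv> relation_ext K C"
abbreviation "RelB \<equiv> relation_ext K B"
abbreviation "P' \<equiv> direct_sum I (\<lambda>i. idem_module RelC (relation_ext_idem K C (\<epsilon> i)))"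

lemma RelC_simps [simp]:
  "carrier RelC = carrier C \<times> carrier C.E"
  "(c, g) \<otimes>\<^bsub>RelC\<^esub> (c', g') = (c \<otimes>\<^bsub>C\<^esub> c', lact C.E c g' \<oplus>\<^bsub>C.E\<^esub> ract C.E g c')"
  "(c, g) \<oplus>\<^bsub>RelC\<^esub> (c', g') = (c \<oplus>\<^bsub>C\<^esub> c', g \<oplus>\<^bsub>C.E\<^esub> g')"
  "\<zero>\<^bsub>RelC\<^esub> = (\<zero>\<^bsub>C\<^esub>, \<zero>\<^bsub>C.E\<^esub>)" "\<one>\<^bsub>RelC\<^esub> = (\<one>\<^bsub>C\<^esub>, \<zero>\<^bsub>C.E\<^esub>)"
  "t \<odot>\<^bsub>RelC\<^esub> (c, g) = (t \<odot>\<^bsub>C\<^esub> c, lact C.E (t \<odot>\<^bsub>C\<^esub> \<one>\<^bsub>C\<^esub>) g)"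
  by (simp_all add: relation_ext_def trivial_ext_def)

lemma RelB_simps [simp]:
  "carrier RelB = carrier B \<times> carrier B.E"
  "(b, g) \<otimes>\<^bsub>RelB\<^esub> (b', g') = (b \<otimes>\<^bsub>B\<^esub> b', lact B.E b g' \<oplus>\<^bsub>B.E\<^esub> ract B.E g b')"
  "(b, g) \<oplus>\<^bsub>RelB\<^esub> (b', g') = (b \<oplus>\<^bsub>B\<^esub> b', g \<oplus>\<^bsub>B.E\<^esub> g')"
  "\<one>\<^bsub>RelB\<^esub> = (\<one>\<^bsub>B\<^esub>, \<zero>\<^bsub>B.E\<^esub>)"
  "t \<odot>\<^bsub>RelB\<^esub> (b, g) = (t \<odot>\<^bsub>B\<^esub> b, lact B.E (t \<odot>\<^bsub>B\<^esub> \<one>\<^bsub>B\<^esub>) g)"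
  by (simp_all add: relation_ext_def trivial_ext_def)

lemma idem_RelC_mem:
  assumes i: "i \<in> I"
  shows "(x, \<eta>) \<in> carrier (idem_module RelC (relation_ext_idem K C (\<epsilon> i))) \<longleftrightarrow>
    x \<in> carrier C \<and> \<epsilon> i \<otimes>\<^bsub>C\<^esub> x = x \<and> \<eta> \<in> carrier C.E \<and> lact C.E (\<epsilon> i) \<eta> = \<eta>"
proof -
  note e = \<epsilon>_closed[OF i]
  have mult: "relation_ext_idem K C (\<epsilon> i) \<otimes>\<^bsub>RelC\<^esub> (c, g) = (\<epsilon> i \<otimes>\<^bsub>C\<^esub> c, lact C.E (\<epsilon> i) g)"
    if "c \<in> carrier C" "g \<in> carrier C.E" for c g
    using that C.ext_ract_zero[OF that(1)] C.E_add_zero(1)[OF C.E_lact_closed[OF e that(2)]]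
    by (simp add: relation_ext_idem_def)
  have "(x, \<eta>) \<in> carrier (idem_module RelC (relation_ext_idem K C (\<epsilon> i))) \<longleftrightarrow>
      (\<exists>c\<in>carrier C. \<exists>g\<in>carrier C.E. x = \<epsilon> i \<otimes>\<^bsub>C\<^esub> c \<and> \<eta> = lact C.E (\<epsilon> i) g)"
    unfolding idem_module_def by (auto simp: mult) (metis mult)
  also have "\<dots> \<longleftrightarrow> x \<in> carrier C \<and> \<epsilon> i \<otimes>\<^bsub>C\<^esub> x = x \<and> \<eta> \<in> carrier C.E \<and> lact C.E (\<epsilon> i) \<eta> = \<eta>"
  proof
    assume "\<exists>c\<in>carrier C. \<exists>g\<in>carrier C.E. x = \<epsilon> i \<otimes>\<^bsub>C\<^esub> c \<and> \<eta> = lact C.E (\<epsilon> i) g"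
    then obtain c g where "c \<in> carrier C" "g \<in> carrier C.E" "x = \<epsilon> i \<otimes>\<^bsub>C\<^esub> c" "\<eta> = lact C.E (\<epsilon> i) g" by blast
    then show "x \<in> carrier C \<and> \<epsilon> i \<otimes>\<^bsub>C\<^esub> x = x \<and> \<eta> \<in> carrier C.E \<and> lact C.E (\<epsilon> i) \<eta> = \<eta>"
      using e \<epsilon>_idem[OF i] C.E_lact_closed C.E_lact_mult C.A.m_assoc[OF e e, of c] by simp
  qed metis
  finally show ?thesis .
qed

text \<open>The coordinate \<open>None\<close> of \<xi> joins the entry in \<open>C\<close> to an
  element of \<open>R(C)\<close>; the coordinate of each copy \<open>i\<close> joins
  \<open>p i\<close> to an element of the right ideal of \<open>R(C)\<close> generated by the
  idempotent of that copy. The corner is kept.\<close>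

definition Theta where
  "Theta = (\<lambda>((c, p, \<mu>), \<xi>). ((c, Phi None \<xi>), (\<lambda>i\<in>I. (p i, Phi (Some i) \<xi>)), \<mu>))"

lemma Theta_bij: "bij_betw Theta (carrier RelB) (carrier (one_point_ext K RelC P'))"
proof (rule bij_betw_imageI)
  show "inj_on Theta (carrier RelB)"
  proof (rule inj_onI)
    fix x y assume x: "x \<in> carrier RelB" and y: "y \<in> carrier RelB" and eq: "Theta x = Theta y"
    obtain c p \<mu> \<xi> where x': "x = ((c, p, \<mu>), \<xi>)" "p \<in> carrier P" "\<xi> \<in> carrier B.E"
      using x by (auto simp: B_carrier simp del: direct_sum_simps)
    obtain c' p' \<mu>' \<xi>' where y': "y = ((c', p', \<mu>'), \<xi>')" "p' \<in> carrier P" "\<xi>' \<in> carrier B.E"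
      using y by (auto simp: B_carrier simp del: direct_sum_simps)
    have e: "c = c'" "\<mu> = \<mu>'" "Phi None \<xi> = Phi None \<xi>'"
      "(\<lambda>i\<in>I. (p i, Phi (Some i) \<xi>)) = (\<lambda>i\<in>I. (p' i, Phi (Some i) \<xi>'))"
      using eq by (simp_all add: Theta_def x' y')
    have ei: "p i = p' i \<and> Phi (Some i) \<xi> = Phi (Some i) \<xi>'" if "i \<in> I" for i
      using fun_cong[OF e(4), of i] that by simp
    have "p = p'" using x'(2) y'(2) ei by (auto intro: PiE_ext)
    moreover have "\<xi> = \<xi>'" by (rule Phi_injective[OF x'(3) y'(3)]) (use e(3) ei in auto)
    ultimately show "x = y" using e x' y' by simp
  qed
  show "Theta ` carrier RelB = carrier (one_point_ext K RelC P')"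
  proof
    show "Theta ` carrier RelB \<subseteq> carrier (one_point_ext K RelC P')"
    proof (rule image_subsetI)
      fix x assume "x \<in> carrier RelB"
      then obtain c p \<mu> \<xi> where x: "x = ((c, p, \<mu>), \<xi>)" "c \<in> carrier C" "p \<in> carrier P" "\<mu> \<in> carrier K" "\<xi> \<in> carrier B.E"
        by (auto simp: B_carrier simp del: direct_sum_simps)
      have "Phi (Some i) \<xi> \<in> carrier C.E \<and> lact C.E (\<epsilon> i) (Phi (Some i) \<xi>) = Phi (Some i) \<xi>" if "i \<in> I" for i
        using Phi_closed[OF x(5), of "Some i"] that by (simp add: eps_def)
      then have "(\<lambda>i\<in>I. (p i, Phi (Some i) \<xi>)) \<in> carrier P'"
        using P_mem[OF x(3)] by (simp add: idem_RelC_mem)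
      then show "Theta x \<in> carrier (one_point_ext K RelC P')"
        using x Phi_closed(1)[OF x(5), of None] by (simp add: Theta_def one_point_ext_def)
    qed
    show "carrier (one_point_ext K RelC P') \<subseteq> Theta ` carrier RelB"
    proof
      fix z assume "z \<in> carrier (one_point_ext K RelC P')"
      then obtain c g m \<mu> where z: "z = ((c, g), m, \<mu>)" "c \<in> carrier C" "g \<in> carrier C.E" "m \<in> carrier P'" "\<mu> \<in> carrier K"
        by (auto simp: one_point_ext_def simp del: direct_sum_simps)
      have m: "fst (m i) \<in> carrier C \<and> \<epsilon> i \<otimes>\<^bsub>C\<^esub> fst (m i) = fst (m i) \<and> snd (m i) \<in> carrier C.E \<and>
          lact C.E (\<epsilon> i) (snd (m i)) = snd (m i)" if "i \<in> I" for i
      proof -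
        have "m i \<in> carrier (idem_module RelC (relation_ext_idem K C (\<epsilon> i)))" using z(4) that by auto
        then have "(fst (m i), snd (m i)) \<in> carrier (idem_module RelC (relation_ext_idem K C (\<epsilon> i)))" by simp
        then show ?thesis unfolding idem_RelC_mem[OF that] .
      qed
      let ?x = "\<lambda>\<kappa>. case \<kappa> of None \<Rightarrow> g | Some i \<Rightarrow> snd (m i)"
      \<comment> \<open>\<open>Phi_surjective\<close> asks each component to be fixed by
        \<open>eps \<kappa>\<close>, which is the unit of \<open>C\<close> for
        \<open>None\<close>.\<close>
      have "lact C.E \<one>\<^bsub>C\<^esub> g = g"
      proof -
        obtain h where h: "cocycle C Q RC h" "g = C.cls h" using z(3) by (rule C.E_cases)
        have "(\<lambda>x\<in>C.Q2. \<one>\<^bsub>C\<^esub> \<otimes>\<^bsub>C\<^esub> h x) = (\<lambda>x\<in>C.Q2. h x)"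
          by (rule restrict_ext) (simp add: C.cocycle_closed[OF h(1)])
        then show ?thesis
          unfolding h(2) C.ext_lact'[OF C.A.one_closed h(1)] using rhom_restrict[OF cocycle_rhom[OF h(1)]] by (simp only:)
      qed
      then have "\<exists>\<xi>\<in>carrier B.E. \<forall>\<kappa>\<in>ind. Phi \<kappa> \<xi> = ?x \<kappa>"
        using m z(3) by (intro Phi_surjective) (auto simp: eps_def)
      then obtain \<xi> where \<xi>: "\<xi> \<in> carrier B.E" "Phi None \<xi> = g" "\<And>i. i \<in> I \<Longrightarrow> Phi (Some i) \<xi> = snd (m i)" by auto
      let ?b = "(c, \<lambda>i\<in>I. fst (m i), \<mu>)"
      have "(\<lambda>i\<in>I. fst (m i)) \<in> carrier P"
        using m by (auto simp: idem_module_mem[OF C.ring_A \<epsilon>_closed \<epsilon>_idem])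
      then have b: "(?b, \<xi>) \<in> carrier RelB" using z \<xi>(1) by (simp del: direct_sum_simps)
      have "(\<lambda>i\<in>I. ((\<lambda>i\<in>I. fst (m i)) i, Phi (Some i) \<xi>)) = restrict m I"
        by (rule restrict_ext) (simp add: \<xi>(3))
      also have "\<dots> = m" using z(4) by (simp add: PiE_restrict)
      finally have "Theta (?b, \<xi>) = z" using z(1) \<xi>(2) by (simp add: Theta_def)
      then show "z \<in> Theta ` carrier RelB" using b by blast
    qed
  qed
qed

abbreviation "D \<equiv> one_point_ext K RelC P'"

lemma D_simps:
  "(u, m, \<mu>) \<otimes>\<^bsub>D\<^esub> (u', m', \<mu>') =
    (u \<otimes>\<^bsub>RelC\<^esub> u', ract P' m u' \<oplus>\<^bsub>P'\<^esub> ract P' m' (\<mu> \<odot>\<^bsub>RelC\<^esub> \<one>\<^bsub>RelC\<^esub>), \<mu> \<otimes>\<^bsub>K\<^esub> \<mu>')"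
  "(u, m, \<mu>) \<oplus>\<^bsub>D\<^esub> (u', m', \<mu>') = (u \<oplus>\<^bsub>RelC\<^esub> u', m \<oplus>\<^bsub>P'\<^esub> m', \<mu> \<oplus>\<^bsub>K\<^esub> \<mu>')"
  "\<one>\<^bsub>D\<^esub> = (\<one>\<^bsub>RelC\<^esub>, \<zero>\<^bsub>P'\<^esub>, \<one>\<^bsub>K\<^esub>)"
  "t \<odot>\<^bsub>D\<^esub> (u, m, \<mu>) = (t \<odot>\<^bsub>RelC\<^esub> u, ract P' m (t \<odot>\<^bsub>RelC\<^esub> \<one>\<^bsub>RelC\<^esub>), t \<otimes>\<^bsub>K\<^esub> \<mu>)"
  by (simp_all add: one_point_ext_def)

lemma scalar_RelC: "t \<in> carrier K \<Longrightarrow> t \<odot>\<^bsub>RelC\<^esub> \<one>\<^bsub>RelC\<^esub> = (t \<odot>\<^bsub>C\<^esub> \<one>\<^bsub>C\<^esub>, \<zero>\<^bsub>C.E\<^esub>)"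
  by (simp add: C.E_lact_zero)

theorem relation_ext_one_point_iso: "alg_iso K RelB D"
  unfolding alg_iso_def
proof (intro bexI ballI)
  \<comment> \<open>The field acts on \<open>P'\<close> through
    \<open>(\<mu> \<odot> \<one>, 0)\<close> in \<open>R(C)\<close>; the zero second entry makes it
    act on both components separately.\<close>
  have scal: "(p, g) \<otimes>\<^bsub>RelC\<^esub> (\<mu> \<odot>\<^bsub>C\<^esub> \<one>\<^bsub>C\<^esub>, \<zero>\<^bsub>C.E\<^esub>) = (p \<otimes>\<^bsub>C\<^esub> (\<mu> \<odot>\<^bsub>C\<^esub> \<one>\<^bsub>C\<^esub>), ract C.E g (\<mu> \<odot>\<^bsub>C\<^esub> \<one>\<^bsub>C\<^esub>))"
    if "p \<in> carrier C" "g \<in> carrier C.E" "\<mu> \<in> carrier K" for p g \<mu>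
    using that C.E_add_zero(2)[OF C.E_ract_closed[OF C.scalar_closed[OF that(3)] that(2)]] C.E_lact_zero by simp
  show "Theta (t \<odot>\<^bsub>RelB\<^esub> x) = t \<odot>\<^bsub>D\<^esub> Theta x" if t: "t \<in> carrier K" and x: "x \<in> carrier RelB" for t x
  proof -
    obtain c p \<mu> \<xi> where x: "x = ((c, p, \<mu>), \<xi>)" "c \<in> carrier C" "p \<in> carrier P" "\<mu> \<in> carrier K" "\<xi> \<in> carrier B.E"
      using x by (auto simp: B_carrier simp del: direct_sum_simps)
    have tB: "(t \<odot>\<^bsub>C\<^esub> \<one>\<^bsub>C\<^esub>, \<zero>\<^bsub>P\<^esub>, t) \<in> carrier B" using t P.M.zero_closed by (simp del: direct_sum_simps)
    have N: "Phi None (lact B.E (t \<odot>\<^bsub>C\<^esub> \<one>\<^bsub>C\<^esub>, \<zero>\<^bsub>P\<^esub>, t) \<xi>) = lact C.E (t \<odot>\<^bsub>C\<^esub> \<one>\<^bsub>C\<^esub>) (Phi None \<xi>)"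
      by (rule Phi_lact_None[OF x(5) tB])
    \<comment> \<open>A scalar acts on \<open>Ext\<close> over \<open>B\<close> as the diagonal
      matrix \<open>(t, 0, t)\<close> from the left. By \<open>Phi_lact_Some\<close> its corner acts
      on coordinate \<open>i\<close> from the right, which is how scalars act on
      \<open>P'\<close>.\<close>
    have S: "Phi (Some i) (lact B.E (t \<odot>\<^bsub>C\<^esub> \<one>\<^bsub>C\<^esub>, \<zero>\<^bsub>P\<^esub>, t) \<xi>) = ract C.E (Phi (Some i) \<xi>) (t \<odot>\<^bsub>C\<^esub> \<one>\<^bsub>C\<^esub>)" if i: "i \<in> I" for i
    proof -
      have z: "lact C.E \<zero>\<^bsub>C\<^esub> (Phi None \<xi>) = \<zero>\<^bsub>C.E\<^esub>"
      proof -
        obtain h where h: "cocycle C Q RC h" "Phi None \<xi> = C.cls h" using Phi_closed(1)[OF x(5), of None] by (auto elim: C.E_cases)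
        have "(\<lambda>x\<in>C.Q2. \<zero>\<^bsub>C\<^esub> \<otimes>\<^bsub>C\<^esub> h x) = (\<lambda>x\<in>C.Q2. \<zero>\<^bsub>C\<^esub>)"
          by (rule restrict_ext) (simp add: C.cocycle_closed[OF h(1)])
        then show ?thesis unfolding h(2) C.ext_lact'[OF C.M.zero_closed h(1)] C.ext_zero' by (simp only:)
      qed
      show ?thesis
        using Phi_lact_Some[OF x(5) tB i] i z C.E_add_zero(2)[OF C.E_ract_closed[OF C.scalar_closed[OF t] Phi_closed(1)[OF x(5), of "Some i"]]]
        by simp
    qed
    have "Theta (t \<odot>\<^bsub>RelB\<^esub> x) = ((t \<odot>\<^bsub>C\<^esub> c, lact C.E (t \<odot>\<^bsub>C\<^esub> \<one>\<^bsub>C\<^esub>) (Phi None \<xi>)),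
        (\<lambda>i\<in>I. (p i \<otimes>\<^bsub>C\<^esub> (t \<odot>\<^bsub>C\<^esub> \<one>\<^bsub>C\<^esub>), ract C.E (Phi (Some i) \<xi>) (t \<odot>\<^bsub>C\<^esub> \<one>\<^bsub>C\<^esub>))), t \<otimes>\<^bsub>K\<^esub> \<mu>)"
      unfolding x(1) RelB_simps(5) B_scalar[OF t] B_simps(5) Theta_def prod.case N
      by (simp add: S del: direct_sum_simps(2) cong: restrict_cong)
    also have "\<dots> = t \<odot>\<^bsub>D\<^esub> Theta x"
      using P_mem[OF x(3)] Phi_closed(1)[OF x(5)] t
      by (auto simp: x(1) Theta_def D_simps scalar_RelC scal simp del: RelC_simps(2,5) intro!: restrict_ext)
    finally show ?thesis .
  qed
  show "Theta \<in> ring_iso RelB D"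
  proof (rule ring_iso_memI)
    show "Theta x \<in> carrier D" if "x \<in> carrier RelB" for x using Theta_bij that by (rule bij_betwE[rule_format])
    show "bij_betw Theta (carrier RelB) (carrier D)" by (rule Theta_bij)
    show "Theta \<one>\<^bsub>RelB\<^esub> = \<one>\<^bsub>D\<^esub>"
      using Phi_zero by (simp add: Theta_def D_simps cong: restrict_cong)
    fix x y assume "x \<in> carrier RelB" "y \<in> carrier RelB"
    then obtain c p \<mu> \<xi> c' p' \<mu>' \<xi>' where
      x: "x = ((c, p, \<mu>), \<xi>)" "c \<in> carrier C" "p \<in> carrier P" "\<mu> \<in> carrier K" "\<xi> \<in> carrier B.E" and
      y: "y = ((c', p', \<mu>'), \<xi>')" "c' \<in> carrier C" "p' \<in> carrier P" "\<mu>' \<in> carrier K" "\<xi>' \<in> carrier B.E"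
      by (auto simp: B_carrier simp del: direct_sum_simps)
    show "Theta (x \<oplus>\<^bsub>RelB\<^esub> y) = Theta x \<oplus>\<^bsub>D\<^esub> Theta y"
      using Phi_add[OF x(5) y(5)] by (auto simp: x(1) y(1) Theta_def D_simps intro!: restrict_ext)
    have b: "(c, p, \<mu>) \<in> carrier B" "(c', p', \<mu>') \<in> carrier B" using x y by (simp_all del: direct_sum_simps)
    note cl = B.E_lact_closed[OF b(1) y(5)] B.E_ract_closed[OF b(2) x(5)]
    have N: "Phi None (lact B.E (c, p, \<mu>) \<xi>' \<oplus>\<^bsub>B.E\<^esub> ract B.E \<xi> (c', p', \<mu>')) =
        lact C.E c (Phi None \<xi>') \<oplus>\<^bsub>C.E\<^esub> ract C.E (Phi None \<xi>) c'"
      using Phi_add[OF cl, of None] Phi_lact_None[OF y(5) b(1)] Phi_ract[OF x(5) b(2), of None] by simp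
    \<comment> \<open>In the target, the \<open>i\<close>-th entry is
      \<open>(p i, Phi (Some i) \<xi>)\<close> times \<open>(c', Phi None \<xi>')\<close> plus
      \<open>(p' i, Phi (Some i) \<xi>')\<close> times \<open>(\<mu>, 0)\<close>. Its three terms in
      \<open>E\<close> are those found here, after reordering by commutativity.\<close>
    have S: "Phi (Some i) (lact B.E (c, p, \<mu>) \<xi>' \<oplus>\<^bsub>B.E\<^esub> ract B.E \<xi> (c', p', \<mu>')) =
        lact C.E (p i) (Phi None \<xi>') \<oplus>\<^bsub>C.E\<^esub> ract C.E (Phi (Some i) \<xi>) c' \<oplus>\<^bsub>C.E\<^esub> ract C.E (Phi (Some i) \<xi>') (\<mu> \<odot>\<^bsub>C\<^esub> \<one>\<^bsub>C\<^esub>)"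
      if i: "i \<in> I" for i
    proof -
      have I: "Some i \<in> ind" "None \<in> ind" using i by simp_all
      note u = C.E_lact_closed[OF conjunct1[OF P_mem[OF x(3) i]] Phi_closed(1)[OF y(5) I(2)]]
        C.E_ract_closed[OF C.scalar_closed[OF x(4)] Phi_closed(1)[OF y(5) I(1)]]
        C.E_ract_closed[OF y(2) Phi_closed(1)[OF x(5) I(1)]]
      show ?thesis
        using Phi_add[OF cl I(1)] Phi_lact_Some[OF y(5) b(1) i] Phi_ract[OF x(5) b(2) I(1)]
        by (simp add: C.E_add_assoc u C.E_add_commute[OF u(2,3)])
    qed
    have "Theta (x \<otimes>\<^bsub>RelB\<^esub> y) = ((c \<otimes>\<^bsub>C\<^esub> c', lact C.E c (Phi None \<xi>') \<oplus>\<^bsub>C.E\<^esub> ract C.E (Phi None \<xi>) c'),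
        (\<lambda>i\<in>I. (p i \<otimes>\<^bsub>C\<^esub> c' \<oplus>\<^bsub>C\<^esub> p' i \<otimes>\<^bsub>C\<^esub> (\<mu> \<odot>\<^bsub>C\<^esub> \<one>\<^bsub>C\<^esub>),
          lact C.E (p i) (Phi None \<xi>') \<oplus>\<^bsub>C.E\<^esub> ract C.E (Phi (Some i) \<xi>) c' \<oplus>\<^bsub>C.E\<^esub> ract C.E (Phi (Some i) \<xi>') (\<mu> \<odot>\<^bsub>C\<^esub> \<one>\<^bsub>C\<^esub>))),
        \<mu> \<otimes>\<^bsub>K\<^esub> \<mu>')"
      unfolding x(1) y(1) RelB_simps(2) B_simps(1) Theta_def prod.case N
      by (auto simp: S intro!: restrict_ext)
    also have "\<dots> = Theta x \<otimes>\<^bsub>D\<^esub> Theta y"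
      using P_mem[OF y(3)] Phi_closed(1)[OF y(5)] x(4)
      by (auto simp: x(1) y(1) Theta_def D_simps scalar_RelC C.E_lact_zero C.E_add_zero C.E_ract_closed
          simp del: RelC_simps(5) intro!: restrict_ext)
    finally show "Theta (x \<otimes>\<^bsub>RelB\<^esub> y) = Theta x \<otimes>\<^bsub>D\<^esub> Theta y" .
  qed
qed

end

theorem theorem3p1:
  fixes K :: "'k ring" and C :: "('k, 'a) module"
    and n :: nat and e :: "nat \<Rightarrow> 'a" and a :: "nat \<Rightarrow> nat"
  assumes "algebraically_closed K"
    and "k_algebra K C" and "finite_dim K C"
    and "basic_algebra C"
    and "gl_dim C \<le> 2"
    and "complete_idems C n e"
  shows "alg_iso K
    (relation_ext K (one_point_ext K C (proj_sum C n e a)))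
    (one_point_ext K (relation_ext K C)
      (proj_sum (relation_ext K C) n (\<lambda>j. relation_ext_idem K C (e j)) a))"
proof -
  interpret k_algebra K C by fact
  have fd: "fd_algebra K C"
    by (intro fd_algebra.intro fd_algebra_axioms.intro k_algebra_axioms finite_dim_fin_gen assms(3))
  let ?I = "SIGMA j:{1..n}. {..<a j}"
  \<comment> \<open>The family is constant in \<open>l\<close>: each copy of the projective at
    \<open>j\<close> gets its own index and the same idempotent \<open>e j\<close>.\<close>
  have "idem_ext K C ?I (\<lambda>(j, l). e j)"
    using assms(6) fd
    by (auto intro!: idem_ext.intro idem_ext_axioms.intro simp: complete_idems_def primitive_idem_def)
  then have "alg_iso K
      (relation_ext K (one_point_ext K C (direct_sum ?I (\<lambda>i. idem_module C (case i of (j, l) \<Rightarrow> e j)))))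
      (one_point_ext K (relation_ext K C)
        (direct_sum ?I (\<lambda>i. idem_module (relation_ext K C) (relation_ext_idem K C (case i of (j, l) \<Rightarrow> e j)))))"
    by (rule idem_ext.relation_ext_one_point_iso)
  then show ?thesis
    by (simp add: proj_sum_def case_prod_unfold)
qed

end
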